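(* (The fundamental theorem of Hopf modules.) Let $\mathcal C$ be a closed braided monoidal category equipped with a class $\mathcal Q$ of regular epimorphisms satisfying the standing assumptions in the context. Let $(A,t_1,t_2,t_3,t_4,e)$ be a regular multiplier bimonoid in $\mathcal C$ with non-degenerate multiplication and dense counit ($e\in\mathcal Q$), such that $(A,t_1,t_2,e)$ is a multiplier Hopf monoid (i.e. $t_1,t_2$ are isomorphisms). Assume that, for any Hopf module $(V,v^1,v^3,v_2,v_3)$ over $A$, with $v:=1e.v_2\colon VA\to V$, the morphism $$V\xrightarrow{\ \eta\ }[A,AV]\xrightarrow{[A,c]}[A,VA]\xrightarrow{[A,(v^1)^{-1}]}[A,VA]\xrightarrow{[A,v]}[A,V]$$ factorizes as $V\xrightarrow{p}V^c\xrightarrow{i}[A,V]$ through some object $V^c$, where $p$ is a strong epimorphism and $i$ is an $A$-pure monomorphism. Then the functor $(-)A$ from $\mathcal C$ to the category of $A$-Hopf modules, sending $X$ to the Hopf module $XA$ described in the context, is an equivalence with inverse $(-)^c$.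
   Context: Notation: $\mathcal C$ is a braided monoidal category, written as if strict; the monoidal product (of objects and morphisms) is juxtaposition, the unit is $I$, the braiding is $c_{X,Y}\colon XY\to YX$. The composite of $f\colon A\to B$ and $g\colon B\to C$ is $g.f$ (juxtaposition binds more tightly than the dot); identity morphisms are written $1$; $A^n=A\cdots A$. Subscripts of $c$ are omitted; $c^{-1}\colon XY\to YX$ means $(c_{Y,X})^{-1}$. $\overline{\mathcal C}$ is the same monoidal category with the inverse braiding. Closed means each functor $X(-)$ has a right adjoint $[X,-]$; the unit is $\eta\colon Y\to[X,XY]$. A monomorphism is $A$-pure if it is preserved by taking the monoidal product with $A$. Standing assumptions: $\mathcal Q$ is a class of regular epimorphisms in $\mathcal C$, closed under composition and monoidal product, containing the isomorphisms, right-cancellative ($s\in\mathcal Q$ and $t.s\in\mathcal Q$ imply $t\in\mathcal Q$), and such that each $q\in \mathcal Q$ is the coequalizer of some pair of morphisms for which this coequalizer is preserved by taking the monoidal product with any fixed object. An associative $m\colon A^2\to A$ is non-degenerate if for all objects $X,Y$ the maps $\mathcal C(X,YA)\to\mathcal C(XA,YA)$, $f\mapsto 1m.f1$, and $\mathcal C(X,AY)\to\mathcal C(AX,AY)$, $g\mapsto m1.1g$, are injective. Multiplier bimonoid: $(A,t_1,t_2,e)$ with $t_1,t_2\colon A^2\to A^2$, $e\colon A\to I$ such that $t_11.c^{-1}1.1t_1.c1.1t_1=1t_1.t_11$ and $1e.t_1=1e$; $1t_2.1c^{-1}.t_21.1c.t_21=t_21.1t_2$ and $e1.t_2=e1$;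 $1t_1.t_21=t_21.1t_1$ and $e1.t_1=1e.t_2$. Its multiplication $m:=e1.t_1=1e.t_2$ is associative. A regular multiplier bimonoid in $\mathcal C$ is $(A,t_1,t_2,t_3,t_4,e)$ such that $(A,t_1,t_2,e)$ is a multiplier bimonoid in $\mathcal C$, $(A,t_3,t_4,e)$ is a multiplier bimonoid in $\overline{\mathcal C}$, and, with $m:=e1.t_1$: $e1.t_1=e1.t_3.c$; $1m.c1.1t_1=1m.t_31.c1$; $t_41.1t_1=1t_1.t_41$; $m1.1c.t_21=m1.1t_4.1c$; $1t_3.t_21=t_21.1t_3$. A comodule is $(V,v^1,v^3)$ with $v^1,v^3\colon VA\to VA$ such that $v^11.c^{-1}1.1v^1.c1.1t_1=1t_1.v^11$ and $1e.v^1=1e$; $v^31.c1.1v^3.c^{-1}1.1t_3=1t_3.v^31$ and $1e.v^3=1e$; $1m.c1.1v^1=1m.v^31.c1\colon AVA\to VA$. A morphism of comodules $f\colon V\to W$ satisfies $w^1.f1=f1.v^1$, $w^3.f1=f1.v^3$. (Under the hypotheses of the theorem, $v^1$ is invertible for every comodule.) A module is $(V,v_2,v_3)$ with $v_2\colon VA\to VA$, $v_3\colon AV\to AV$ such that $1t_2.1c^{-1}.v_21.1c.v_21=v_21.1t_2$; $v:=1e.v_2\in\mathcal Q$; $t_31.c1.1v_3.c^{-1}1.1v_3=1v_3.t_31\colon A^2V\to A^2V$; $1t_3.v_21=v_21.1t_3$; $t_21.1v_3=1v_3.t_21$; $1e.v_2=e1.v_3.c$. A morphism of modules $f\colon V\to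 W$ satisfies $w_2.f1=f1.v_2$ and $w_3.1f=1f.v_3$. A Hopf module is $(V,v^1,v^3,v_2,v_3)$ with $(V,v^1,v^3)$ a comodule, $(V,v_2,v_3)$ a module, such that either (equivalently both) of the following hold, where $v=1e.v_2$: $v1.c^{-1}1.1v^1.c1.1t_1=v^1.v1\colon VA^2\to VA$; $v1.1t_3.1c.v^31.1c^{-1}=v^3.v1\colon VA^2\to VA$. A morphism of Hopf modules is a morphism of $\mathcal C$ which is both a module and a comodule morphism. The functor $(-)A$: $X\mapsto XA$ with comodule structure $v^1=1t_1$, $v^3=1t_3$ on $XA^2$, and module structure $v_2=1t_2\colon XA^2\to XA^2$, $v_3=c1.1t_3.c^{-1}1\colon AXA\to XA^2\to XA^2\to AXA$ (with $c=c_{X,A}$); on morphisms $f\mapsto f1$. The functor $(-)^c$ sends a Hopf module $V$ to $V^c$ (well-defined up to isomorphism), and a morphism of Hopf modules $h\colon V\to W$ to the unique morphism $h^c\colon V^c\to W^c$ with $h^c.p=p.h$ (equivalently, with $i.h^c=[A,h].i$). *)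

theory Defs
  imports Main
begin

record ('o, 'a) cat_data =
  Obj :: "'o set"
  Arr :: "'a set"
  Dom :: "'a \<Rightarrow> 'o"
  Cod :: "'a \<Rightarrow> 'o"
  Id :: "'o \<Rightarrow> 'a"  ("\<one>\<index>")
  Comp :: "'a \<Rightarrow> 'a \<Rightarrow> 'a"  (infixl "\<cdot>\<index>" 60)

definition hom :: "('o, 'a, 'm) cat_data_scheme \<Rightarrow> 'o \<Rightarrow> 'o \<Rightarrow> 'a set" where
  "hom C X Y = {f \<in> Arr C. Dom C f = X \<and> Cod C f = Y}"

locale category =
  fixes C :: "('o, 'a, 'm) cat_data_scheme" (structure)
  assumes Dom_Obj: "f \<in> Arr C \<Longrightarrow> Dom C f \<in> Obj C"
    and Cod_Obj: "f \<in> Arr C \<Longrightarrow> Cod C f \<in> Obj C"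
    and Id_hom: "X \<in> Obj C \<Longrightarrow> \<one> X \<in> hom C X X"
    and Comp_hom: "\<lbrakk>f \<in> hom C X Y; g \<in> hom C Y Z\<rbrakk> \<Longrightarrow> g \<cdot> f \<in> hom C X Z"
    and Comp_Id_right: "f \<in> hom C X Y \<Longrightarrow> f \<cdot> \<one> X = f"
    and Comp_Id_left: "f \<in> hom C X Y \<Longrightarrow> \<one> Y \<cdot> f = f"
    and Comp_assoc:
      "\<lbrakk>f \<in> hom C W X; g \<in> hom C X Y; h \<in> hom C Y Z\<rbrakk> \<Longrightarrow> h \<cdot> g \<cdot> f = h \<cdot> (g \<cdot> f)"

context
  fixes C :: "('o, 'a, 'm) cat_data_scheme" (structure)
begin

definition inverse_arrows :: "'a \<Rightarrow> 'a \<Rightarrow> bool" where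
  "inverse_arrows f g \<longleftrightarrow> f \<in> Arr C \<and> g \<in> hom C (Cod C f) (Dom C f) \<and>
     g \<cdot> f = \<one> (Dom C f) \<and> f \<cdot> g = \<one> (Cod C f)"

definition is_iso :: "'a \<Rightarrow> bool" where
  "is_iso f \<longleftrightarrow> (\<exists>g. inverse_arrows f g)"

definition arr_inv :: "'a \<Rightarrow> 'a" where
  "arr_inv f = (THE g. inverse_arrows f g)"

definition is_mono :: "'a \<Rightarrow> bool" where
  "is_mono f \<longleftrightarrow> f \<in> Arr C \<and>
     (\<forall>W. \<forall>g \<in> hom C W (Dom C f). \<forall>h \<in> hom C W (Dom C f). f \<cdot> g = f \<cdot> h \<longrightarrow> g = h)"

definition is_epi :: "'a \<Rightarrow> bool" where
  "is_epi f \<longleftrightarrow> f \<in> Arr C \<and>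
     (\<forall>W. \<forall>g \<in> hom C (Cod C f) W. \<forall>h \<in> hom C (Cod C f) W. g \<cdot> f = h \<cdot> f \<longrightarrow> g = h)"

definition is_strong_epi :: "'a \<Rightarrow> bool" where
  "is_strong_epi p \<longleftrightarrow> is_epi p \<and>
     (\<forall>j f g. is_mono j \<and> f \<in> hom C (Dom C p) (Dom C j) \<and> g \<in> hom C (Cod C p) (Cod C j) \<and>
        j \<cdot> f = g \<cdot> p \<longrightarrow>
        (\<exists>d \<in> hom C (Cod C p) (Dom C j). d \<cdot> p = f \<and> j \<cdot> d = g))"

definition is_coequalizer :: "'a \<Rightarrow> 'a \<Rightarrow> 'a \<Rightarrow> bool" where
  "is_coequalizer f g q \<longleftrightarrow>
     (\<exists>X Y Z. f \<in> hom C X Y \<and> g \<in> hom C X Y \<and> q \<in> hom C Y Z \<and> q \<cdot> f = q \<cdot> g \<and>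
        (\<forall>W. \<forall>h \<in> hom C Y W. h \<cdot> f = h \<cdot> g \<longrightarrow> (\<exists>!k. k \<in> hom C Z W \<and> k \<cdot> q = h)))"

definition is_regular_epi :: "'a \<Rightarrow> bool" where
  "is_regular_epi q \<longleftrightarrow> (\<exists>f g. is_coequalizer f g q)"

end

record ('o, 'a, 'p, 'b) functor_data =
  FObj :: "'o \<Rightarrow> 'p"
  FArr :: "'a \<Rightarrow> 'b"

definition is_functor ::
  "('o, 'a, 'm) cat_data_scheme \<Rightarrow> ('p, 'b, 'n) cat_data_scheme \<Rightarrow> ('o, 'a, 'p, 'b) functor_data \<Rightarrow> bool"
where
  "is_functor C D F \<longleftrightarrow> category C \<and> category D \<and>
     (\<forall>X \<in> Obj C. FObj F X \<in> Obj D) \<and>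
     (\<forall>X Y. \<forall>f \<in> hom C X Y. FArr F f \<in> hom D (FObj F X) (FObj F Y)) \<and>
     (\<forall>X \<in> Obj C. FArr F (\<one>\<^bsub>C\<^esub> X) = \<one>\<^bsub>D\<^esub> (FObj F X)) \<and>
     (\<forall>X Y Z. \<forall>f \<in> hom C X Y. \<forall>g \<in> hom C Y Z. FArr F (g \<cdot>\<^bsub>C\<^esub> f) = FArr F g \<cdot>\<^bsub>D\<^esub> FArr F f)"

definition id_functor :: "('o, 'a, 'o, 'a) functor_data" where
  "id_functor = \<lparr>FObj = \<lambda>X. X, FArr = \<lambda>f. f\<rparr>"

definition comp_functor ::
  "('p, 'b, 'q, 'c) functor_data \<Rightarrow> ('o, 'a, 'p, 'b) functor_data \<Rightarrow> ('o, 'a, 'q, 'c) functor_data"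
where
  "comp_functor G F = \<lparr>FObj = FObj G \<circ> FObj F, FArr = FArr G \<circ> FArr F\<rparr>"

definition is_nat_trans ::
  "('o, 'a, 'm) cat_data_scheme \<Rightarrow> ('p, 'b, 'n) cat_data_scheme \<Rightarrow>
   ('o, 'a, 'p, 'b) functor_data \<Rightarrow> ('o, 'a, 'p, 'b) functor_data \<Rightarrow> ('o \<Rightarrow> 'b) \<Rightarrow> bool"
where
  "is_nat_trans C D F G \<tau> \<longleftrightarrow> is_functor C D F \<and> is_functor C D G \<and>
     (\<forall>X \<in> Obj C. \<tau> X \<in> hom D (FObj F X) (FObj G X)) \<and>
     (\<forall>X Y. \<forall>f \<in> hom C X Y. \<tau> Y \<cdot>\<^bsub>D\<^esub> FArr F f = FArr G f \<cdot>\<^bsub>D\<^esub> \<tau> X)"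

definition is_nat_iso ::
  "('o, 'a, 'm) cat_data_scheme \<Rightarrow> ('p, 'b, 'n) cat_data_scheme \<Rightarrow>
   ('o, 'a, 'p, 'b) functor_data \<Rightarrow> ('o, 'a, 'p, 'b) functor_data \<Rightarrow> ('o \<Rightarrow> 'b) \<Rightarrow> bool"
where
  "is_nat_iso C D F G \<tau> \<longleftrightarrow> is_nat_trans C D F G \<tau> \<and> (\<forall>X \<in> Obj C. is_iso D (\<tau> X))"

definition is_adjunction ::
  "('o, 'a, 'm) cat_data_scheme \<Rightarrow> ('p, 'b, 'n) cat_data_scheme \<Rightarrow>
   ('o, 'a, 'p, 'b) functor_data \<Rightarrow> ('p, 'b, 'o, 'a) functor_data \<Rightarrow>
   ('o \<Rightarrow> 'a) \<Rightarrow> ('p \<Rightarrow> 'b) \<Rightarrow> bool"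
where
  "is_adjunction C D F G \<eta> \<epsilon> \<longleftrightarrow> is_functor C D F \<and> is_functor D C G \<and>
     is_nat_trans C C id_functor (comp_functor G F) \<eta> \<and>
     is_nat_trans D D (comp_functor F G) id_functor \<epsilon> \<and>
     (\<forall>X \<in> Obj C. \<epsilon> (FObj F X) \<cdot>\<^bsub>D\<^esub> FArr F (\<eta> X) = \<one>\<^bsub>D\<^esub> (FObj F X)) \<and>
     (\<forall>Y \<in> Obj D. FArr G (\<epsilon> Y) \<cdot>\<^bsub>C\<^esub> \<eta> (FObj G Y) = \<one>\<^bsub>C\<^esub> (FObj G Y))"

definition equivalence_with_inverse ::
  "('o, 'a, 'm) cat_data_scheme \<Rightarrow> ('p, 'b, 'n) cat_data_scheme \<Rightarrow>
   ('o, 'a, 'p, 'b) functor_data \<Rightarrow> ('p, 'b, 'o, 'a) functor_data \<Rightarrow> bool"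
where
  "equivalence_with_inverse C D F G \<longleftrightarrow> is_functor C D F \<and> is_functor D C G \<and>
     (\<exists>\<tau>. is_nat_iso C C (comp_functor G F) id_functor \<tau>) \<and>
     (\<exists>\<tau>. is_nat_iso D D (comp_functor F G) id_functor \<tau>)"

text \<open>The monoidal structure is not assumed to be strict. The product is written
  \<open>\<odot>\<close> on objects and \<open>\<otimes>\<close> on arrows; \<open>\<a> X Y Z\<close> goes from \<open>(X \<odot> Y) \<odot> Z\<close> to \<open>X \<odot> (Y \<odot> Z)\<close>.\<close>

record ('o, 'a) bmc_data = "('o, 'a) cat_data" +
  TensO :: "'o \<Rightarrow> 'o \<Rightarrow> 'o"  (infixl "\<odot>\<index>" 70)
  TensA :: "'a \<Rightarrow> 'a \<Rightarrow> 'a"  (infixl "\<otimes>\<index>" 70)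
  UnitO :: "'o"  ("\<I>\<index>")
  Assoc :: "'o \<Rightarrow> 'o \<Rightarrow> 'o \<Rightarrow> 'a"  ("\<a>\<index>")
  LUnit :: "'o \<Rightarrow> 'a"  ("\<l>\<index>")
  RUnit :: "'o \<Rightarrow> 'a"  ("\<r>\<index>")
  Braid :: "'o \<Rightarrow> 'o \<Rightarrow> 'a"  ("\<c>\<index>")

locale braided_monoidal_category = category C
  for C :: "('o, 'a, 'm) bmc_data_scheme" (structure) +
  assumes TensO_Obj: "\<lbrakk>X \<in> Obj C; Y \<in> Obj C\<rbrakk> \<Longrightarrow> X \<odot> Y \<in> Obj C"
    and UnitO_Obj: "\<I> \<in> Obj C"
    and TensA_hom:
      "\<lbrakk>f \<in> hom C X Y; f' \<in> hom C X' Y'\<rbrakk> \<Longrightarrow> f \<otimes> f' \<in> hom C (X \<odot> X') (Y \<odot> Y')"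
    and TensA_Id: "\<lbrakk>X \<in> Obj C; Y \<in> Obj C\<rbrakk> \<Longrightarrow> \<one> X \<otimes> \<one> Y = \<one> (X \<odot> Y)"
    and TensA_Comp:
      "\<lbrakk>f \<in> hom C X Y; g \<in> hom C Y Z; f' \<in> hom C X' Y'; g' \<in> hom C Y' Z'\<rbrakk> \<Longrightarrow>
        (g \<cdot> f) \<otimes> (g' \<cdot> f') = g \<otimes> g' \<cdot> f \<otimes> f'"
    and Assoc_hom:
      "\<lbrakk>X \<in> Obj C; Y \<in> Obj C; Z \<in> Obj C\<rbrakk> \<Longrightarrow> \<a> X Y Z \<in> hom C (X \<odot> Y \<odot> Z) (X \<odot> (Y \<odot> Z))"
    and Assoc_iso: "\<lbrakk>X \<in> Obj C; Y \<in> Obj C; Z \<in> Obj C\<rbrakk> \<Longrightarrow> is_iso C (\<a> X Y Z)"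
    and Assoc_nat:
      "\<lbrakk>f \<in> hom C X X'; g \<in> hom C Y Y'; h \<in> hom C Z Z'\<rbrakk> \<Longrightarrow>
        \<a> X' Y' Z' \<cdot> f \<otimes> g \<otimes> h = f \<otimes> (g \<otimes> h) \<cdot> \<a> X Y Z"
    and LUnit_hom: "X \<in> Obj C \<Longrightarrow> \<l> X \<in> hom C (\<I> \<odot> X) X"
    and LUnit_iso: "X \<in> Obj C \<Longrightarrow> is_iso C (\<l> X)"
    and LUnit_nat: "f \<in> hom C X Y \<Longrightarrow> \<l> Y \<cdot> \<one> \<I> \<otimes> f = f \<cdot> \<l> X"
    and RUnit_hom: "X \<in> Obj C \<Longrightarrow> \<r> X \<in> hom C (X \<odot> \<I>) X"
    and RUnit_iso: "X \<in> Obj C \<Longrightarrow> is_iso C (\<r> X)"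
    and RUnit_nat: "f \<in> hom C X Y \<Longrightarrow> \<r> Y \<cdot> f \<otimes> \<one> \<I> = f \<cdot> \<r> X"
    and pentagon:
      "\<lbrakk>W \<in> Obj C; X \<in> Obj C; Y \<in> Obj C; Z \<in> Obj C\<rbrakk> \<Longrightarrow>
        \<one> W \<otimes> \<a> X Y Z \<cdot> \<a> W (X \<odot> Y) Z \<cdot> \<a> W X Y \<otimes> \<one> Z = \<a> W X (Y \<odot> Z) \<cdot> \<a> (W \<odot> X) Y Z"
    and triangle:
      "\<lbrakk>X \<in> Obj C; Y \<in> Obj C\<rbrakk> \<Longrightarrow> \<one> X \<otimes> \<l> Y \<cdot> \<a> X \<I> Y = \<r> X \<otimes> \<one> Y"
    and Braid_hom: "\<lbrakk>X \<in> Obj C; Y \<in> Obj C\<rbrakk> \<Longrightarrow> \<c> X Y \<in> hom C (X \<odot> Y) (Y \<odot> X)"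
    and Braid_iso: "\<lbrakk>X \<in> Obj C; Y \<in> Obj C\<rbrakk> \<Longrightarrow> is_iso C (\<c> X Y)"
    and Braid_nat:
      "\<lbrakk>f \<in> hom C X X'; g \<in> hom C Y Y'\<rbrakk> \<Longrightarrow> \<c> X' Y' \<cdot> f \<otimes> g = g \<otimes> f \<cdot> \<c> X Y"
    and hexagon1:
      "\<lbrakk>X \<in> Obj C; Y \<in> Obj C; Z \<in> Obj C\<rbrakk> \<Longrightarrow>
        \<a> Y Z X \<cdot> \<c> X (Y \<odot> Z) \<cdot> \<a> X Y Z = \<one> Y \<otimes> \<c> X Z \<cdot> \<a> Y X Z \<cdot> \<c> X Y \<otimes> \<one> Z"
    and hexagon2:
      "\<lbrakk>X \<in> Obj C; Y \<in> Obj C; Z \<in> Obj C\<rbrakk> \<Longrightarrow>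
        arr_inv C (\<a> Z X Y) \<cdot> \<c> (X \<odot> Y) Z \<cdot> arr_inv C (\<a> X Y Z) =
        \<c> X Z \<otimes> \<one> Y \<cdot> arr_inv C (\<a> X Z Y) \<cdot> \<one> X \<otimes> \<c> Y Z"

definition braid_inv ::
  "('o, 'a, 'm) bmc_data_scheme \<Rightarrow> 'o \<Rightarrow> 'o \<Rightarrow> 'a"  ("\<c>\<inverse>\<index>")
where
  "\<c>\<inverse>\<^bsub>C\<^esub> X Y = arr_inv C (\<c>\<^bsub>C\<^esub> Y X)"  \<comment> \<open>from \<open>X \<odot> Y\<close> to \<open>Y \<odot> X\<close>\<close>

definition rev_braid :: "('o, 'a, 'm) bmc_data_scheme \<Rightarrow> ('o, 'a, 'm) bmc_data_scheme" where
  "rev_braid C = C\<lparr>Braid := braid_inv C\<rparr>"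

definition tensor_functor ::
  "('o, 'a, 'm) bmc_data_scheme \<Rightarrow> 'o \<Rightarrow> ('o, 'a, 'o, 'a) functor_data"
where
  "tensor_functor C X = \<lparr>FObj = \<lambda>Y. X \<odot>\<^bsub>C\<^esub> Y, FArr = \<lambda>f. \<one>\<^bsub>C\<^esub> X \<otimes>\<^bsub>C\<^esub> f\<rparr>"

record ('o, 'a) cbmc_data = "('o, 'a) bmc_data" +
  IHomO :: "'o \<Rightarrow> 'o \<Rightarrow> 'o"
  IHomA :: "'o \<Rightarrow> 'a \<Rightarrow> 'a"
  Coev :: "'o \<Rightarrow> 'o \<Rightarrow> 'a"  ("\<eta>\<index>")
  Ev :: "'o \<Rightarrow> 'o \<Rightarrow> 'a"

definition ihom_functor ::
  "('o, 'a, 'm) cbmc_data_scheme \<Rightarrow> 'o \<Rightarrow> ('o, 'a, 'o, 'a) functor_data"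
where
  "ihom_functor C X = \<lparr>FObj = IHomO C X, FArr = IHomA C X\<rparr>"

locale closed_braided_monoidal_category = braided_monoidal_category C
  for C :: "('o, 'a, 'm) cbmc_data_scheme" (structure) +
  assumes closed:
    "X \<in> Obj C \<Longrightarrow> is_adjunction C C (tensor_functor C X) (ihom_functor C X) (Coev C X) (Ev C X)"

context
  fixes C :: "('o, 'a, 'm) bmc_data_scheme" (structure)
begin

text \<open>Preservation under the product with an object is required on both sides; in a braided
  monoidal category each side implies the other.\<close>

definition is_pure_mono :: "'o \<Rightarrow> 'a \<Rightarrow> bool" where
  "is_pure_mono A f \<longleftrightarrow> is_mono C f \<and> is_mono C (f \<otimes> \<one> A) \<and> is_mono C (\<one> A \<otimes> f)"

definition admissible_class :: "'a set \<Rightarrow> bool" where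
  "admissible_class Q \<longleftrightarrow>
     (\<forall>q \<in> Q. is_regular_epi C q) \<and>
     (\<forall>p \<in> Q. \<forall>q \<in> Q. Cod C p = Dom C q \<longrightarrow> q \<cdot> p \<in> Q) \<and>
     (\<forall>p \<in> Q. \<forall>q \<in> Q. p \<otimes> q \<in> Q) \<and>
     (\<forall>f. is_iso C f \<longrightarrow> f \<in> Q) \<and>
     (\<forall>s \<in> Q. \<forall>t \<in> Arr C. Cod C s = Dom C t \<and> t \<cdot> s \<in> Q \<longrightarrow> t \<in> Q) \<and>
     (\<forall>q \<in> Q. \<exists>f g. is_coequalizer C f g q \<and>
        (\<forall>X \<in> Obj C. is_coequalizer C (\<one> X \<otimes> f) (\<one> X \<otimes> g) (\<one> X \<otimes> q) \<and>
                     is_coequalizer C (f \<otimes> \<one> X) (g \<otimes> \<one> X) (q \<otimes> \<one> X)))"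

end

text \<open>Threefold products are always bracketed to the left. For \<open>f\<close> from \<open>Y \<odot> Z\<close> to \<open>Y \<odot> Z\<close>,
  \<open>lift23 X Y Z f\<close> is the endomorphism of \<open>(X \<odot> Y) \<odot> Z\<close> written \<open>1f\<close> in strict notation, and
  \<open>mul23 X A m\<close>, \<open>cap_right e X\<close>, \<open>cap_left e X\<close> are \<open>1m\<close> from \<open>(X \<odot> A) \<odot> A\<close> to \<open>X \<odot> A\<close>,
  \<open>1e\<close> from \<open>X \<odot> A\<close> to \<open>X\<close> and \<open>e1\<close> from \<open>A \<odot> X\<close> to \<open>X\<close>.\<close>

context
  fixes C :: "('o, 'a, 'm) bmc_data_scheme" (structure)
begin

definition lift23 :: "'o \<Rightarrow> 'o \<Rightarrow> 'o \<Rightarrow> 'a \<Rightarrow> 'a" where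
  "lift23 X Y Z f = arr_inv C (\<a> X Y Z) \<cdot> \<one> X \<otimes> f \<cdot> \<a> X Y Z"

definition mul23 :: "'o \<Rightarrow> 'o \<Rightarrow> 'a \<Rightarrow> 'a" where
  "mul23 X A m = \<one> X \<otimes> m \<cdot> \<a> X A A"

definition cap_right :: "'a \<Rightarrow> 'o \<Rightarrow> 'a" where
  "cap_right e X = \<r> X \<cdot> \<one> X \<otimes> e"

definition cap_left :: "'a \<Rightarrow> 'o \<Rightarrow> 'a" where
  "cap_left e X = \<l> X \<cdot> e \<otimes> \<one> X"

definition multiplier_bimonoid :: "'o \<Rightarrow> 'a \<Rightarrow> 'a \<Rightarrow> 'a \<Rightarrow> bool" where
  "multiplier_bimonoid A t1 t2 e \<longleftrightarrow>
     A \<in> Obj C \<and> t1 \<in> hom C (A \<odot> A) (A \<odot> A) \<and> t2 \<in> hom C (A \<odot> A) (A \<odot> A) \<and> e \<in> hom C A \<I> \<and>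
     t1 \<otimes> \<one> A \<cdot> \<c>\<inverse> A A \<otimes> \<one> A \<cdot> lift23 A A A t1 \<cdot> \<c> A A \<otimes> \<one> A \<cdot> lift23 A A A t1
       = lift23 A A A t1 \<cdot> t1 \<otimes> \<one> A \<and>
     cap_right e A \<cdot> t1 = cap_right e A \<and>
     lift23 A A A t2 \<cdot> lift23 A A A (\<c>\<inverse> A A) \<cdot> t2 \<otimes> \<one> A \<cdot> lift23 A A A (\<c> A A) \<cdot> t2 \<otimes> \<one> A
       = t2 \<otimes> \<one> A \<cdot> lift23 A A A t2 \<and>
     cap_left e A \<cdot> t2 = cap_left e A \<and>
     lift23 A A A t1 \<cdot> t2 \<otimes> \<one> A = t2 \<otimes> \<one> A \<cdot> lift23 A A A t1 \<and>
     cap_left e A \<cdot> t1 = cap_right e A \<cdot> t2"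

definition multiplier_hopf_monoid :: "'o \<Rightarrow> 'a \<Rightarrow> 'a \<Rightarrow> 'a \<Rightarrow> bool" where
  "multiplier_hopf_monoid A t1 t2 e \<longleftrightarrow>
     multiplier_bimonoid A t1 t2 e \<and> is_iso C t1 \<and> is_iso C t2"

definition nondegenerate :: "'o \<Rightarrow> 'a \<Rightarrow> bool" where
  "nondegenerate A m \<longleftrightarrow>
     (\<forall>X \<in> Obj C. \<forall>Y \<in> Obj C.
        inj_on (\<lambda>f. mul23 Y A m \<cdot> f \<otimes> \<one> A) (hom C X (Y \<odot> A)) \<and>
        inj_on (\<lambda>g. m \<otimes> \<one> Y \<cdot> arr_inv C (\<a> A A Y) \<cdot> \<one> A \<otimes> g) (hom C X (A \<odot> Y)))"

end

record ('o, 'a) mult_data =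
  Car :: "'o"
  T1 :: "'a"
  T2 :: "'a"
  T3 :: "'a"
  T4 :: "'a"
  Counit :: "'a"

definition mult :: "('o, 'a, 'm) bmc_data_scheme \<Rightarrow> ('o, 'a) mult_data \<Rightarrow> 'a" where
  "mult C B = cap_left C (Counit B) (Car B) \<cdot>\<^bsub>C\<^esub> T1 B"

context
  fixes C :: "('o, 'a, 'm) bmc_data_scheme" (structure)
begin

definition regular_multiplier_bimonoid :: "('o, 'a) mult_data \<Rightarrow> bool" where
  "regular_multiplier_bimonoid B \<longleftrightarrow>
     (let A = Car B; t1 = T1 B; t2 = T2 B; t3 = T3 B; t4 = T4 B; e = Counit B; m = mult C B in
       multiplier_bimonoid C A t1 t2 e \<and>
       multiplier_bimonoid (rev_braid C) A t3 t4 e \<and>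
       cap_left C e A \<cdot> t1 = cap_left C e A \<cdot> t3 \<cdot> \<c> A A \<and>
       mul23 C A A m \<cdot> \<c> A A \<otimes> \<one> A \<cdot> lift23 C A A A t1
         = mul23 C A A m \<cdot> t3 \<otimes> \<one> A \<cdot> \<c> A A \<otimes> \<one> A \<and>
       t4 \<otimes> \<one> A \<cdot> lift23 C A A A t1 = lift23 C A A A t1 \<cdot> t4 \<otimes> \<one> A \<and>
       m \<otimes> \<one> A \<cdot> lift23 C A A A (\<c> A A) \<cdot> t2 \<otimes> \<one> A
         = m \<otimes> \<one> A \<cdot> lift23 C A A A t4 \<cdot> lift23 C A A A (\<c> A A) \<and>
       lift23 C A A A t3 \<cdot> t2 \<otimes> \<one> A = t2 \<otimes> \<one> A \<cdot> lift23 C A A A t3)"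

end

text \<open>For a Hopf module \<open>(V, v\<^sup>1, v\<^sup>3, v\<^sub>2, v\<^sub>3)\<close>, the fields \<open>Co1\<close>, \<open>Co3\<close> hold \<open>v\<^sup>1\<close>, \<open>v\<^sup>3\<close>
  and the fields \<open>Ac2\<close>, \<open>Ac3\<close> hold \<open>v\<^sub>2\<close>, \<open>v\<^sub>3\<close>.\<close>

record ('o, 'a) hopf_data =
  HObj :: "'o"
  Co1 :: "'a"
  Co3 :: "'a"
  Ac2 :: "'a"
  Ac3 :: "'a"

context
  fixes C :: "('o, 'a, 'm) bmc_data_scheme" (structure)
begin

definition is_comodule :: "('o, 'a) mult_data \<Rightarrow> 'o \<Rightarrow> 'a \<Rightarrow> 'a \<Rightarrow> bool" where
  "is_comodule B V co1 co3 \<longleftrightarrow>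
     (let A = Car B; t1 = T1 B; t3 = T3 B; e = Counit B; m = mult C B in
       V \<in> Obj C \<and> co1 \<in> hom C (V \<odot> A) (V \<odot> A) \<and> co3 \<in> hom C (V \<odot> A) (V \<odot> A) \<and>
       co1 \<otimes> \<one> A \<cdot> \<c>\<inverse> A V \<otimes> \<one> A \<cdot> lift23 C A V A co1 \<cdot> \<c> V A \<otimes> \<one> A \<cdot> lift23 C V A A t1
         = lift23 C V A A t1 \<cdot> co1 \<otimes> \<one> A \<and>
       cap_right C e V \<cdot> co1 = cap_right C e V \<and>
       co3 \<otimes> \<one> A \<cdot> \<c> A V \<otimes> \<one> A \<cdot> lift23 C A V A co3 \<cdot> \<c>\<inverse> V A \<otimes> \<one> A \<cdot> lift23 C V A A t3
         = lift23 C V A A t3 \<cdot> co3 \<otimes> \<one> A \<and>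
       cap_right C e V \<cdot> co3 = cap_right C e V \<and>
       mul23 C V A m \<cdot> \<c> A V \<otimes> \<one> A \<cdot> lift23 C A V A co1
         = mul23 C V A m \<cdot> co3 \<otimes> \<one> A \<cdot> \<c> A V \<otimes> \<one> A)"

definition is_module :: "'a set \<Rightarrow> ('o, 'a) mult_data \<Rightarrow> 'o \<Rightarrow> 'a \<Rightarrow> 'a \<Rightarrow> bool" where
  "is_module Q B V ac2 ac3 \<longleftrightarrow>
     (let A = Car B; t2 = T2 B; t3 = T3 B; e = Counit B in
       V \<in> Obj C \<and> ac2 \<in> hom C (V \<odot> A) (V \<odot> A) \<and> ac3 \<in> hom C (A \<odot> V) (A \<odot> V) \<and>
       lift23 C V A A t2 \<cdot> lift23 C V A A (\<c>\<inverse> A A) \<cdot> ac2 \<otimes> \<one> A \<cdot> lift23 C V A A (\<c> A A) \<cdot> ac2 \<otimes> \<one> A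
         = ac2 \<otimes> \<one> A \<cdot> lift23 C V A A t2 \<and>
       cap_right C e V \<cdot> ac2 \<in> Q \<and>
       t3 \<otimes> \<one> V \<cdot> \<c> A A \<otimes> \<one> V \<cdot> lift23 C A A V ac3 \<cdot> \<c>\<inverse> A A \<otimes> \<one> V \<cdot> lift23 C A A V ac3
         = lift23 C A A V ac3 \<cdot> t3 \<otimes> \<one> V \<and>
       lift23 C V A A t3 \<cdot> ac2 \<otimes> \<one> A = ac2 \<otimes> \<one> A \<cdot> lift23 C V A A t3 \<and>
       t2 \<otimes> \<one> V \<cdot> lift23 C A A V ac3 = lift23 C A A V ac3 \<cdot> t2 \<otimes> \<one> V \<and>
       cap_right C e V \<cdot> ac2 = cap_left C e V \<cdot> ac3 \<cdot> \<c> V A)"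

definition action :: "('o, 'a) mult_data \<Rightarrow> ('o, 'a) hopf_data \<Rightarrow> 'a" where
  "action B M = cap_right C (Counit B) (HObj M) \<cdot> Ac2 M"

text \<open>Either of the two compatibility conditions suffices; they are equivalent when the
  multiplication is non-degenerate.\<close>

definition hopf_module :: "'a set \<Rightarrow> ('o, 'a) mult_data \<Rightarrow> ('o, 'a) hopf_data \<Rightarrow> bool" where
  "hopf_module Q B M \<longleftrightarrow>
     (let A = Car B; V = HObj M; v = action B M in
       is_comodule B V (Co1 M) (Co3 M) \<and>
       is_module Q B V (Ac2 M) (Ac3 M) \<and>
       (v \<otimes> \<one> A \<cdot> \<c>\<inverse> A V \<otimes> \<one> A \<cdot> lift23 C A V A (Co1 M) \<cdot> \<c> V A \<otimes> \<one> A \<cdot> lift23 C V A A (T1 B)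
          = Co1 M \<cdot> v \<otimes> \<one> A \<or>
        v \<otimes> \<one> A \<cdot> lift23 C V A A (T3 B) \<cdot> lift23 C V A A (\<c> A A) \<cdot> Co3 M \<otimes> \<one> A
            \<cdot> lift23 C V A A (\<c>\<inverse> A A)
          = Co3 M \<cdot> v \<otimes> \<one> A))"

definition comodule_morphism ::
  "('o, 'a) mult_data \<Rightarrow> ('o, 'a) hopf_data \<Rightarrow> ('o, 'a) hopf_data \<Rightarrow> 'a \<Rightarrow> bool"
where
  "comodule_morphism B M N f \<longleftrightarrow> f \<in> hom C (HObj M) (HObj N) \<and>
     Co1 N \<cdot> f \<otimes> \<one> (Car B) = f \<otimes> \<one> (Car B) \<cdot> Co1 M \<and>
     Co3 N \<cdot> f \<otimes> \<one> (Car B) = f \<otimes> \<one> (Car B) \<cdot> Co3 M"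

definition module_morphism ::
  "('o, 'a) mult_data \<Rightarrow> ('o, 'a) hopf_data \<Rightarrow> ('o, 'a) hopf_data \<Rightarrow> 'a \<Rightarrow> bool"
where
  "module_morphism B M N f \<longleftrightarrow> f \<in> hom C (HObj M) (HObj N) \<and>
     Ac2 N \<cdot> f \<otimes> \<one> (Car B) = f \<otimes> \<one> (Car B) \<cdot> Ac2 M \<and>
     Ac3 N \<cdot> \<one> (Car B) \<otimes> f = \<one> (Car B) \<otimes> f \<cdot> Ac3 M"

text \<open>An arrow of the category of Hopf modules carries its domain and codomain.\<close>

definition hopf_cat ::
  "'a set \<Rightarrow> ('o, 'a) mult_data \<Rightarrow>
   (('o, 'a) hopf_data, ('o, 'a) hopf_data \<times> 'a \<times> ('o, 'a) hopf_data) cat_data"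
where
  "hopf_cat Q B =
     \<lparr>Obj = {M. hopf_module Q B M},
      Arr = {(M, f, N). hopf_module Q B M \<and> hopf_module Q B N \<and>
               comodule_morphism B M N f \<and> module_morphism B M N f},
      Dom = (\<lambda>(M, f, N). M),
      Cod = (\<lambda>(M, f, N). N),
      Id = (\<lambda>M. (M, \<one> (HObj M), M)),
      Comp = (\<lambda>(_, g, P) (M, f, _). (M, g \<cdot> f, P))\<rparr>"

definition free_hopf_module :: "('o, 'a) mult_data \<Rightarrow> 'o \<Rightarrow> ('o, 'a) hopf_data" where
  "free_hopf_module B X =
     (let A = Car B in
       \<lparr>HObj = X \<odot> A,
        Co1 = lift23 C X A A (T1 B),
        Co3 = lift23 C X A A (T3 B),
        Ac2 = lift23 C X A A (T2 B),
        Ac3 = \<a> A X A \<cdot> \<c> X A \<otimes> \<one> A \<cdot> lift23 C X A A (T3 B) \<cdot> \<c>\<inverse> A X \<otimes> \<one> A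
                \<cdot> arr_inv C (\<a> A X A)\<rparr>)"

definition free_functor ::
  "('o, 'a) mult_data \<Rightarrow>
   ('o, 'a, ('o, 'a) hopf_data, ('o, 'a) hopf_data \<times> 'a \<times> ('o, 'a) hopf_data) functor_data"
where
  "free_functor B =
     \<lparr>FObj = free_hopf_module B,
      FArr = (\<lambda>f. (free_hopf_module B (Dom C f), f \<otimes> \<one> (Car B), free_hopf_module B (Cod C f)))\<rparr>"

text \<open>\<open>Vc\<close> and \<open>p\<close> choose, for each Hopf module \<open>V\<close>, the object \<open>V\<^sup>c\<close> and the epimorphism from
  \<open>V\<close> to \<open>V\<^sup>c\<close>.\<close>

definition coinvariants_functor ::
  "(('o, 'a) hopf_data \<Rightarrow> 'o) \<Rightarrow> (('o, 'a) hopf_data \<Rightarrow> 'a) \<Rightarrow>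
   (('o, 'a) hopf_data, ('o, 'a) hopf_data \<times> 'a \<times> ('o, 'a) hopf_data, 'o, 'a) functor_data"
where
  "coinvariants_functor Vc p =
     \<lparr>FObj = Vc,
      FArr = (\<lambda>(M, h, N). THE k. k \<in> hom C (Vc M) (Vc N) \<and> k \<cdot> p M = p N \<cdot> h)\<rparr>"

end

context
  fixes C :: "('o, 'a, 'm) cbmc_data_scheme" (structure)
begin

definition coinvariants_map :: "('o, 'a) mult_data \<Rightarrow> ('o, 'a) hopf_data \<Rightarrow> 'a" where
  "coinvariants_map B M =
     (let A = Car B; V = HObj M in
       IHomA C A (action C B M) \<cdot> IHomA C A (arr_inv C (Co1 M)) \<cdot> IHomA C A (\<c> A V) \<cdot> \<eta> A V)"

definition coinvariants_factorization ::
  "('o, 'a) mult_data \<Rightarrow> ('o, 'a) hopf_data \<Rightarrow> 'o \<Rightarrow> 'a \<Rightarrow> 'a \<Rightarrow> bool"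
where
  "coinvariants_factorization B M Vc p i \<longleftrightarrow>
     p \<in> hom C (HObj M) Vc \<and> i \<in> hom C Vc (IHomO C (Car B) (HObj M)) \<and>
     is_strong_epi C p \<and> is_pure_mono C (Car B) i \<and>
     i \<cdot> p = coinvariants_map B M"

end

end

theory Submission
  imports Defs
begin

text \<open>Write \<open>x\<^sub>1 \<otimes> x\<^sub>2 a\<close> for \<open>v\<^sup>1(x \<otimes> a)\<close>. On every comodule \<open>v\<^sup>1\<close> is invertible: with \<open>s(a \<otimes> b) = S(a) b\<close>, read off
  from the inverse of \<open>t\<^sub>1\<close>, one has \<open>S(x\<^sub>1 a) x\<^sub>2 b = S(a) b\<close>, so \<open>v\<^sup>1\<close> is monic, and
  \<open>x\<^sub>1 \<otimes> x\<^sub>2 S(a x\<^sub>3) b = x \<otimes> S(a) b\<close>, so the regular epimorphism \<open>1s\<close> factors through it. The arrow that is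
  factorized is the transpose of \<open>E(x) a = x\<^sub>1 S(x\<^sub>2) a\<close>, and \<open>E(x a) = E(x) e(a)\<close> gives \<open>p(x a) = p(x) e(a)\<close>.
  Hence \<open>x \<otimes> a \<mapsto> p(x\<^sub>1) \<otimes> x\<^sub>2 a\<close> takes \<open>x a \<otimes> b\<close> and \<open>x \<otimes> a b\<close> to the same value, and by non-degeneracy it
  descends along the regular epimorphism \<open>v\<close> to an arrow from \<open>V\<close> to \<open>V\<^sup>c A\<close>, whose inverse is the transpose of \<open>i\<close>.
  On a free module \<open>E\<close> is \<open>1e\<close> followed by a monomorphism, which identifies \<open>(X A)\<^sup>c\<close> with \<open>X\<close>.

  The identities between composites of tensor products are computed in a strict monoidal category of
  ``strands'' in which the given one embeds faithfully.\<close>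

section \<open>Categories\<close>

text \<open>\<open>A\<close> need not have a unit, so in general neither a comultiplication nor an
  antipode is an arrow: only \<open>x\<^sub>1 \<otimes> x\<^sub>2 a\<close>, \<open>S(a) b\<close>
  and \<open>a S(b)\<close> are. Most identities are therefore stated with spare factors attached,
  proved after one more multiplication, and freed of it by non-degeneracy. The test factor may have
  to stand on the side where \<open>v\<^sup>1\<close> does not multiply, and there the companion
  maps enter: \<open>t\<^sub>3(a \<otimes> b)\<close> is
  \<open>a\<^sub>1 \<otimes> b a\<^sub>2\<close> and \<open>v\<^sup>3(x \<otimes> a)\<close> is
  \<open>x\<^sub>1 \<otimes> a x\<^sub>2\<close>; in front of a multiplication the compatibility
  axioms exchange them with \<open>t\<^sub>1\<close> and \<open>v\<^sup>1\<close>. They belong to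
  the reversed braiding, so the lemmas about crossings carry a sign. The other substitute for a unit
  is density. The counit, the actions and the map \<open>S(a) b\<close> lie in \<open>Q\<close>, so
  an equation may be tested after composing with them, and a diagonal fill-in of a strong
  epimorphism against a monomorphism supplies inverses for which no formula is available.\<close>

lemma hom_iff: "f \<in> hom C X Y \<longleftrightarrow> f \<in> Arr C \<and> Dom C f = X \<and> Cod C f = Y"
  by (auto simp: hom_def)

context category
begin

lemma Id_simps [simp]:
  assumes "X \<in> Obj C"
  shows "\<one> X \<in> Arr C" and "Dom C (\<one> X) = X" and "Cod C (\<one> X) = X"
  using Id_hom[OF assms] by (auto simp: hom_iff)

lemma Comp_simps [simp]:
  assumes "f \<in> Arr C" and "g \<in> Arr C" and "Dom C g = Cod C f"
  shows "g \<cdot> f \<in> Arr C" and "Dom C (g \<cdot> f) = Dom C f" and "Cod C (g \<cdot> f) = Cod C g"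
  using Comp_hom[of f "Dom C f" "Cod C f" g "Cod C g"] assms by (auto simp: hom_iff)

lemma Comp_Id [simp]:
  assumes "f \<in> Arr C"
  shows "Dom C f = X \<Longrightarrow> f \<cdot> \<one> X = f" and "Cod C f = X \<Longrightarrow> \<one> X \<cdot> f = f"
  using assms Comp_Id_right[of f X] Comp_Id_left[of f _ X] by (auto simp: hom_iff)

lemma Comp_assoc' [simp]:
  assumes "f \<in> Arr C" and "g \<in> Arr C" and "h \<in> Arr C" and "Dom C g = Cod C f" and "Dom C h = Cod C g"
  shows "h \<cdot> g \<cdot> f = h \<cdot> (g \<cdot> f)"
  using assms Comp_assoc[of f _ "Cod C f" g "Cod C g" h] by (auto simp: hom_iff)

declare Dom_Obj [simp] Cod_Obj [simp]

lemma inverse_arrows_unique: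
  assumes "inverse_arrows C f g" and "inverse_arrows C f h"
  shows "g = h"
proof -
  have "f \<in> Arr C" "g \<in> hom C (Cod C f) (Dom C f)" "h \<in> hom C (Cod C f) (Dom C f)"
    "g \<cdot> f = \<one> (Dom C f)" "f \<cdot> h = \<one> (Cod C f)"
    using assms by (auto simp: inverse_arrows_def)
  then show ?thesis
    using Comp_assoc[of h "Cod C f" "Dom C f" f "Cod C f" g "Dom C f"] Comp_Id_right[of g] Comp_Id_left[of h]
    by (simp add: hom_def)
qed

lemma arr_inv_eq:
  assumes "inverse_arrows C f g"
  shows "arr_inv C f = g"
  unfolding arr_inv_def using assms by (blast intro: the_equality inverse_arrows_unique)

lemma inverse_arrows_arr_inv:
  assumes "is_iso C f"
  shows "inverse_arrows C f (arr_inv C f)"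
  using assms arr_inv_eq by (auto simp: is_iso_def)

lemma arr_inv_simps [simp]:
  assumes "is_iso C f"
  shows "arr_inv C f \<in> Arr C" and "Dom C (arr_inv C f) = Cod C f" and "Cod C (arr_inv C f) = Dom C f"
    and "arr_inv C f \<cdot> f = \<one> (Dom C f)" and "f \<cdot> arr_inv C f = \<one> (Cod C f)"
  using inverse_arrows_arr_inv[OF assms] by (auto simp: inverse_arrows_def hom_iff)

lemma iso_Arr: "is_iso C f \<Longrightarrow> f \<in> Arr C"
  by (auto simp: is_iso_def inverse_arrows_def)

lemma arr_inv_Comp_cancel [simp]:
  assumes "is_iso C f" and "g \<in> Arr C"
  shows "Cod C g = Dom C f \<Longrightarrow> arr_inv C f \<cdot> (f \<cdot> g) = g"
    and "Cod C g = Cod C f \<Longrightarrow> f \<cdot> (arr_inv C f \<cdot> g) = g"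
proof -
  assume "Cod C g = Dom C f"
  then have "arr_inv C f \<cdot> (f \<cdot> g) = arr_inv C f \<cdot> f \<cdot> g"
    using assms iso_Arr by (subst Comp_assoc') auto
  then show "arr_inv C f \<cdot> (f \<cdot> g) = g" using assms \<open>Cod C g = Dom C f\<close> by simp
next
  assume "Cod C g = Cod C f"
  then have "f \<cdot> (arr_inv C f \<cdot> g) = f \<cdot> arr_inv C f \<cdot> g"
    using assms iso_Arr by (subst Comp_assoc') auto
  then show "f \<cdot> (arr_inv C f \<cdot> g) = g" using assms \<open>Cod C g = Cod C f\<close> by simp
qed

lemma iso_arr_inv [simp]:
  assumes "is_iso C f"
  shows "is_iso C (arr_inv C f)" and "arr_inv C (arr_inv C f) = f"
proof -
  have "inverse_arrows C (arr_inv C f) f"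
    using assms iso_Arr[OF assms] by (simp add: inverse_arrows_def hom_iff)
  then show "is_iso C (arr_inv C f)" "arr_inv C (arr_inv C f) = f"
    by (auto simp: is_iso_def arr_inv_eq)
qed

lemma iso_Comp:
  assumes "is_iso C f" and "is_iso C g" and "Dom C g = Cod C f"
  shows "is_iso C (g \<cdot> f)" and "arr_inv C (g \<cdot> f) = arr_inv C f \<cdot> arr_inv C g"
proof -
  have "inverse_arrows C (g \<cdot> f) (arr_inv C f \<cdot> arr_inv C g)"
    using assms iso_Arr[OF assms(1)] iso_Arr[OF assms(2)] by (simp add: inverse_arrows_def hom_iff)
  then show "is_iso C (g \<cdot> f)" "arr_inv C (g \<cdot> f) = arr_inv C f \<cdot> arr_inv C g"
    by (auto simp: is_iso_def arr_inv_eq)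
qed

lemma iso_Id:
  assumes "X \<in> Obj C"
  shows "is_iso C (\<one> X)" and "arr_inv C (\<one> X) = \<one> X"
proof -
  have "inverse_arrows C (\<one> X) (\<one> X)"
    using assms by (simp add: inverse_arrows_def hom_iff)
  then show "is_iso C (\<one> X)" "arr_inv C (\<one> X) = \<one> X"
    by (auto simp: is_iso_def arr_inv_eq)
qed

lemma monoD: "\<lbrakk>is_mono C f; g \<in> hom C W (Dom C f); h \<in> hom C W (Dom C f); f \<cdot> g = f \<cdot> h\<rbrakk> \<Longrightarrow> g = h"
  unfolding is_mono_def by blast

lemma epiD: "\<lbrakk>is_epi C f; g \<in> hom C (Cod C f) W; h \<in> hom C (Cod C f) W; g \<cdot> f = h \<cdot> f\<rbrakk> \<Longrightarrow> g = h"
  unfolding is_epi_def by blast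

lemma iso_mono:
  assumes "is_iso C f"
  shows "is_mono C f"
  unfolding is_mono_def
proof (intro conjI allI ballI impI)
  fix W g h assume g: "g \<in> hom C W (Dom C f)" and h: "h \<in> hom C W (Dom C f)" and "f \<cdot> g = f \<cdot> h"
  then have "arr_inv C f \<cdot> (f \<cdot> g) = arr_inv C f \<cdot> (f \<cdot> h)" by simp
  then show "g = h" using g h assms by (simp add: hom_iff)
qed (use assms in \<open>rule iso_Arr\<close>)

lemma iso_epi:
  assumes "is_iso C f"
  shows "is_epi C f"
  unfolding is_epi_def
proof (intro conjI allI ballI impI)
  fix W g h assume g: "g \<in> hom C (Cod C f) W" and h: "h \<in> hom C (Cod C f) W" and "g \<cdot> f = h \<cdot> f"
  then have "(g \<cdot> f) \<cdot> arr_inv C f = (h \<cdot> f) \<cdot> arr_inv C f" by simp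
  then show "g = h" using g h assms iso_Arr[OF assms] by (simp add: hom_iff)
qed (use assms in \<open>rule iso_Arr\<close>)

section \<open>Coequalizers, regular and strong epimorphisms\<close>

lemma coequalizer_epi:
  assumes "is_coequalizer C f g q"
  shows "is_epi C q"
proof -
  obtain X Y Z where f: "f \<in> hom C X Y" and g: "g \<in> hom C X Y" and q: "q \<in> hom C Y Z"
    and eq: "q \<cdot> f = q \<cdot> g"
    and univ: "\<And>W h. \<lbrakk>h \<in> hom C Y W; h \<cdot> f = h \<cdot> g\<rbrakk> \<Longrightarrow> \<exists>!k. k \<in> hom C Z W \<and> k \<cdot> q = h"
    using assms unfolding is_coequalizer_def by blast
  show ?thesis
    unfolding is_epi_def
  proof (intro conjI allI ballI impI)
    show "q \<in> Arr C" using q by (simp add: hom_iff)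
    fix W k l assume k: "k \<in> hom C (Cod C q) W" and l: "l \<in> hom C (Cod C q) W" and kl: "k \<cdot> q = l \<cdot> q"
    have "k \<cdot> q \<cdot> f = k \<cdot> q \<cdot> g" using f g q k eq by (simp add: hom_iff)
    moreover have "k \<cdot> q \<in> hom C Y W" using q k by (simp add: hom_iff)
    ultimately have "\<exists>!h. h \<in> hom C Z W \<and> h \<cdot> q = k \<cdot> q" using univ by blast
    then show "k = l" using k l kl q by (metis hom_iff)
  qed
qed

text \<open>The pair coequalized by \<open>q\<close> is also identified by the top side of the
  square, because \<open>j\<close> is monic. The universal property then yields the diagonal, and
  \<open>q\<close> being epic gives the second triangle.\<close>

lemma regular_epi_strong:
  assumes "is_regular_epi C q"
  shows "is_strong_epi C q"
proof -
  obtain f g where co: "is_coequalizer C f g q" using assms by (auto simp: is_regular_epi_def)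
  obtain X Y Z where f: "f \<in> hom C X Y" and g: "g \<in> hom C X Y" and q: "q \<in> hom C Y Z"
    and eq: "q \<cdot> f = q \<cdot> g"
    and univ: "\<And>W h. \<lbrakk>h \<in> hom C Y W; h \<cdot> f = h \<cdot> g\<rbrakk> \<Longrightarrow> \<exists>!k. k \<in> hom C Z W \<and> k \<cdot> q = h"
    using co unfolding is_coequalizer_def by blast
  have epi: "is_epi C q" using coequalizer_epi[OF co] .
  show ?thesis
    unfolding is_strong_epi_def
  proof (intro conjI allI impI)
    show "is_epi C q" by (fact epi)
    fix j u v
    assume "is_mono C j \<and> u \<in> hom C (Dom C q) (Dom C j) \<and> v \<in> hom C (Cod C q) (Cod C j) \<and> j \<cdot> u = v \<cdot> q"
    then have j: "is_mono C j" "j \<in> Arr C" and u: "u \<in> hom C Y (Dom C j)" and v: "v \<in> hom C Z (Cod C j)"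
      and sq: "j \<cdot> u = v \<cdot> q" using q by (auto simp: is_mono_def hom_iff)
    have "j \<cdot> (u \<cdot> f) = j \<cdot> u \<cdot> f" using j u f by (simp add: hom_iff)
    also have "\<dots> = v \<cdot> (q \<cdot> g)" using v q f eq sq by (simp add: hom_iff)
    also have "\<dots> = j \<cdot> u \<cdot> g" using v q g sq by (simp add: hom_iff)
    also have "\<dots> = j \<cdot> (u \<cdot> g)" using j u g by (simp add: hom_iff)
    finally have "u \<cdot> f = u \<cdot> g"
      by (rule monoD[OF j(1), of _ X, rotated 2]) (use j u f g in \<open>auto simp: hom_iff\<close>)
    then obtain d where d: "d \<in> hom C Z (Dom C j)" "d \<cdot> q = u" using univ[of u] u by blast
    moreover have "j \<cdot> d = v"
    proof (rule epiD[OF epi, of _ "Cod C j"])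
      show "j \<cdot> d \<cdot> q = v \<cdot> q" using d j u q sq by (simp add: hom_iff)
    qed (use d j v q in \<open>auto simp: hom_iff\<close>)
    ultimately show "\<exists>d\<in>hom C (Cod C q) (Dom C j). d \<cdot> q = u \<and> j \<cdot> d = v"
      using q by (auto simp: hom_iff)
  qed
qed

lemma strong_epi_diagonal:
  assumes "is_strong_epi C q" "is_mono C j" "f \<in> hom C (Dom C q) (Dom C j)" "g \<in> hom C (Cod C q) (Cod C j)"
    and "j \<cdot> f = g \<cdot> q"
  obtains d where "d \<in> hom C (Cod C q) (Dom C j)" "d \<cdot> q = f" "j \<cdot> d = g"
  using assms unfolding is_strong_epi_def by blast

end

section \<open>Braided monoidal categories\<close>

context braided_monoidal_category
begin

declare TensO_Obj [simp] UnitO_Obj [simp]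

lemma TensA_simps [simp]:
  assumes "f \<in> Arr C" and "g \<in> Arr C"
  shows "f \<otimes> g \<in> Arr C" and "Dom C (f \<otimes> g) = Dom C f \<odot> Dom C g"
    and "Cod C (f \<otimes> g) = Cod C f \<odot> Cod C g"
  using TensA_hom[of f "Dom C f" "Cod C f" g "Dom C g" "Cod C g"] assms by (auto simp: hom_iff)

lemma structure_simps [simp]:
  assumes "X \<in> Obj C"
  shows "\<l> X \<in> Arr C" "Dom C (\<l> X) = \<I> \<odot> X" "Cod C (\<l> X) = X"
    and "\<r> X \<in> Arr C" "Dom C (\<r> X) = X \<odot> \<I>" "Cod C (\<r> X) = X"
    and "Y \<in> Obj C \<Longrightarrow> \<c> X Y \<in> Arr C" "Y \<in> Obj C \<Longrightarrow> Dom C (\<c> X Y) = X \<odot> Y"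
        "Y \<in> Obj C \<Longrightarrow> Cod C (\<c> X Y) = Y \<odot> X"
    and "Y \<in> Obj C \<Longrightarrow> Z \<in> Obj C \<Longrightarrow> \<a> X Y Z \<in> Arr C"
        "Y \<in> Obj C \<Longrightarrow> Z \<in> Obj C \<Longrightarrow> Dom C (\<a> X Y Z) = X \<odot> Y \<odot> Z"
        "Y \<in> Obj C \<Longrightarrow> Z \<in> Obj C \<Longrightarrow> Cod C (\<a> X Y Z) = X \<odot> (Y \<odot> Z)"
  using assms LUnit_hom[of X] RUnit_hom[of X] Braid_hom[of X Y] Assoc_hom[of X Y Z]
  by (auto simp: hom_iff)

declare Assoc_iso [simp] LUnit_iso [simp] RUnit_iso [simp] Braid_iso [simp]

lemma braid_inv_simps [simp]:
  assumes "X \<in> Obj C" and "Y \<in> Obj C"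
  shows "\<c>\<inverse> X Y \<in> Arr C" and "Dom C (\<c>\<inverse> X Y) = X \<odot> Y" and "Cod C (\<c>\<inverse> X Y) = Y \<odot> X"
  using assms by (auto simp: braid_inv_def)

lemma TensA_Comp':
  assumes "f \<in> Arr C" "g \<in> Arr C" "f' \<in> Arr C" "g' \<in> Arr C" "Dom C g = Cod C f" "Dom C g' = Cod C f'"
  shows "(g \<otimes> g') \<cdot> (f \<otimes> f') = (g \<cdot> f) \<otimes> (g' \<cdot> f')"
  using assms TensA_Comp[of f _ "Cod C f" g "Cod C g" f' _ "Cod C f'" g'] by (auto simp: hom_iff)

lemma Id_tensor_Comp:
  assumes "X \<in> Obj C" "f \<in> Arr C" "g \<in> Arr C" "Dom C g = Cod C f"
  shows "\<one> X \<otimes> (g \<cdot> f) = \<one> X \<otimes> g \<cdot> \<one> X \<otimes> f"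
    and "(g \<cdot> f) \<otimes> \<one> X = g \<otimes> \<one> X \<cdot> f \<otimes> \<one> X"
  using assms TensA_Comp'[of "\<one> X" "\<one> X" f g] TensA_Comp'[of f g "\<one> X" "\<one> X"] by simp_all

lemma Assoc_nat':
  assumes "f \<in> Arr C" "g \<in> Arr C" "h \<in> Arr C"
  shows "\<a> (Cod C f) (Cod C g) (Cod C h) \<cdot> f \<otimes> g \<otimes> h
    = f \<otimes> (g \<otimes> h) \<cdot> \<a> (Dom C f) (Dom C g) (Dom C h)"
  using assms Assoc_nat[of f _ _ g _ _ h] by (auto simp: hom_iff)

lemma iso_TensA:
  assumes "is_iso C f" and "is_iso C g"
  shows "is_iso C (f \<otimes> g)" and "arr_inv C (f \<otimes> g) = arr_inv C f \<otimes> arr_inv C g"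
proof -
  have "inverse_arrows C (f \<otimes> g) (arr_inv C f \<otimes> arr_inv C g)"
    using assms iso_Arr[OF assms(1)] iso_Arr[OF assms(2)]
    by (simp add: inverse_arrows_def hom_iff TensA_Comp' TensA_Id)
  then show "is_iso C (f \<otimes> g)" "arr_inv C (f \<otimes> g) = arr_inv C f \<otimes> arr_inv C g"
    by (auto simp: is_iso_def arr_inv_eq)
qed

text \<open>Naturality of the right unitor, an isomorphism, recovers \<open>f\<close> from
  \<open>f \<otimes> \<one> \<I>\<close>.\<close>

lemma tensor_unit_faithful:
  assumes f: "f \<in> hom C X Y" and g: "g \<in> hom C X Y" and "f \<otimes> \<one> \<I> = g \<otimes> \<one> \<I>"
  shows "f = g"
proof -
  have X: "X \<in> Obj C" using f by (auto simp: hom_iff)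
  have "f \<cdot> \<r> X = g \<cdot> \<r> X" using RUnit_nat[OF f] RUnit_nat[OF g] assms(3) by metis
  then show ?thesis
    by (rule epiD[OF iso_epi[OF RUnit_iso[OF X]], of _ Y, rotated 2]) (use f g X in \<open>auto simp: hom_iff\<close>)
qed

lemma unit_tensor_faithful:
  assumes f: "f \<in> hom C X Y" and g: "g \<in> hom C X Y" and "\<one> \<I> \<otimes> f = \<one> \<I> \<otimes> g"
  shows "f = g"
proof -
  have X: "X \<in> Obj C" using f by (auto simp: hom_iff)
  have "f \<cdot> \<l> X = g \<cdot> \<l> X" using LUnit_nat[OF f] LUnit_nat[OF g] assms(3) by metis
  then show ?thesis
    by (rule epiD[OF iso_epi[OF LUnit_iso[OF X]], of _ Y, rotated 2]) (use f g X in \<open>auto simp: hom_iff\<close>)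
qed

text \<open>Kelly's unit coherence, a consequence of pentagon and triangle. Both sides are compared
  after tensoring with \<open>\<I>\<close>, where the triangle applies at \<open>Y\<close> and at
  \<open>X \<odot> Y\<close> and the pentagon links the two; tensoring with \<open>\<I>\<close> is
  faithful.\<close>

lemma RUnit_tensor:
  assumes X: "X \<in> Obj C" and Y: "Y \<in> Obj C"
  shows "\<one> X \<otimes> \<r> Y \<cdot> \<a> X Y \<I> = \<r> (X \<odot> Y)"
proof -
  have "\<a> X Y \<I> \<cdot> ((\<one> X \<otimes> \<r> Y \<cdot> \<a> X Y \<I>) \<otimes> \<one> \<I>)
      = \<a> X Y \<I> \<cdot> (\<one> X \<otimes> \<r> Y \<otimes> \<one> \<I>) \<cdot> (\<a> X Y \<I> \<otimes> \<one> \<I>)"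
    using X Y by (simp add: TensA_Comp')
  also have "\<dots> = \<one> X \<otimes> (\<r> Y \<otimes> \<one> \<I>) \<cdot> \<a> X (Y \<odot> \<I>) \<I> \<cdot> (\<a> X Y \<I> \<otimes> \<one> \<I>)"
    using X Y Assoc_nat'[of "\<one> X" "\<r> Y" "\<one> \<I>"] by simp
  also have "\<dots> = \<one> X \<otimes> (\<one> Y \<otimes> \<l> \<I> \<cdot> \<a> Y \<I> \<I>) \<cdot> \<a> X (Y \<odot> \<I>) \<I> \<cdot> (\<a> X Y \<I> \<otimes> \<one> \<I>)"
    using Y by (simp add: triangle)
  also have "\<dots> = \<one> X \<otimes> (\<one> Y \<otimes> \<l> \<I>) \<cdot> (\<one> X \<otimes> \<a> Y \<I> \<I> \<cdot> \<a> X (Y \<odot> \<I>) \<I> \<cdot> (\<a> X Y \<I> \<otimes> \<one> \<I>))"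
    using X Y by (subst Id_tensor_Comp(1)) simp_all
  also have "\<dots> = \<one> X \<otimes> (\<one> Y \<otimes> \<l> \<I>) \<cdot> (\<a> X Y (\<I> \<odot> \<I>) \<cdot> \<a> (X \<odot> Y) \<I> \<I>)"
    using X Y pentagon[of X Y \<I> \<I>] by simp
  also have "\<dots> = (\<one> X \<otimes> (\<one> Y \<otimes> \<l> \<I>) \<cdot> \<a> X Y (\<I> \<odot> \<I>)) \<cdot> \<a> (X \<odot> Y) \<I> \<I>"
    using X Y by simp
  also have "\<dots> = (\<a> X Y \<I> \<cdot> \<one> X \<otimes> \<one> Y \<otimes> \<l> \<I>) \<cdot> \<a> (X \<odot> Y) \<I> \<I>"
    using X Y Assoc_nat'[of "\<one> X" "\<one> Y" "\<l> \<I>"] by simp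
  also have "\<dots> = \<a> X Y \<I> \<cdot> \<r> (X \<odot> Y) \<otimes> \<one> \<I>"
    using X Y triangle[of "X \<odot> Y" \<I>] by (simp add: TensA_Id)
  finally have "(\<one> X \<otimes> \<r> Y \<cdot> \<a> X Y \<I>) \<otimes> \<one> \<I> = \<r> (X \<odot> Y) \<otimes> \<one> \<I>"
    by (rule monoD[OF iso_mono[OF Assoc_iso[of X Y \<I>]], of _ "X \<odot> Y \<odot> \<I> \<odot> \<I>", rotated 5])
      (use X Y in \<open>auto simp: hom_iff\<close>)
  then show ?thesis
    by (rule tensor_unit_faithful[rotated 2]) (use X Y in \<open>auto simp: hom_iff\<close>)
qed

end

section \<open>Strands\<close>

datatype ('o, 'a) strand =
  Strand (sdom: "'o list") (sfam: "('o \<Rightarrow> 'a) option") (scod: "'o list")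

abbreviation sat :: "('o, 'a) strand \<Rightarrow> 'o \<Rightarrow> 'a" where
  "sat f \<equiv> the (sfam f)"

context braided_monoidal_category
begin

definition act :: "'o \<Rightarrow> 'o list \<Rightarrow> 'o" where
  "act W xs = foldl (\<odot>) W xs"

definition whisk :: "'a \<Rightarrow> 'o list \<Rightarrow> 'a" where
  "whisk f xs = foldl (\<lambda>g x. g \<otimes> \<one> x) f xs"

lemma act_simps [simp]: "act W [] = W" "act W (x # xs) = act (W \<odot> x) xs"
  "act W (xs @ ys) = act (act W xs) ys"
  by (auto simp: act_def)

lemma whisk_simps [simp]: "whisk f [] = f" "whisk f (x # xs) = whisk (f \<otimes> \<one> x) xs"
  "whisk f (xs @ ys) = whisk (whisk f xs) ys"
  by (auto simp: whisk_def)

lemma act_Obj [simp]: "W \<in> Obj C \<Longrightarrow> set xs \<subseteq> Obj C \<Longrightarrow> act W xs \<in> Obj C"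
  by (induction xs arbitrary: W) auto

lemma whisk_Arr [simp]:
  assumes "f \<in> Arr C" and "set xs \<subseteq> Obj C"
  shows "whisk f xs \<in> Arr C" and "Dom C (whisk f xs) = act (Dom C f) xs"
    and "Cod C (whisk f xs) = act (Cod C f) xs"
  using assms by (induction xs arbitrary: f) auto

lemma whisk_Id [simp]: "W \<in> Obj C \<Longrightarrow> set xs \<subseteq> Obj C \<Longrightarrow> whisk (\<one> W) xs = \<one> (act W xs)"
  by (induction xs arbitrary: W) (auto simp: TensA_Id)

lemma whisk_Comp:
  assumes "f \<in> Arr C" "g \<in> Arr C" "Dom C g = Cod C f" "set xs \<subseteq> Obj C"
  shows "whisk (g \<cdot> f) xs = whisk g xs \<cdot> whisk f xs"
  using assms by (induction xs arbitrary: f g) (auto simp: Id_tensor_Comp)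

text \<open>A strand of type \<open>xs \<rightarrow> ys\<close> is a natural family of arrows
  \<open>W \<odot> x\<^sub>1 \<odot> \<dots> \<rightarrow> W \<odot> y\<^sub>1 \<odot> \<dots>\<close>, bracketed to the left. Whiskering on the left is a change
  of \<open>W\<close>, so strands form a strict monoidal category. The null family \<open>None\<close> absorbs all ill-typed
  expressions, which makes the laws below unconditional.\<close>

definition natural_family :: "'o list \<Rightarrow> ('o \<Rightarrow> 'a) \<Rightarrow> 'o list \<Rightarrow> bool" where
  "natural_family xs F ys \<longleftrightarrow> set xs \<subseteq> Obj C \<and> set ys \<subseteq> Obj C \<and>
     (\<forall>W \<in> Obj C. F W \<in> hom C (act W xs) (act W ys)) \<and>
     (\<forall>W. W \<notin> Obj C \<longrightarrow> F W = undefined) \<and>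
     (\<forall>g \<in> Arr C. F (Cod C g) \<cdot> whisk g xs = whisk g ys \<cdot> F (Dom C g))"

definition valid :: "('o, 'a) strand \<Rightarrow> bool" where
  "valid f \<longleftrightarrow> sfam f \<noteq> None \<and> natural_family (sdom f) (sat f) (scod f)"

text \<open>The datatype also contains strands whose family is neither null nor natural. The unit
  laws fail for those, while every operation below returns a normal strand.\<close>

definition normal :: "('o, 'a) strand \<Rightarrow> bool" where
  "normal f \<longleftrightarrow> sfam f = None \<or> valid f"

text \<open>The guard \<open>P\<close> chooses between a family and the null value. Fixing the value
  \<open>undefined\<close> off the objects makes strands with the same components equal.\<close>

definition mk :: "'o list \<Rightarrow> bool \<Rightarrow> ('o \<Rightarrow> 'a) \<Rightarrow> 'o list \<Rightarrow> ('o, 'a) strand" where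
  "mk xs P F ys = Strand xs (if P then Some (\<lambda>W. if W \<in> Obj C then F W else undefined) else None) ys"

definition sid :: "'o list \<Rightarrow> ('o, 'a) strand" where
  "sid xs = mk xs (set xs \<subseteq> Obj C) (\<lambda>W. \<one> (act W xs)) xs"

definition scomp :: "('o, 'a) strand \<Rightarrow> ('o, 'a) strand \<Rightarrow> ('o, 'a) strand"  (infixr "\<star>" 65) where
  "g \<star> f = mk (sdom f) (valid g \<and> valid f \<and> scod f = sdom g) (\<lambda>W. sat g W \<cdot> sat f W) (scod g)"

definition swhisk :: "'o list \<Rightarrow> ('o, 'a) strand \<Rightarrow> 'o list \<Rightarrow> ('o, 'a) strand"
  ("_ \<lhd> _ \<rhd> _" [72, 72, 72] 71) where
  "xs \<lhd> f \<rhd> ys = mk (xs @ sdom f @ ys) (valid f \<and> set xs \<subseteq> Obj C \<and> set ys \<subseteq> Obj C)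
     (\<lambda>W. whisk (sat f (act W xs)) ys) (xs @ scod f @ ys)"

abbreviation swhisk_left :: "'o list \<Rightarrow> ('o, 'a) strand \<Rightarrow> ('o, 'a) strand"  ("_ \<lhd> _" [72, 72] 71) where
  "xs \<lhd> f \<equiv> xs \<lhd> f \<rhd> []"

abbreviation swhisk_right :: "('o, 'a) strand \<Rightarrow> 'o list \<Rightarrow> ('o, 'a) strand"  ("_ \<rhd> _" [72, 72] 71) where
  "f \<rhd> ys \<equiv> [] \<lhd> f \<rhd> ys"

lemma mk_simps [simp]: "sdom (mk xs P F ys) = xs" "scod (mk xs P F ys) = ys"
  "sfam (mk xs P F ys) = None \<longleftrightarrow> \<not> P"
  by (auto simp: mk_def)

lemma sat_mk [simp]: "P \<Longrightarrow> W \<in> Obj C \<Longrightarrow> sat (mk xs P F ys) W = F W"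
  by (simp add: mk_def)

lemma validD:
  assumes "valid f"
  shows "set (sdom f) \<subseteq> Obj C" and "set (scod f) \<subseteq> Obj C"
    and "W \<in> Obj C \<Longrightarrow> sat f W \<in> Arr C" and "W \<in> Obj C \<Longrightarrow> Dom C (sat f W) = act W (sdom f)"
    and "W \<in> Obj C \<Longrightarrow> Cod C (sat f W) = act W (scod f)"
    and "g \<in> Arr C \<Longrightarrow> sat f (Cod C g) \<cdot> whisk g (sdom f) = whisk g (scod f) \<cdot> sat f (Dom C g)"
  using assms by (auto simp: valid_def natural_family_def hom_iff)

lemma valid_mkI:
  assumes P and "set xs \<subseteq> Obj C" and "set ys \<subseteq> Obj C"
    and "\<And>W. W \<in> Obj C \<Longrightarrow> F W \<in> hom C (act W xs) (act W ys)"
    and "\<And>g. g \<in> Arr C \<Longrightarrow> F (Cod C g) \<cdot> whisk g xs = whisk g ys \<cdot> F (Dom C g)"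
  shows "valid (mk xs P F ys)"
  using assms by (auto simp: valid_def natural_family_def mk_def)

lemma valid_imp_fam: "valid f \<Longrightarrow> sfam f \<noteq> None"
  by (simp add: valid_def)

lemma strand_eqI:
  assumes "normal f" "normal g" "sdom f = sdom g" "scod f = scod g"
    and "valid f \<longleftrightarrow> valid g"
    and "\<And>W. valid f \<Longrightarrow> valid g \<Longrightarrow> W \<in> Obj C \<Longrightarrow> sat f W = sat g W"
  shows "f = g"
proof (cases "valid f")
  case True
  then have "valid g" using assms by blast
  have "sat f W = sat g W" for W
    using assms(6)[OF True \<open>valid g\<close>, of W] True \<open>valid g\<close>
    by (cases "W \<in> Obj C") (auto simp: valid_def natural_family_def)
  then have "sfam f = sfam g"
    using True \<open>valid g\<close> by (metis ext option.expand valid_imp_fam)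
  then show ?thesis using assms by (cases f; cases g) auto
next
  case False
  then have "sfam f = None" "sfam g = None" using assms by (auto simp: normal_def)
  then show ?thesis using assms by (cases f; cases g) auto
qed

lemma valid_sid [simp]: "valid (sid xs) \<longleftrightarrow> set xs \<subseteq> Obj C"
proof
  show "valid (sid xs) \<Longrightarrow> set xs \<subseteq> Obj C" by (auto simp: valid_def sid_def)
  show "set xs \<subseteq> Obj C \<Longrightarrow> valid (sid xs)"
    unfolding sid_def by (rule valid_mkI) (auto simp: hom_iff)
qed

lemma scomp_ends [simp]: "sdom (g \<star> f) = sdom f" "scod (g \<star> f) = scod g"
  by (simp_all add: scomp_def)

lemma swhisk_ends [simp]: "sdom (xs \<lhd> f \<rhd> ys) = xs @ sdom f @ ys" "scod (xs \<lhd> f \<rhd> ys) = xs @ scod f @ ys"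
  by (simp_all add: swhisk_def)

lemma sid_ends [simp]: "sdom (sid xs) = xs" "scod (sid xs) = xs"
  by (simp_all add: sid_def)

lemma valid_scomp [simp]: "valid (g \<star> f) \<longleftrightarrow> valid g \<and> valid f \<and> scod f = sdom g"
proof
  show "valid (g \<star> f) \<Longrightarrow> valid g \<and> valid f \<and> scod f = sdom g"
    using valid_imp_fam[of "g \<star> f"] by (simp add: scomp_def)
next
  assume *: "valid g \<and> valid f \<and> scod f = sdom g"
  then have g: "valid g" and f: "valid f" and m: "sdom g = scod f" by auto
  show "valid (g \<star> f)"
    unfolding scomp_def
  proof (rule valid_mkI)
    show "valid g \<and> valid f \<and> scod f = sdom g" by (fact *)
  next
    fix h assume h: "h \<in> Arr C"
    then have o: "Dom C h \<in> Obj C" "Cod C h \<in> Obj C" by auto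
    note s = validD[OF f] validD(1,2,3,4,5)[OF g] h o m
    have "(sat g (Cod C h) \<cdot> sat f (Cod C h)) \<cdot> whisk h (sdom f)
        = sat g (Cod C h) \<cdot> (sat f (Cod C h) \<cdot> whisk h (sdom f))"
      using s by (simp del: validD(6))
    also have "\<dots> = sat g (Cod C h) \<cdot> whisk h (scod f) \<cdot> sat f (Dom C h)"
      using s by simp
    also have "\<dots> = whisk h (scod g) \<cdot> sat g (Dom C h) \<cdot> sat f (Dom C h)"
      using validD(6)[OF g h] m by simp
    finally show "sat g (Cod C h) \<cdot> sat f (Cod C h) \<cdot> whisk h (sdom f)
        = whisk h (scod g) \<cdot> (sat g (Dom C h) \<cdot> sat f (Dom C h))"
      using s by simp
  qed (use validD[OF f] validD[OF g] m in \<open>auto simp: hom_iff\<close>)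
qed

lemma sat_scomp [simp]:
  "valid g \<Longrightarrow> valid f \<Longrightarrow> scod f = sdom g \<Longrightarrow> W \<in> Obj C \<Longrightarrow> sat (g \<star> f) W = sat g W \<cdot> sat f W"
  by (simp add: scomp_def)

lemma sat_sid [simp]: "set xs \<subseteq> Obj C \<Longrightarrow> W \<in> Obj C \<Longrightarrow> sat (sid xs) W = \<one> (act W xs)"
  by (simp add: sid_def)

lemma valid_swhisk [simp]:
  "valid (xs \<lhd> f \<rhd> ys) \<longleftrightarrow> valid f \<and> set xs \<subseteq> Obj C \<and> set ys \<subseteq> Obj C"
proof
  show "valid (xs \<lhd> f \<rhd> ys) \<Longrightarrow> valid f \<and> set xs \<subseteq> Obj C \<and> set ys \<subseteq> Obj C"
    using valid_imp_fam[of "xs \<lhd> f \<rhd> ys"] by (simp add: swhisk_def)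
next
  assume *: "valid f \<and> set xs \<subseteq> Obj C \<and> set ys \<subseteq> Obj C"
  then have f: "valid f" and xs: "set xs \<subseteq> Obj C" and ys: "set ys \<subseteq> Obj C" by auto
  show "valid (xs \<lhd> f \<rhd> ys)"
    unfolding swhisk_def
  proof (rule valid_mkI)
    show "valid f \<and> set xs \<subseteq> Obj C \<and> set ys \<subseteq> Obj C" by (fact *)
  next
    fix h assume h: "h \<in> Arr C"
    then have o: "Dom C h \<in> Obj C" "Cod C h \<in> Obj C" by auto
    have "sat f (act (Cod C h) xs) \<cdot> whisk (whisk h xs) (sdom f)
        = whisk (whisk h xs) (scod f) \<cdot> sat f (act (Dom C h) xs)"
      using validD(6)[OF f, of "whisk h xs"] h xs by simp
    then have "whisk (sat f (act (Cod C h) xs)) ys \<cdot> whisk (whisk (whisk h xs) (sdom f)) ys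
        = whisk (whisk (whisk h xs) (scod f)) ys \<cdot> whisk (sat f (act (Dom C h) xs)) ys"
      using validD[OF f] h o xs ys by (simp add: whisk_Comp[symmetric])
    then show "whisk (sat f (act (Cod C h) xs)) ys \<cdot> whisk h (xs @ sdom f @ ys)
        = whisk h (xs @ scod f @ ys) \<cdot> whisk (sat f (act (Dom C h) xs)) ys"
      by simp
  qed (use validD[OF f] xs ys in \<open>auto simp: hom_iff\<close>)
qed

lemma sat_swhisk [simp]:
  "\<lbrakk>valid f; set xs \<subseteq> Obj C; set ys \<subseteq> Obj C; W \<in> Obj C\<rbrakk> \<Longrightarrow>
    sat (xs \<lhd> f \<rhd> ys) W = whisk (sat f (act W xs)) ys"
  by (simp add: swhisk_def)

lemma normal_simps [simp]: "normal (g \<star> f)" "normal (sid xs)" "normal (xs \<lhd> f \<rhd> ys)"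
  unfolding normal_def valid_scomp valid_sid valid_swhisk
  by (auto simp: scomp_def sid_def swhisk_def)

lemma valid_normal [simp]: "valid f \<Longrightarrow> normal f"
  by (simp add: normal_def)

lemma scomp_assoc [simp]: "(h \<star> g) \<star> f = h \<star> (g \<star> f)"
  by (rule strand_eqI) (auto simp: validD)

lemma sid_scomp [simp]: "normal f \<Longrightarrow> scod f = ys \<Longrightarrow> sid ys \<star> f = f"
  by (rule strand_eqI) (auto simp: validD dest: validD(2))

lemma scomp_sid [simp]: "normal f \<Longrightarrow> sdom f = xs \<Longrightarrow> f \<star> sid xs = f"
  by (rule strand_eqI) (auto simp: validD dest: validD(1))

lemma swhisk_sid [simp]: "set xs \<subseteq> Obj C \<Longrightarrow> set zs \<subseteq> Obj C \<Longrightarrow> xs \<lhd> sid ys \<rhd> zs = sid (xs @ ys @ zs)"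
  by (rule strand_eqI) auto

lemma swhisk_scomp [simp]: "xs \<lhd> (g \<star> f) \<rhd> ys = xs \<lhd> g \<rhd> ys \<star> xs \<lhd> f \<rhd> ys"
  by (rule strand_eqI) (auto simp: validD whisk_Comp)

lemma swhisk_swhisk [simp]: "xs \<lhd> (xs' \<lhd> f \<rhd> ys') \<rhd> ys = (xs @ xs') \<lhd> f \<rhd> (ys' @ ys)"
  by (rule strand_eqI) auto

lemma swhisk_Nil [simp]: "normal f \<Longrightarrow> [] \<lhd> f \<rhd> [] = f"
  by (rule strand_eqI) auto

text \<open>Naturality of \<open>g\<close> in its parameter, taken at the whiskered component of
  \<open>f\<close>, is the interchange law. This is why the families are required to be
  natural.\<close>

lemma interchange:
  "(xs @ scod f @ ys) \<lhd> g \<rhd> zs \<star> xs \<lhd> f \<rhd> (ys @ sdom g @ zs)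
    = xs \<lhd> f \<rhd> (ys @ scod g @ zs) \<star> (xs @ sdom f @ ys) \<lhd> g \<rhd> zs"
proof (rule strand_eqI)
  fix W assume "valid ((xs @ scod f @ ys) \<lhd> g \<rhd> zs \<star> xs \<lhd> f \<rhd> (ys @ sdom g @ zs))" and W: "W \<in> Obj C"
  then have f: "valid f" and g: "valid g" and s: "set xs \<subseteq> Obj C" "set ys \<subseteq> Obj C" "set zs \<subseteq> Obj C" by auto
  note v = validD(1-5)[OF f] validD(1-5)[OF g] s W
  let ?h = "whisk (sat f (act W xs)) ys"
  have "sat g (Cod C ?h) \<cdot> whisk ?h (sdom g) = whisk ?h (scod g) \<cdot> sat g (Dom C ?h)"
    by (rule validD(6)[OF g]) (use v in simp)
  then have "whisk (sat g (Cod C ?h)) zs \<cdot> whisk (whisk ?h (sdom g)) zs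
      = whisk (whisk ?h (scod g)) zs \<cdot> whisk (sat g (Dom C ?h)) zs"
    using v by (simp add: whisk_Comp[symmetric])
  then show "sat ((xs @ scod f @ ys) \<lhd> g \<rhd> zs \<star> xs \<lhd> f \<rhd> (ys @ sdom g @ zs)) W
      = sat (xs \<lhd> f \<rhd> (ys @ scod g @ zs) \<star> (xs @ sdom f @ ys) \<lhd> g \<rhd> zs) W"
    using f g v by simp
qed (auto dest: validD)

end

section \<open>Arrows as strands\<close>

context braided_monoidal_category
begin

section \<open>Rebracketing a list of objects against a parameter object\<close>

definition br :: "'o list \<Rightarrow> 'o" where
  "br xs = act (hd xs) (tl xs)"

text \<open>\<open>k\<close> is the rebracketing reached so far, with codomain
  \<open>W \<odot> Y\<close>; each further letter joins the right factor at the cost of one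
  associator. The accumulator follows the left bracketing of \<open>act\<close>.\<close>

primrec kap_acc :: "'o \<Rightarrow> 'o \<Rightarrow> 'a \<Rightarrow> 'o list \<Rightarrow> 'a" where
  "kap_acc W Y k [] = k"
| "kap_acc W Y k (y # ys) = kap_acc W (Y \<odot> y) (\<a> W Y y \<cdot> k \<otimes> \<one> y) ys"

definition kap :: "'o \<Rightarrow> 'o list \<Rightarrow> 'a" where
  "kap W xs = kap_acc W (hd xs) (\<one> (W \<odot> hd xs)) (tl xs)"

lemma br_simps [simp]: "br [x] = x" "br (x # y # ys) = act x (y # ys)"
  by (auto simp: br_def)

lemma br_Cons: "br (x # xs) = act x xs"
  by (simp add: br_def)

lemma br_snoc [simp]: "xs \<noteq> [] \<Longrightarrow> br (xs @ ys) = act (br xs) ys"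
  by (cases xs) (auto simp: br_Cons)

lemma br_Obj [simp]: "xs \<noteq> [] \<Longrightarrow> set xs \<subseteq> Obj C \<Longrightarrow> br xs \<in> Obj C"
  by (cases xs) (auto simp: br_Cons)

lemma kap_acc_iso:
  assumes "is_iso C k" "Cod C k = W \<odot> Y" "W \<in> Obj C" "Y \<in> Obj C" "set ys \<subseteq> Obj C"
  shows "is_iso C (kap_acc W Y k ys) \<and> Dom C (kap_acc W Y k ys) = act (Dom C k) ys \<and>
    Cod C (kap_acc W Y k ys) = W \<odot> act Y ys"
  using assms
proof (induction ys arbitrary: Y k)
  case (Cons y ys)
  then have "k \<in> Arr C" using iso_Arr by blast
  then show ?case
    using Cons.prems Cons.IH[of "\<a> W Y y \<cdot> k \<otimes> \<one> y" "Y \<odot> y"] by (simp add: iso_Comp iso_TensA iso_Id)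
qed simp

lemma kap_acc_nat:
  assumes "k \<in> Arr C" "k' \<in> Arr C" "Cod C k = Dom C g \<odot> Y" "Cod C k' = Cod C g \<odot> Y"
    and "g \<in> Arr C" "h \<in> Arr C" "Dom C h = Dom C k" "Cod C h = Dom C k'"
    and "k' \<cdot> h = g \<otimes> \<one> Y \<cdot> k" "Y \<in> Obj C" "set ys \<subseteq> Obj C"
  shows "kap_acc (Cod C g) Y k' ys \<cdot> whisk h ys = g \<otimes> \<one> (act Y ys) \<cdot> kap_acc (Dom C g) Y k ys"
  using assms
proof (induction ys arbitrary: Y k k' h)
  case (Cons y ys)
  let ?k = "\<a> (Dom C g) Y y \<cdot> k \<otimes> \<one> y" and ?k' = "\<a> (Cod C g) Y y \<cdot> k' \<otimes> \<one> y"
  have o: "Dom C g \<in> Obj C" "Cod C g \<in> Obj C" "y \<in> Obj C" using Cons.prems by auto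
  have "?k' \<cdot> h \<otimes> \<one> y = \<a> (Cod C g) Y y \<cdot> (k' \<cdot> h) \<otimes> \<one> y"
    using Cons.prems(1-8,10-) o by (simp add: Id_tensor_Comp)
  also have "\<dots> = (\<a> (Cod C g) Y y \<cdot> g \<otimes> \<one> Y \<otimes> \<one> y) \<cdot> k \<otimes> \<one> y"
    unfolding Cons.prems(9) using Cons.prems(1-8,10-) o by (simp add: Id_tensor_Comp)
  also have "\<a> (Cod C g) Y y \<cdot> g \<otimes> \<one> Y \<otimes> \<one> y = g \<otimes> \<one> (Y \<odot> y) \<cdot> \<a> (Dom C g) Y y"
    using Assoc_nat'[of g "\<one> Y" "\<one> y"] Cons.prems o by (simp add: TensA_Id)
  finally have "?k' \<cdot> h \<otimes> \<one> y = g \<otimes> \<one> (Y \<odot> y) \<cdot> ?k" using Cons.prems o by simp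
  then show ?case
    using Cons.prems o Cons.IH[where k = ?k and k' = ?k' and h = "h \<otimes> \<one> y"] by simp
qed simp

lemma kap_acc_snoc: "kap_acc W Y k (ys @ [y]) = \<a> W (act Y ys) y \<cdot> kap_acc W Y k ys \<otimes> \<one> y"
  by (induction ys arbitrary: Y k) auto

text \<open>One pentagon per letter. The free starting arrows \<open>k\<close>, \<open>l\<close>,
  \<open>n\<close> make the induction possible: the relation between them in the last assumption is
  what passes from one letter to the next.\<close>

lemma kap_acc_coherent:
  assumes "W \<in> Obj C" "X \<in> Obj C" "Y \<in> Obj C" "P \<in> Obj C" "set ys \<subseteq> Obj C"
    and "is_iso C k" "Dom C k = U" "Cod C k = W \<odot> P"
    and "is_iso C l" "Dom C l = P" "Cod C l = X \<odot> Y"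
    and "is_iso C n" "Dom C n = U" "Cod C n = W \<odot> X \<odot> Y"
    and "\<one> W \<otimes> l \<cdot> k = \<a> W X Y \<cdot> n"
  shows "\<one> W \<otimes> kap_acc X Y l ys \<cdot> kap_acc W P k ys = \<a> W X (act Y ys) \<cdot> kap_acc (W \<odot> X) Y n ys"
  using assms
proof (induction ys arbitrary: P Y U k l n)
  case (Cons y ys)
  note p = Cons.prems(1-14) iso_Arr[OF Cons.prems(6)] iso_Arr[OF Cons.prems(9)] iso_Arr[OF Cons.prems(12)]
  have y: "y \<in> Obj C" using p by simp
  let ?k = "\<a> W P y \<cdot> k \<otimes> \<one> y" and ?l = "\<a> X Y y \<cdot> l \<otimes> \<one> y" and ?n = "\<a> (W \<odot> X) Y y \<cdot> n \<otimes> \<one> y"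
  have "\<one> W \<otimes> ?l \<cdot> ?k = \<one> W \<otimes> \<a> X Y y \<cdot> (\<one> W \<otimes> (l \<otimes> \<one> y) \<cdot> \<a> W P y) \<cdot> k \<otimes> \<one> y"
    using p y by (simp add: Id_tensor_Comp)
  also have "\<one> W \<otimes> (l \<otimes> \<one> y) \<cdot> \<a> W P y = \<a> W (X \<odot> Y) y \<cdot> \<one> W \<otimes> l \<otimes> \<one> y"
    using Assoc_nat'[of "\<one> W" l "\<one> y"] p y by simp
  also have "\<one> W \<otimes> \<a> X Y y \<cdot> (\<a> W (X \<odot> Y) y \<cdot> \<one> W \<otimes> l \<otimes> \<one> y) \<cdot> k \<otimes> \<one> y
      = \<one> W \<otimes> \<a> X Y y \<cdot> \<a> W (X \<odot> Y) y \<cdot> (\<one> W \<otimes> l \<cdot> k) \<otimes> \<one> y"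
    using p y by (simp add: Id_tensor_Comp)
  also have "\<dots> = (\<one> W \<otimes> \<a> X Y y \<cdot> \<a> W (X \<odot> Y) y \<cdot> \<a> W X Y \<otimes> \<one> y) \<cdot> n \<otimes> \<one> y"
    unfolding Cons.prems(15) using p y by (simp add: Id_tensor_Comp)
  also have "\<dots> = (\<a> W X (Y \<odot> y) \<cdot> \<a> (W \<odot> X) Y y) \<cdot> n \<otimes> \<one> y"
    using p y pentagon[of W X Y y] by simp
  also have "\<dots> = \<a> W X (Y \<odot> y) \<cdot> ?n" using p y by simp
  finally have *: "\<one> W \<otimes> ?l \<cdot> ?k = \<a> W X (Y \<odot> y) \<cdot> ?n" .
  have "\<one> W \<otimes> kap_acc X (Y \<odot> y) ?l ys \<cdot> kap_acc W (P \<odot> y) ?k ys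
      = \<a> W X (act (Y \<odot> y) ys) \<cdot> kap_acc (W \<odot> X) (Y \<odot> y) ?n ys"
    by (rule Cons.IH[where U = "U \<odot> y"])
      (use p Cons.prems(15) y * in \<open>simp_all add: iso_Comp iso_TensA iso_Id\<close>)
  then show ?case by simp
qed simp

lemma kap_simps [simp]:
  assumes "W \<in> Obj C" "xs \<noteq> []" "set xs \<subseteq> Obj C"
  shows "is_iso C (kap W xs)" "kap W xs \<in> Arr C" "Dom C (kap W xs) = act W xs" "Cod C (kap W xs) = W \<odot> br xs"
proof -
  have o: "hd xs \<in> Obj C" "set (tl xs) \<subseteq> Obj C" using assms by (cases xs; auto)+
  have *: "is_iso C (kap W xs) \<and> Dom C (kap W xs) = act (W \<odot> hd xs) (tl xs) \<and> Cod C (kap W xs) = W \<odot> br xs"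
    using kap_acc_iso[of "\<one> (W \<odot> hd xs)" W "hd xs" "tl xs"] assms o
    by (simp add: kap_def br_def iso_Id)
  then show "is_iso C (kap W xs)" "kap W xs \<in> Arr C" "Dom C (kap W xs) = act W xs" "Cod C (kap W xs) = W \<odot> br xs"
    using assms iso_Arr by (cases xs; auto)+
qed

lemma kap_nat:
  assumes "g \<in> Arr C" "xs \<noteq> []" "set xs \<subseteq> Obj C"
  shows "kap (Cod C g) xs \<cdot> whisk g xs = g \<otimes> \<one> (br xs) \<cdot> kap (Dom C g) xs"
proof (cases xs)
  case (Cons x ys)
  then show ?thesis
    using kap_acc_nat[of "\<one> (Dom C g \<odot> x)" "\<one> (Cod C g \<odot> x)" g x "g \<otimes> \<one> x" ys] assms
    by (simp add: kap_def br_Cons)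
qed (use assms in simp)

lemma kap_snoc: "xs \<noteq> [] \<Longrightarrow> kap W (xs @ [y]) = \<a> W (br xs) y \<cdot> kap W xs \<otimes> \<one> y"
  by (cases xs) (auto simp: kap_def br_Cons kap_acc_snoc)

lemma kap_coherent:
  assumes "W \<in> Obj C" "X \<in> Obj C" "xs \<noteq> []" "set xs \<subseteq> Obj C"
  shows "\<one> W \<otimes> kap X xs \<cdot> kap W (X # xs) = \<a> W X (br xs) \<cdot> kap (W \<odot> X) xs"
proof (cases xs)
  case (Cons x ys)
  then show ?thesis
    using kap_acc_coherent[of W X x "X \<odot> x" ys "\<a> W X x" "W \<odot> X \<odot> x" "\<one> (X \<odot> x)" "\<one> (W \<odot> X \<odot> x)"] assms
    by (simp add: kap_def br_Cons iso_Id TensA_Id)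
qed (use assms in simp)

lemma kap_sing [simp]: "kap W [x] = \<one> (W \<odot> x)"
  by (simp add: kap_def)

lemma kap_pair [simp]: "W \<in> Obj C \<Longrightarrow> X \<in> Obj C \<Longrightarrow> Y \<in> Obj C \<Longrightarrow> kap W [X, Y] = \<a> W X Y"
  by (simp add: kap_def TensA_Id)

section \<open>The embedding of arrows into strands\<close>

definition strable :: "'o list \<Rightarrow> 'o list \<Rightarrow> 'a \<Rightarrow> bool" where
  "strable xs ys f \<longleftrightarrow> xs \<noteq> [] \<and> ys \<noteq> [] \<and> set xs \<subseteq> Obj C \<and> set ys \<subseteq> Obj C \<and> f \<in> hom C (br xs) (br ys)"

definition str :: "'o list \<Rightarrow> 'o list \<Rightarrow> 'a \<Rightarrow> ('o, 'a) strand" where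
  "str xs ys f = mk xs (strable xs ys f) (\<lambda>W. arr_inv C (kap W ys) \<cdot> (\<one> W \<otimes> f) \<cdot> kap W xs) ys"

lemma str_ends [simp]: "sdom (str xs ys f) = xs" "scod (str xs ys f) = ys"
  by (simp_all add: str_def)

lemma strableD:
  assumes "strable xs ys f"
  shows "xs \<noteq> []" "ys \<noteq> []" "set xs \<subseteq> Obj C" "set ys \<subseteq> Obj C" "f \<in> Arr C" "Dom C f = br xs" "Cod C f = br ys"
  using assms by (auto simp: strable_def hom_iff)

lemma sat_str:
  "strable xs ys f \<Longrightarrow> W \<in> Obj C \<Longrightarrow> sat (str xs ys f) W = arr_inv C (kap W ys) \<cdot> (\<one> W \<otimes> f \<cdot> kap W xs)"
  using strableD[of xs ys f] by (simp add: str_def)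

lemma valid_str [simp]: "valid (str xs ys f) \<longleftrightarrow> strable xs ys f"
proof
  show "valid (str xs ys f) \<Longrightarrow> strable xs ys f"
    using valid_imp_fam[of "str xs ys f"] by (simp add: str_def)
next
  assume s: "strable xs ys f"
  note d = strableD[OF s]
  show "valid (str xs ys f)"
    unfolding str_def
  proof (rule valid_mkI)
    fix g assume g: "g \<in> Arr C"
    then have o: "Dom C g \<in> Obj C" "Cod C g \<in> Obj C" by auto
    have "kap (Cod C g) ys \<cdot> (arr_inv C (kap (Cod C g) ys) \<cdot> (\<one> (Cod C g) \<otimes> f) \<cdot> kap (Cod C g) xs \<cdot> whisk g xs)
        = \<one> (Cod C g) \<otimes> f \<cdot> (kap (Cod C g) xs \<cdot> whisk g xs)"
      using d g o by simp
    also have "\<dots> = (\<one> (Cod C g) \<otimes> f \<cdot> g \<otimes> \<one> (br xs)) \<cdot> kap (Dom C g) xs"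
      using kap_nat[of g xs] d g o by simp
    also have "\<dots> = (g \<otimes> \<one> (br ys) \<cdot> \<one> (Dom C g) \<otimes> f) \<cdot> kap (Dom C g) xs"
      using d g o by (simp add: TensA_Comp')
    also have "\<dots>
        = g \<otimes> \<one> (br ys) \<cdot> kap (Dom C g) ys \<cdot> (arr_inv C (kap (Dom C g) ys) \<cdot> (\<one> (Dom C g) \<otimes> f) \<cdot> kap (Dom C g) xs)"
      using d g o by simp
    also have "\<dots> = kap (Cod C g) ys \<cdot> (whisk g ys \<cdot> (arr_inv C (kap (Dom C g) ys) \<cdot> (\<one> (Dom C g) \<otimes> f) \<cdot> kap (Dom C g) xs))"
      using kap_nat[of g ys, symmetric] d g o by simp
    finally have "kap (Cod C g) ys \<cdot> (arr_inv C (kap (Cod C g) ys) \<cdot> (\<one> (Cod C g) \<otimes> f) \<cdot> kap (Cod C g) xs \<cdot> whisk g xs)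
        = kap (Cod C g) ys \<cdot> (whisk g ys \<cdot> (arr_inv C (kap (Dom C g) ys) \<cdot> (\<one> (Dom C g) \<otimes> f) \<cdot> kap (Dom C g) xs))" .
    then show "arr_inv C (kap (Cod C g) ys) \<cdot> (\<one> (Cod C g) \<otimes> f) \<cdot> kap (Cod C g) xs \<cdot> whisk g xs
        = whisk g ys \<cdot> (arr_inv C (kap (Dom C g) ys) \<cdot> (\<one> (Dom C g) \<otimes> f) \<cdot> kap (Dom C g) xs)"
      by (rule monoD[OF iso_mono, rotated 3, where W = "act (Dom C g) xs"]) (use d g o in \<open>simp_all add: hom_iff\<close>)
  qed (use s d in \<open>simp_all add: hom_iff\<close>)
qed

lemma normal_str [simp]: "normal (str xs ys f)"
  unfolding normal_def valid_str by (auto simp: str_def)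

text \<open>The component at \<open>\<I>\<close> is conjugate to
  \<open>\<one> \<I> \<otimes> f\<close>, and tensoring with the unit is faithful. Every return from
  strands to the given category rests on this.\<close>

lemma str_faithful:
  assumes "strable xs ys f" "strable xs ys g" "str xs ys f = str xs ys g"
  shows "f = g"
proof -
  note d = strableD[OF assms(1)] strableD[OF assms(2)]
  have k: "kap \<I> ys \<cdot> (sat (str xs ys f) \<I> \<cdot> arr_inv C (kap \<I> xs)) = \<one> \<I> \<otimes> f"
    if "strable xs ys f" for f
    using strableD[OF that] by (simp add: sat_str[OF that])
  have "\<one> \<I> \<otimes> f = \<one> \<I> \<otimes> g" using k[OF assms(1)] k[OF assms(2)] assms(3) by metis
  then show "f = g"
    by (rule unit_tensor_faithful[rotated 2]) (use d in \<open>auto simp: hom_iff\<close>)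
qed

lemma str_scomp:
  assumes "strable xs zs f" "strable zs ys g"
  shows "str zs ys g \<star> str xs zs f = str xs ys (g \<cdot> f)"
proof -
  note d = strableD[OF assms(1)] strableD[OF assms(2)]
  have s: "strable xs ys (g \<cdot> f)" using d by (simp add: strable_def hom_iff)
  show ?thesis
    by (rule strand_eqI) (use assms s d in \<open>simp_all add: sat_str Id_tensor_Comp\<close>)
qed

lemma str_Id: "xs \<noteq> [] \<Longrightarrow> set xs \<subseteq> Obj C \<Longrightarrow> str xs xs (\<one> (br xs)) = sid xs"
proof (rule strand_eqI)
  assume x: "xs \<noteq> []" "set xs \<subseteq> Obj C"
  then have s: "strable xs xs (\<one> (br xs))" by (simp add: strable_def hom_iff)
  show "valid (str xs xs (\<one> (br xs))) = valid (sid xs)" using s x by simp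
  show "sat (str xs xs (\<one> (br xs))) W = sat (sid xs) W" if "W \<in> Obj C" for W
    using x that by (simp add: sat_str[OF s] TensA_Id)
qed simp_all

lemma strable_whisk_right:
  assumes "strable xs ys f" "y \<in> Obj C"
  shows "strable (xs @ [y]) (ys @ [y]) (f \<otimes> \<one> y)"
  using strableD[OF assms(1)] assms(2) by (simp add: strable_def hom_iff)

lemma str_whisk_right:
  assumes "strable xs ys f" "y \<in> Obj C"
  shows "str xs ys f \<rhd> [y] = str (xs @ [y]) (ys @ [y]) (f \<otimes> \<one> y)"
proof (rule strand_eqI)
  note d = strableD[OF assms(1)] assms(2)
  note s = strable_whisk_right[OF assms]
  show "valid (str xs ys f \<rhd> [y]) = valid (str (xs @ [y]) (ys @ [y]) (f \<otimes> \<one> y))"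
    using assms s by simp
  fix W assume W: "W \<in> Obj C"
  let ?i = "\<lambda>xs. arr_inv C (kap W xs)"
  have e: "\<one> W \<otimes> (f \<otimes> \<one> y) \<cdot> \<a> W (br xs) y = \<a> W (br ys) y \<cdot> \<one> W \<otimes> f \<otimes> \<one> y"
    using Assoc_nat'[of "\<one> W" f "\<one> y"] d W by simp
  have "sat (str (xs @ [y]) (ys @ [y]) (f \<otimes> \<one> y)) W
      = ?i ys \<otimes> \<one> y \<cdot> (arr_inv C (\<a> W (br ys) y) \<cdot> (\<one> W \<otimes> (f \<otimes> \<one> y) \<cdot> \<a> W (br xs) y \<cdot> kap W xs \<otimes> \<one> y))"
    unfolding sat_str[OF s W] using d W by (simp add: kap_snoc iso_Comp iso_TensA iso_Id)
  also have "\<dots> = (?i ys \<cdot> (\<one> W \<otimes> f \<cdot> kap W xs)) \<otimes> \<one> y"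
    unfolding e using d W by (simp add: Id_tensor_Comp)
  also have "\<dots> = sat (str xs ys f \<rhd> [y]) W"
    using assms W by (simp add: sat_str)
  finally show "sat (str xs ys f \<rhd> [y]) W = sat (str (xs @ [y]) (ys @ [y]) (f \<otimes> \<one> y)) W" ..
qed simp_all

lemma sat_str_hom:
  assumes "strable xs ys f" "x \<in> Obj C"
  shows "strable (x # xs) (x # ys) (sat (str xs ys f) x)"
  using validD(3-5)[of "str xs ys f" x] strableD[OF assms(1)] assms
  by (simp add: strable_def hom_iff br_Cons)

text \<open>On the left the component at \<open>W\<close> is that of the original strand at
  \<open>W \<odot> x\<close>; \<open>kap_coherent\<close> compares the two ways of bracketing
  \<open>W\<close>, \<open>x\<close> and the list.\<close>

lemma str_whisk_left:
  assumes "strable xs ys f" "x \<in> Obj C"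
  shows "[x] \<lhd> str xs ys f = str (x # xs) (x # ys) (sat (str xs ys f) x)"
proof (rule strand_eqI)
  note d = strableD[OF assms(1)] assms(2)
  note s = sat_str_hom[OF assms]
  show "valid ([x] \<lhd> str xs ys f) = valid (str (x # xs) (x # ys) (sat (str xs ys f) x))"
    using assms s by simp
  fix W assume W: "W \<in> Obj C"
  let ?K = "kap (W \<odot> x) ys" and ?L = "\<one> W \<otimes> kap x ys \<cdot> kap W (x # ys)"
  have co: "?L = \<a> W x (br ys) \<cdot> ?K" using kap_coherent[of W x ys] d W by simp
  have sat: "sat (str xs ys f) x \<in> hom C (act x xs) (act x ys)"
    using s by (simp add: strable_def br_Cons)
  have e1: "kap x ys \<cdot> sat (str xs ys f) x = \<one> x \<otimes> f \<cdot> kap x xs"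
    using d by (simp add: sat_str[OF assms])
  have e2: "\<one> W \<otimes> (\<one> x \<otimes> f) \<cdot> \<a> W x (br xs) = \<a> W x (br ys) \<cdot> \<one> (W \<odot> x) \<otimes> f"
    using Assoc_nat'[of "\<one> W" "\<one> x" f] d W by (simp add: TensA_Id)
  have "?L \<cdot> sat (str (x # xs) (x # ys) (sat (str xs ys f) x)) W
      = \<one> W \<otimes> kap x ys \<cdot> (\<one> W \<otimes> sat (str xs ys f) x \<cdot> kap W (x # xs))"
    using s d W sat by (subst sat_str[OF s W]) (simp add: hom_iff br_Cons)
  also have "\<dots> = \<one> W \<otimes> (kap x ys \<cdot> sat (str xs ys f) x) \<cdot> kap W (x # xs)"
    using s d W sat by (subst Id_tensor_Comp(1)) (simp_all add: hom_iff br_Cons)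
  also have "\<dots> = \<one> W \<otimes> (\<one> x \<otimes> f) \<cdot> (\<one> W \<otimes> kap x xs \<cdot> kap W (x # xs))"
    unfolding e1 using d W by (subst Id_tensor_Comp(1)) (simp_all add: br_Cons)
  also have "\<dots> = (\<one> W \<otimes> (\<one> x \<otimes> f) \<cdot> \<a> W x (br xs)) \<cdot> kap (W \<odot> x) xs"
    using kap_coherent[of W x xs] d W by simp
  also have "\<dots> = \<a> W x (br ys) \<cdot> ?K \<cdot> sat (str xs ys f) (W \<odot> x)"
    unfolding e2 using d W by (simp add: sat_str[OF assms(1)])
  also have "\<dots> = ?L \<cdot> sat (str xs ys f) (W \<odot> x)" unfolding co ..
  finally have eq: "?L \<cdot> sat (str (x # xs) (x # ys) (sat (str xs ys f) x)) W = ?L \<cdot> sat (str xs ys f) (W \<odot> x)" .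
  have "is_iso C ?L" unfolding co using d W by (rule_tac iso_Comp(1)) simp_all
  then have "sat (str (x # xs) (x # ys) (sat (str xs ys f) x)) W = sat (str xs ys f) (W \<odot> x)"
    by (rule monoD[OF iso_mono, rotated 3, OF eq, where W = "act W (x # xs)"])
      (use d W validD(3-5)[of "str xs ys f" "W \<odot> x"] validD(3-5)[of "str (x # xs) (x # ys) (sat (str xs ys f) x)" W] s assms
        in \<open>simp_all add: hom_iff br_Cons\<close>)
  then show "sat ([x] \<lhd> str xs ys f) W = sat (str (x # xs) (x # ys) (sat (str xs ys f) x)) W"
    using assms d W by simp
qed simp_all


text \<open>Composites associate to the right, so an equation for \<open>a \<star> b\<close> does
  not match inside a longer composite. These forms add an arbitrary continuation \<open>x\<close>
  and can be used for rewriting.\<close>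

lemma ext2: "a \<star> b = z \<Longrightarrow> a \<star> b \<star> x = z \<star> x"
  by (metis scomp_assoc)

lemma ext3: "a \<star> b \<star> c = z \<Longrightarrow> a \<star> b \<star> c \<star> x = z \<star> x"
  by (metis scomp_assoc)

lemma ext4: "a \<star> b \<star> c \<star> d = z \<Longrightarrow> a \<star> b \<star> c \<star> d \<star> x = z \<star> x"
  by (metis scomp_assoc)

lemma ext5: "a \<star> b \<star> c \<star> d \<star> e = z \<Longrightarrow> a \<star> b \<star> c \<star> d \<star> e \<star> x = z \<star> x"
  by (metis scomp_assoc)

lemma str_whisk_left_simps:
  assumes "X \<in> Obj C"
  shows "strable [Y] [Y'] f \<Longrightarrow> [X] \<lhd> str [Y] [Y'] f = str [X, Y] [X, Y'] (\<one> X \<otimes> f)"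
    and "strable [Y, Z] [Y'] f \<Longrightarrow>
      [X] \<lhd> str [Y, Z] [Y'] f = str [X, Y, Z] [X, Y'] (\<one> X \<otimes> f \<cdot> \<a> X Y Z)"
    and "strable [Y] [Y', Z'] f \<Longrightarrow>
      [X] \<lhd> str [Y] [Y', Z'] f = str [X, Y] [X, Y', Z'] (arr_inv C (\<a> X Y' Z') \<cdot> \<one> X \<otimes> f)"
    and "strable [Y, Z] [Y', Z'] f \<Longrightarrow>
      [X] \<lhd> str [Y, Z] [Y', Z'] f = str [X, Y, Z] [X, Y', Z'] (arr_inv C (\<a> X Y' Z') \<cdot> \<one> X \<otimes> f \<cdot> \<a> X Y Z)"
  using assms by (subst str_whisk_left; simp add: strable_def sat_str hom_iff iso_Id)+

lemma str_whisk_right_simps: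
  assumes "W \<in> Obj C"
  shows "strable [X] [X'] f \<Longrightarrow> str [X] [X'] f \<rhd> [W] = str [X, W] [X', W] (f \<otimes> \<one> W)"
    and "strable [X, Y] [X'] f \<Longrightarrow> str [X, Y] [X'] f \<rhd> [W] = str [X, Y, W] [X', W] (f \<otimes> \<one> W)"
    and "strable [X] [X', Y'] f \<Longrightarrow> str [X] [X', Y'] f \<rhd> [W] = str [X, W] [X', Y', W] (f \<otimes> \<one> W)"
    and "strable [X, Y] [X', Y'] f \<Longrightarrow>
      str [X, Y] [X', Y'] f \<rhd> [W] = str [X, Y, W] [X', Y', W] (f \<otimes> \<one> W)"
    and "strable [X, Y, Z] [X', Y'] f \<Longrightarrow>
      str [X, Y, Z] [X', Y'] f \<rhd> [W] = str [X, Y, Z, W] [X', Y', W] (f \<otimes> \<one> W)"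
    and "strable [X, Y, Z] [X', Y', Z'] f \<Longrightarrow>
      str [X, Y, Z] [X', Y', Z'] f \<rhd> [W] = str [X, Y, Z, W] [X', Y', Z', W] (f \<otimes> \<one> W)"
  using assms by (subst str_whisk_right; simp)+

text \<open>\<open>str\<close> excludes empty lists. A counit is therefore made directly into a
  strand that ends in the empty list, the strict unit, so that \<open>1e\<close> and
  \<open>e1\<close> become whiskerings of one strand and unitors disappear from the
  calculations.\<close>

definition scap :: "'o \<Rightarrow> 'a \<Rightarrow> ('o, 'a) strand" where
  "scap A e = mk [A] (A \<in> Obj C \<and> e \<in> hom C A \<I>) (\<lambda>W. \<r> W \<cdot> \<one> W \<otimes> e) []"

lemma scap_ends [simp]: "sdom (scap A e) = [A]" "scod (scap A e) = []"
  by (simp_all add: scap_def)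

lemma valid_scap [simp]: "valid (scap A e) \<longleftrightarrow> A \<in> Obj C \<and> e \<in> hom C A \<I>"
proof
  show "valid (scap A e) \<Longrightarrow> A \<in> Obj C \<and> e \<in> hom C A \<I>"
    using valid_imp_fam[of "scap A e"] by (simp add: scap_def)
next
  assume *: "A \<in> Obj C \<and> e \<in> hom C A \<I>"
  then have e: "e \<in> Arr C" "Dom C e = A" "Cod C e = \<I>" "A \<in> Obj C" by (auto simp: hom_iff)
  show "valid (scap A e)"
    unfolding scap_def
  proof (rule valid_mkI)
    fix g assume g: "g \<in> Arr C"
    then have o: "Dom C g \<in> Obj C" "Cod C g \<in> Obj C" by auto
    have "\<one> (Cod C g) \<otimes> e \<cdot> g \<otimes> \<one> A = g \<otimes> \<one> \<I> \<cdot> \<one> (Dom C g) \<otimes> e"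
      using e g o by (simp add: TensA_Comp')
    then have "\<r> (Cod C g) \<cdot> \<one> (Cod C g) \<otimes> e \<cdot> g \<otimes> \<one> A = \<r> (Cod C g) \<cdot> g \<otimes> \<one> \<I> \<cdot> \<one> (Dom C g) \<otimes> e"
      using e g o by simp
    also have "\<dots> = g \<cdot> \<r> (Dom C g) \<cdot> \<one> (Dom C g) \<otimes> e"
      using RUnit_nat[of g "Dom C g" "Cod C g"] g by (simp add: hom_iff)
    finally show "\<r> (Cod C g) \<cdot> \<one> (Cod C g) \<otimes> e \<cdot> whisk g [A] = whisk g [] \<cdot> (\<r> (Dom C g) \<cdot> \<one> (Dom C g) \<otimes> e)"
      using e g o by simp
  qed (use * e in \<open>auto simp: hom_iff\<close>)
qed

lemma normal_scap [simp]: "normal (scap A e)"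
  unfolding normal_def valid_scap by (auto simp: scap_def)

lemma sat_scap [simp]:
  "A \<in> Obj C \<Longrightarrow> e \<in> hom C A \<I> \<Longrightarrow> W \<in> Obj C \<Longrightarrow> sat (scap A e) W = \<r> W \<cdot> \<one> W \<otimes> e"
  by (simp add: scap_def)

text \<open>The component of \<open>scap\<close> uses the right unitor of the parameter.
  \<open>RUnit_tensor\<close> turns it into the right unitor of \<open>X\<close>, the triangle into
  the left one.\<close>

lemma scap_whisk:
  assumes e: "e \<in> hom C A \<I>" and X: "X \<in> Obj C"
  shows "[X] \<lhd> scap A e = str [X, A] [X] (cap_right C e X)"
    and "scap A e \<rhd> [X] = str [A, X] [X] (cap_left C e X)"
proof -
  have h: "e \<in> Arr C" "Dom C e = A" "Cod C e = \<I>" "A \<in> Obj C"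
    using e by (auto simp: hom_iff)
  have s1: "strable [X, A] [X] (cap_right C e X)" and s2: "strable [A, X] [X] (cap_left C e X)"
    using h X by (auto simp: strable_def hom_iff cap_right_def cap_left_def)
  show "[X] \<lhd> scap A e = str [X, A] [X] (cap_right C e X)"
  proof (rule strand_eqI)
    fix W assume W: "W \<in> Obj C"
    have e1: "\<one> W \<otimes> (\<one> X \<otimes> e) \<cdot> \<a> W X A = \<a> W X \<I> \<cdot> \<one> (W \<odot> X) \<otimes> e"
      using Assoc_nat'[of "\<one> W" "\<one> X" e] h X W by (simp add: TensA_Id)
    have "sat (str [X, A] [X] (cap_right C e X)) W = \<one> W \<otimes> \<r> X \<cdot> (\<one> W \<otimes> (\<one> X \<otimes> e) \<cdot> \<a> W X A)"
      using h X W s1 by (simp add: sat_str cap_right_def Id_tensor_Comp iso_Id)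
    also have "\<dots> = (\<one> W \<otimes> \<r> X \<cdot> \<a> W X \<I>) \<cdot> \<one> (W \<odot> X) \<otimes> e"
      unfolding e1 using h X W by simp
    also have "\<dots> = sat ([X] \<lhd> scap A e) W"
      using h X W e by (simp add: RUnit_tensor)
    finally show "sat ([X] \<lhd> scap A e) W = sat (str [X, A] [X] (cap_right C e X)) W" ..
  qed (use s1 X h e in auto)
  show "scap A e \<rhd> [X] = str [A, X] [X] (cap_left C e X)"
  proof (rule strand_eqI)
    fix W assume W: "W \<in> Obj C"
    have e1: "\<one> W \<otimes> (e \<otimes> \<one> X) \<cdot> \<a> W A X = \<a> W \<I> X \<cdot> \<one> W \<otimes> e \<otimes> \<one> X"
      using Assoc_nat'[of "\<one> W" e "\<one> X"] h X W by simp
    have "sat (str [A, X] [X] (cap_left C e X)) W = \<one> W \<otimes> \<l> X \<cdot> (\<one> W \<otimes> (e \<otimes> \<one> X) \<cdot> \<a> W A X)"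
      using h X W s2 by (simp add: sat_str cap_left_def Id_tensor_Comp iso_Id)
    also have "\<dots> = (\<one> W \<otimes> \<l> X \<cdot> \<a> W \<I> X) \<cdot> \<one> W \<otimes> e \<otimes> \<one> X"
      unfolding e1 using h X W by simp
    also have "\<dots> = (\<r> W \<cdot> \<one> W \<otimes> e) \<otimes> \<one> X"
      using h X W triangle[of W X] by (simp add: Id_tensor_Comp)
    also have "\<dots> = sat (scap A e \<rhd> [X]) W"
      using h X W e by simp
    finally show "sat (scap A e \<rhd> [X]) W = sat (str [A, X] [X] (cap_left C e X)) W" ..
  qed (use s2 X h e in auto)
qed

text \<open>Naturality in \<open>W\<close> alone does not force a family to come from an arrow.
  Cancellation of epimorphisms and non-degeneracy speak about arrows, so they are transferred only
  to strands in the image of \<open>str\<close>.\<close>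

definition rep :: "('o, 'a) strand \<Rightarrow> bool" where
  "rep F \<longleftrightarrow> (\<exists>f. strable (sdom F) (scod F) f \<and> str (sdom F) (scod F) f = F)"

lemma rep_str [simp]: "strable xs ys f \<Longrightarrow> rep (str xs ys f)"
  by (auto simp: rep_def)

lemma rep_valid: "rep F \<Longrightarrow> valid F"
  by (metis rep_def valid_str)

lemma rep_scomp [simp]:
  assumes "rep G" "rep F" "scod F = sdom G"
  shows "rep (G \<star> F)"
proof -
  obtain f where f: "strable (sdom F) (scod F) f" "str (sdom F) (scod F) f = F"
    using assms unfolding rep_def by blast
  obtain g where g: "strable (sdom G) (scod G) g" "str (sdom G) (scod G) g = G"
    using assms unfolding rep_def by blast
  have "strable (sdom F) (scod G) (g \<cdot> f)"
    using f g assms(3) by (auto simp: strable_def hom_iff)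
  moreover have "G \<star> F = str (sdom F) (scod G) (g \<cdot> f)"
    using str_scomp[of "sdom F" "scod F" f "scod G" g] f g assms(3) by simp
  ultimately show ?thesis by (auto simp: rep_def)
qed

lemma rep_whisk_left: "rep F \<Longrightarrow> set xs \<subseteq> Obj C \<Longrightarrow> rep (xs \<lhd> F)"
proof (induction xs)
  case Nil
  then show ?case using rep_valid[of F] by simp
next
  case (Cons x xs)
  then obtain f where f: "strable (sdom (xs \<lhd> F)) (scod (xs \<lhd> F)) f"
      "str (sdom (xs \<lhd> F)) (scod (xs \<lhd> F)) f = xs \<lhd> F"
    unfolding rep_def by force
  have x: "x \<in> Obj C" using Cons by simp
  have "(x # xs) \<lhd> F = [x] \<lhd> (xs \<lhd> F)" by simp
  then show ?case
    using str_whisk_left[OF f(1) x] rep_str[OF sat_str_hom[OF f(1) x]] unfolding f(2) by simp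
qed

lemma rep_whisk_right: "rep F \<Longrightarrow> set ys \<subseteq> Obj C \<Longrightarrow> rep (F \<rhd> ys)"
proof (induction ys rule: rev_induct)
  case Nil
  then show ?case using rep_valid[of F] by simp
next
  case (snoc y ys)
  then obtain f where f: "strable (sdom (F \<rhd> ys)) (scod (F \<rhd> ys)) f"
      "str (sdom (F \<rhd> ys)) (scod (F \<rhd> ys)) f = F \<rhd> ys"
    unfolding rep_def by force
  have y: "y \<in> Obj C" using snoc by simp
  have "F \<rhd> (ys @ [y]) = (F \<rhd> ys) \<rhd> [y]" by simp
  then show ?case
    using str_whisk_right[OF f(1) y] rep_str[OF strable_whisk_right[OF f(1) y]] unfolding f(2) by simp
qed

lemma rep_whisk [simp]:
  assumes "rep F" "set xs \<subseteq> Obj C" "set ys \<subseteq> Obj C"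
  shows "rep (xs \<lhd> F \<rhd> ys)"
proof -
  have "xs \<lhd> F \<rhd> ys = (xs \<lhd> F) \<rhd> ys" by simp
  then show ?thesis using rep_whisk_right[OF rep_whisk_left[OF assms(1,2)] assms(3)] by simp
qed

lemma rep_scap [simp]:
  assumes "e \<in> hom C A \<I>" "set xs \<subseteq> Obj C" "set ys \<subseteq> Obj C" "xs @ ys \<noteq> []"
  shows "rep (xs \<lhd> scap A e \<rhd> ys)"
proof (cases xs rule: rev_cases)
  case (snoc xs' x)
  have "rep ([x] \<lhd> scap A e)"
    using assms snoc by (subst scap_whisk) (auto simp: strable_def cap_right_def hom_iff intro!: rep_str)
  then have "rep (xs' \<lhd> ([x] \<lhd> scap A e) \<rhd> ys)" using assms snoc by (rule_tac rep_whisk) auto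
  then show ?thesis using snoc by simp
next
  case Nil
  then obtain y ys' where y: "ys = y # ys'" using assms by (cases ys) auto
  have "rep (scap A e \<rhd> [y])"
    using assms y by (subst scap_whisk) (auto simp: strable_def cap_left_def hom_iff intro!: rep_str)
  then have "rep ((scap A e \<rhd> [y]) \<rhd> ys')" using assms y by (rule_tac rep_whisk) auto
  then show ?thesis using Nil y by simp
qed

lemma strand_epi_cancel:
  assumes "is_epi C q" "strable xs ys q" "rep F" "rep G" "sdom F = ys" "sdom G = ys" "scod F = scod G"
    and "F \<star> str xs ys q = G \<star> str xs ys q"
  shows "F = G"
proof -
  obtain f where f: "strable ys (scod F) f" "str ys (scod F) f = F"
    using assms(3,5) unfolding rep_def by blast
  obtain g where g: "strable ys (scod F) g" "str ys (scod F) g = G"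
    using assms(4,6,7) unfolding rep_def by metis
  have "str xs (scod F) (f \<cdot> q) = str xs (scod F) (g \<cdot> q)"
    using str_scomp[OF assms(2) f(1)] str_scomp[OF assms(2) g(1)] assms(8) unfolding f(2) g(2) by simp
  then have "f \<cdot> q = g \<cdot> q"
    by (rule str_faithful[rotated 2]) (use f(1) g(1) assms(2) in \<open>auto simp: strable_def hom_iff\<close>)
  then have "f = g"
    by (rule epiD[OF assms(1), rotated 2]) (use f(1) g(1) assms(2) in \<open>auto simp: strable_def hom_iff\<close>)
  then show ?thesis using f g by simp
qed

text \<open>A right inverse \<open>y\<close> of \<open>x\<close> suffices. This allows an identity
  to be checked on the values of \<open>t1\<close>, \<open>t2\<close> or a coaction, where antipodes
  cancel.\<close>

lemma strand_iso_cancel: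
  assumes "x \<star> y = sid zs" "normal F" "normal G" "sdom F = zs" "sdom G = zs"
    and "F \<star> x = G \<star> x"
  shows "F = G"
proof -
  have "(F \<star> x) \<star> y = (G \<star> x) \<star> y" using assms by (simp only:)
  then show ?thesis using assms(1-5) by simp
qed

section \<open>Braiding strands\<close>

text \<open>The sign selects the braiding or its inverse, so that one lemma serves both the given
  category and the one with reversed braiding.\<close>

definition brd :: "bool \<Rightarrow> 'o \<Rightarrow> 'o \<Rightarrow> ('o, 'a) strand" where
  "brd s X Y = str [X, Y] [Y, X] (if s then \<c> X Y else \<c>\<inverse> X Y)"

lemma brd_ends [simp]: "sdom (brd s X Y) = [X, Y]" "scod (brd s X Y) = [Y, X]"
  by (simp_all add: brd_def)

lemma normal_brd [simp]: "normal (brd s X Y)"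
  by (simp add: brd_def)

lemma rep_brd [simp]: "X \<in> Obj C \<Longrightarrow> Y \<in> Obj C \<Longrightarrow> rep (brd s X Y)"
  by (auto simp: brd_def strable_def hom_iff)

lemma brd_inverse [simp]:
  assumes "X \<in> Obj C" "Y \<in> Obj C"
  shows "brd (\<not> s) Y X \<star> brd s X Y = sid [X, Y]"
    and "brd True Y X \<star> brd False X Y = sid [X, Y]"
    and "brd False Y X \<star> brd True X Y = sid [X, Y]"
proof -
  have Id: "str [X, Y] [X, Y] (\<one> (X \<odot> Y)) = sid [X, Y]"
    using str_Id[of "[X, Y]"] assms by simp
  have st: "strable [X, Y] [Y, X] (if s then \<c> X Y else \<c>\<inverse> X Y)"
    "strable [Y, X] [X, Y] (if s then \<c> Y X else \<c>\<inverse> Y X)" for s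
    using assms by (auto simp: strable_def hom_iff)
  have c: "(if \<not> s then \<c> Y X else \<c>\<inverse> Y X) \<cdot> (if s then \<c> X Y else \<c>\<inverse> X Y) = \<one> (X \<odot> Y)" for s
    using assms by (cases s) (simp_all add: braid_inv_def)
  have i: "brd (\<not> s) Y X \<star> brd s X Y = sid [X, Y]" for s
    unfolding brd_def str_scomp[OF st] c Id ..
  show "brd (\<not> s) Y X \<star> brd s X Y = sid [X, Y]" by (fact i)
  show "brd True Y X \<star> brd False X Y = sid [X, Y]" "brd False Y X \<star> brd True X Y = sid [X, Y]"
    using i[of False] i[of True] by simp_all
qed

lemma brd_whisk_inverse [simp]:
  assumes "X \<in> Obj C" "Y \<in> Obj C" "set us \<subseteq> Obj C" "set vs \<subseteq> Obj C"
  shows "us \<lhd> brd (\<not> s) Y X \<rhd> vs \<star> us \<lhd> brd s X Y \<rhd> vs = sid (us @ [X, Y] @ vs)"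
    and "us \<lhd> brd True Y X \<rhd> vs \<star> us \<lhd> brd False X Y \<rhd> vs = sid (us @ [X, Y] @ vs)"
    and "us \<lhd> brd False Y X \<rhd> vs \<star> us \<lhd> brd True X Y \<rhd> vs = sid (us @ [X, Y] @ vs)"
  unfolding swhisk_scomp[symmetric] using assms by simp_all

text \<open>For the braiding this is its naturality; for the inverse it follows by composing with
  inverse crossings on both sides.\<close>

lemma slide11:
  assumes "strable [X] [Y] f" "W \<in> Obj C"
  shows "[W] \<lhd> str [X] [Y] f \<star> brd s X W = brd s Y W \<star> str [X] [Y] f \<rhd> [W]"
    and "str [X] [Y] f \<rhd> [W] \<star> brd s W X = brd s W Y \<star> [W] \<lhd> str [X] [Y] f"
proof -
  have o: "X \<in> Obj C" "Y \<in> Obj C" "W \<in> Obj C" "f \<in> hom C X Y"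
    using assms by (auto simp: strable_def)
  let ?L = "[W] \<lhd> str [X] [Y] f" and ?R = "str [X] [Y] f \<rhd> [W]"
  have L: "?L = str [W, X] [W, Y] (\<one> W \<otimes> f)" using str_whisk_left_simps(1)[OF assms(2,1)] .
  have R: "?R = str [X, W] [Y, W] (f \<otimes> \<one> W)" using str_whisk_right_simps(1)[of W X Y f] assms by simp
  have t1: "?L \<star> brd True X W = brd True Y W \<star> ?R"
    unfolding L R brd_def using o Braid_nat[of f X Y "\<one> W" W W]
    by (simp add: str_scomp strable_def hom_iff)
  have t2: "?R \<star> brd True W X = brd True W Y \<star> ?L"
    unfolding L R brd_def using o Braid_nat[of "\<one> W" W W f X Y]
    by (simp add: str_scomp strable_def hom_iff)
  have "brd False Y W \<star> (?R \<star> brd True W X) \<star> brd False X W = brd False Y W \<star> (brd True W Y \<star> ?L) \<star> brd False X W"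
    by (simp only: t2)
  then have f1: "brd False Y W \<star> ?R = ?L \<star> brd False X W"
    using o by (simp add: ext2[OF brd_inverse(3)])
  have "brd False W Y \<star> (?L \<star> brd True X W) \<star> brd False W X = brd False W Y \<star> (brd True Y W \<star> ?R) \<star> brd False W X"
    by (simp only: t1)
  then have f2: "brd False W Y \<star> ?L = ?R \<star> brd False W X"
    using o by (simp add: ext2[OF brd_inverse(3)])
  show "?L \<star> brd s X W = brd s Y W \<star> ?R" using t1 f1 by (cases s) simp_all
  show "?R \<star> brd s W X = brd s W Y \<star> ?L" using t2 f2 by (cases s) simp_all
qed


lemma whisk_eq: "F = G \<Longrightarrow> us \<lhd> F \<rhd> vs = us \<lhd> G \<rhd> vs"
  by simp

lemma whisk_unit_faithful:
  assumes "rep F" "rep G" "sdom F = sdom G" "scod F = scod G"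
  shows "F \<rhd> [\<I>] = G \<rhd> [\<I>] \<Longrightarrow> F = G" and "[\<I>] \<lhd> F = [\<I>] \<lhd> G \<Longrightarrow> F = G"
proof -
  obtain f where f: "strable (sdom F) (scod F) f" "str (sdom F) (scod F) f = F"
    using assms unfolding rep_def by blast
  obtain g where g: "strable (sdom F) (scod F) g" "str (sdom F) (scod F) g = G"
    using assms unfolding rep_def by metis
  have h: "f \<in> hom C (br (sdom F)) (br (scod F))" "g \<in> hom C (br (sdom F)) (br (scod F))"
    using f g by (auto simp: strable_def)
  {
    assume "F \<rhd> [\<I>] = G \<rhd> [\<I>]"
    then have "str (sdom F @ [\<I>]) (scod F @ [\<I>]) (f \<otimes> \<one> \<I>) = str (sdom F @ [\<I>]) (scod F @ [\<I>]) (g \<otimes> \<one> \<I>)"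
      using str_whisk_right[OF f(1), of \<I>] str_whisk_right[OF g(1), of \<I>] unfolding f(2) g(2) by simp
    then have "f \<otimes> \<one> \<I> = g \<otimes> \<one> \<I>"
      by (rule str_faithful[rotated 2]) (use strable_whisk_right[OF f(1), of \<I>] strable_whisk_right[OF g(1), of \<I>] in simp_all)
    then have "f = g" by (rule tensor_unit_faithful[OF h])
    then show "F = G" using f g by simp
  next
    assume a: "[\<I>] \<lhd> F = [\<I>] \<lhd> G"
    have "str (\<I> # sdom F) (\<I> # scod F) (sat F \<I>) = str (\<I> # sdom F) (\<I> # scod F) (sat G \<I>)"
      using str_whisk_left[OF f(1), of \<I>] str_whisk_left[OF g(1), of \<I>] a unfolding f(2) g(2) by simp
    then have e: "sat F \<I> = sat G \<I>"
      by (rule str_faithful[rotated 2])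
        (use sat_str_hom[OF f(1), of \<I>] sat_str_hom[OF g(1), of \<I>] in \<open>simp_all add: f(2) g(2)\<close>)
    have k: "kap \<I> (scod F) \<cdot> (sat (str (sdom F) (scod F) f) \<I> \<cdot> arr_inv C (kap \<I> (sdom F))) = \<one> \<I> \<otimes> f"
      if "strable (sdom F) (scod F) f" for f
      using strableD[OF that] by (simp add: sat_str[OF that])
    have "\<one> \<I> \<otimes> f = \<one> \<I> \<otimes> g" using k[OF f(1)] k[OF g(1)] e unfolding f(2) g(2) by metis
    then have "f = g" by (rule unit_tensor_faithful[OF h])
    then show "F = G" using f g by simp
  }
qed

section \<open>Crossings of whole blocks, and the hexagons\<close>

definition join :: "'o list \<Rightarrow> ('o, 'a) strand" where
  "join xs = str xs [br xs] (\<one> (br xs))"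

definition split :: "'o list \<Rightarrow> ('o, 'a) strand" where
  "split xs = str [br xs] xs (\<one> (br xs))"

lemma join_split_ends [simp]: "sdom (join xs) = xs" "scod (join xs) = [br xs]"
  "sdom (split xs) = [br xs]" "scod (split xs) = xs" "normal (join xs)" "normal (split xs)"
  by (simp_all add: join_def split_def)

lemma join_split [simp]:
  assumes "xs \<noteq> []" "set xs \<subseteq> Obj C"
  shows "join xs \<star> split xs = sid [br xs]" and "split xs \<star> join xs = sid xs"
    and "rep (join xs)" and "rep (split xs)"
proof -
  have s: "strable xs [br xs] (\<one> (br xs))" "strable [br xs] xs (\<one> (br xs))"
    using assms by (simp_all add: strable_def hom_iff)
  show "join xs \<star> split xs = sid [br xs]"
    using assms str_Id[of "[br xs]"] by (simp add: join_def split_def str_scomp[OF s(2,1)])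
  show "split xs \<star> join xs = sid xs"
    using assms str_Id[of xs] by (simp add: join_def split_def str_scomp[OF s])
  show "rep (join xs)" "rep (split xs)" using s by (simp_all add: join_def split_def)
qed

lemma str_split:
  assumes "strable xs ys f"
  shows "str xs ys f = split ys \<star> str [br xs] [br ys] f \<star> join xs"
proof -
  note d = strableD[OF assms]
  have s: "strable xs [br xs] (\<one> (br xs))" "strable [br ys] ys (\<one> (br ys))" "strable [br xs] [br ys] f"
    "strable xs [br ys] f"
    using d by (simp_all add: strable_def hom_iff)
  show ?thesis
    using d by (simp add: join_def split_def str_scomp[OF s(1,3)] str_scomp[OF s(4,2)])
qed

text \<open>The block \<open>xs\<close> crossing the strand \<open>W\<close>.\<close>

definition brl :: "bool \<Rightarrow> 'o list \<Rightarrow> 'o \<Rightarrow> ('o, 'a) strand" where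
  "brl s xs W = [W] \<lhd> split xs \<star> brd s (br xs) W \<star> join xs \<rhd> [W]"

definition brr :: "bool \<Rightarrow> 'o \<Rightarrow> 'o list \<Rightarrow> ('o, 'a) strand" where
  "brr s W xs = split xs \<rhd> [W] \<star> brd s W (br xs) \<star> [W] \<lhd> join xs"

text \<open>With the block joined to a single object this is \<open>slide11\<close>. The hexagons
  enter only when the crossing of the block is taken apart into crossings of its letters.\<close>

lemma slide:
  assumes f: "strable xs ys f" and W: "W \<in> Obj C"
  shows "[W] \<lhd> str xs ys f \<star> brl s xs W = brl s ys W \<star> str xs ys f \<rhd> [W]"
    and "str xs ys f \<rhd> [W] \<star> brr s W xs = brr s W ys \<star> [W] \<lhd> str xs ys f"
proof -
  note d = strableD[OF f]
  have f': "strable [br xs] [br ys] f" using f by (simp add: strable_def)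
  have jw: "us \<lhd> join zs \<rhd> vs \<star> us \<lhd> split zs \<rhd> vs = sid (us @ [br zs] @ vs)"
    if "zs \<noteq> []" "set zs \<subseteq> Obj C" "set us \<subseteq> Obj C" "set vs \<subseteq> Obj C" for zs us vs
    unfolding swhisk_scomp[symmetric] using that by simp
  note s1 = slide11(1)[OF f' W, of s] and s2 = slide11(2)[OF f' W, of s]
  show "[W] \<lhd> str xs ys f \<star> brl s xs W = brl s ys W \<star> str xs ys f \<rhd> [W]"
    unfolding str_split[OF f] brl_def
    using d W by (simp add: ext2[OF jw] ext2[OF s1])
  show "str xs ys f \<rhd> [W] \<star> brr s W xs = brr s W ys \<star> [W] \<lhd> str xs ys f"
    unfolding str_split[OF f] brr_def
    using d W by (simp add: ext2[OF jw] ext2[OF s2])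
qed

lemma brl_brr_inverse:
  assumes "xs \<noteq> []" "set xs \<subseteq> Obj C" "W \<in> Obj C"
  shows "brl (\<not> s) xs W \<star> brr s W xs = sid (W # xs)" and "brr (\<not> s) W xs \<star> brl s xs W = sid (xs @ [W])"
proof -
  have jw: "us \<lhd> join zs \<rhd> vs \<star> us \<lhd> split zs \<rhd> vs = sid (us @ [br zs] @ vs)"
    "us \<lhd> split zs \<rhd> vs \<star> us \<lhd> join zs \<rhd> vs = sid (us @ zs @ vs)"
    if "zs \<noteq> []" "set zs \<subseteq> Obj C" "set us \<subseteq> Obj C" "set vs \<subseteq> Obj C" for zs us vs
    unfolding swhisk_scomp[symmetric] using that by simp_all
  show "brl (\<not> s) xs W \<star> brr s W xs = sid (W # xs)" "brr (\<not> s) W xs \<star> brl s xs W = sid (xs @ [W])"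
    unfolding brl_def brr_def
    using assms by (simp_all add: ext2[OF jw(1)] ext2[OF brd_inverse(1)] jw(2))
qed

lemma brl_sing [simp]: "X \<in> Obj C \<Longrightarrow> W \<in> Obj C \<Longrightarrow> brl s [X] W = brd s X W"
  and brr_sing [simp]: "X \<in> Obj C \<Longrightarrow> W \<in> Obj C \<Longrightarrow> brr s W [X] = brd s W X"
  using str_Id[of "[X]"] by (simp_all add: brl_def brr_def join_def split_def)

lemma brl_pair_True:
  assumes X: "X \<in> Obj C" "Y \<in> Obj C" "W \<in> Obj C"
  shows "brl True [X, Y] W = brd True X W \<rhd> [Y] \<star> [X] \<lhd> brd True Y W"
proof -
  let ?i = "arr_inv C (\<a> W X Y)"
  have l1: "[W] \<lhd> split [X, Y] = str [W, X \<odot> Y] [W, X, Y] ?i"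
    unfolding split_def using X
    by (simp add: str_whisk_left_simps(3) strable_def hom_iff TensA_Id)
  have l2: "join [X, Y] \<rhd> [W] = str [X, Y, W] [X \<odot> Y, W] (\<one> (X \<odot> Y \<odot> W))"
    unfolding join_def using X
    by (simp add: str_whisk_right_simps(2) strable_def hom_iff TensA_Id)
  have l: "brl True [X, Y] W = str [X, Y, W] [W, X, Y] (?i \<cdot> \<c> (X \<odot> Y) W)"
    unfolding brl_def l1 l2 brd_def using X by (simp add: str_scomp strable_def hom_iff)
  have r1: "brd True X W \<rhd> [Y] = str [X, W, Y] [W, X, Y] (\<c> X W \<otimes> \<one> Y)"
    unfolding brd_def using X by (simp add: str_whisk_right_simps(4) strable_def hom_iff)
  have r2: "[X] \<lhd> brd True Y W = str [X, Y, W] [X, W, Y] (arr_inv C (\<a> X W Y) \<cdot> \<one> X \<otimes> \<c> Y W \<cdot> \<a> X Y W)"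
    unfolding brd_def using X by (simp add: str_whisk_left_simps(4) strable_def hom_iff)
  have "?i \<cdot> \<c> (X \<odot> Y) W = (?i \<cdot> \<c> (X \<odot> Y) W \<cdot> arr_inv C (\<a> X Y W)) \<cdot> \<a> X Y W"
    using X by simp
  also have "\<dots> = (\<c> X W \<otimes> \<one> Y \<cdot> arr_inv C (\<a> X W Y) \<cdot> \<one> X \<otimes> \<c> Y W) \<cdot> \<a> X Y W"
    using X by (simp only: hexagon2)
  finally show ?thesis
    unfolding l r1 r2 using X by (simp add: str_scomp strable_def hom_iff)
qed

lemma brr_pair_True:
  assumes X: "X \<in> Obj C" "Y \<in> Obj C" "W \<in> Obj C"
  shows "brr True W [X, Y] = [X] \<lhd> brd True W Y \<star> brd True W X \<rhd> [Y]"
proof -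
  have l1: "[W] \<lhd> join [X, Y] = str [W, X, Y] [W, X \<odot> Y] (\<a> W X Y)"
    unfolding join_def using X
    by (simp add: str_whisk_left_simps(2) strable_def hom_iff TensA_Id)
  have l2: "split [X, Y] \<rhd> [W] = str [X \<odot> Y, W] [X, Y, W] (\<one> (X \<odot> Y \<odot> W))"
    unfolding split_def using X
    by (simp add: str_whisk_right_simps(3) strable_def hom_iff TensA_Id)
  have l: "brr True W [X, Y] = str [W, X, Y] [X, Y, W] (\<c> W (X \<odot> Y) \<cdot> \<a> W X Y)"
    unfolding brr_def l1 l2 brd_def using X by (simp add: str_scomp strable_def hom_iff)
  have r1: "brd True W X \<rhd> [Y] = str [W, X, Y] [X, W, Y] (\<c> W X \<otimes> \<one> Y)"
    unfolding brd_def using X by (simp add: str_whisk_right_simps(4) strable_def hom_iff)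
  have r2: "[X] \<lhd> brd True W Y = str [X, W, Y] [X, Y, W] (arr_inv C (\<a> X Y W) \<cdot> \<one> X \<otimes> \<c> W Y \<cdot> \<a> X W Y)"
    unfolding brd_def using X by (simp add: str_whisk_left_simps(4) strable_def hom_iff)
  have "\<c> W (X \<odot> Y) \<cdot> \<a> W X Y = arr_inv C (\<a> X Y W) \<cdot> (\<a> X Y W \<cdot> \<c> W (X \<odot> Y) \<cdot> \<a> W X Y)"
    using X by simp
  also have "\<dots> = arr_inv C (\<a> X Y W) \<cdot> (\<one> X \<otimes> \<c> W Y \<cdot> \<a> X W Y \<cdot> \<c> W X \<otimes> \<one> Y)"
    using X by (simp only: hexagon1)
  finally show ?thesis
    unfolding l r1 r2 using X by (simp add: str_scomp strable_def hom_iff)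
qed

lemma brl_pair:
  assumes X: "X \<in> Obj C" "Y \<in> Obj C" "W \<in> Obj C"
  shows "brl s [X, Y] W = brd s X W \<rhd> [Y] \<star> [X] \<lhd> brd s Y W"
proof (cases s)
  case False
  \<comment> \<open>Both sides are left inverse to the positive block crossing
    \<open>brr True W [X, Y]\<close>, which the hexagon has already decomposed.\<close>
  have "brl False [X, Y] W = (brd False X W \<rhd> [Y] \<star> [X] \<lhd> brd False Y W)"
  proof (rule strand_iso_cancel)
    show "brr True W [X, Y] \<star> brl False [X, Y] W = sid [X, Y, W]"
      using brl_brr_inverse(2)[of "[X, Y]" W False] X by simp
    show "brl False [X, Y] W \<star> brr True W [X, Y]
        = (brd False X W \<rhd> [Y] \<star> [X] \<lhd> brd False Y W) \<star> brr True W [X, Y]"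
      using brl_brr_inverse(1)[of "[X, Y]" W True] X brd_whisk_inverse(3)[of W Y "[X]" "[]"]
      by (simp add: brr_pair_True ext2[OF brd_whisk_inverse(3)])
  qed (simp_all add: brl_def brr_def X)
  then show ?thesis using False by simp
qed (use brl_pair_True[OF X] in simp)

lemma brr_pair:
  assumes X: "X \<in> Obj C" "Y \<in> Obj C" "W \<in> Obj C"
  shows "brr s W [X, Y] = [X] \<lhd> brd s W Y \<star> brd s W X \<rhd> [Y]"
proof (cases s)
  case False
  have "brr False W [X, Y] = ([X] \<lhd> brd False W Y \<star> brd False W X \<rhd> [Y])"
  proof (rule strand_iso_cancel)
    show "brl True [X, Y] W \<star> brr False W [X, Y] = sid [W, X, Y]"
      using brl_brr_inverse(1)[of "[X, Y]" W False] X by simp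
    show "brr False W [X, Y] \<star> brl True [X, Y] W
        = ([X] \<lhd> brd False W Y \<star> brd False W X \<rhd> [Y]) \<star> brl True [X, Y] W"
      using brl_brr_inverse(2)[of "[X, Y]" W True] X
      by (simp add: brl_pair_True ext2[OF brd_whisk_inverse(3)])
  qed (simp_all add: brl_def brr_def X)
  then show ?thesis using False by simp
qed (use brr_pair_True[OF X] in simp)

lemma slide22:
  assumes f: "strable [X, Y] [X', Y'] f" and W: "W \<in> Obj C"
  shows "[W] \<lhd> str [X, Y] [X', Y'] f \<star> brd s X W \<rhd> [Y] \<star> [X] \<lhd> brd s Y W
      = brd s X' W \<rhd> [Y'] \<star> [X'] \<lhd> brd s Y' W \<star> str [X, Y] [X', Y'] f \<rhd> [W]"
    and "str [X, Y] [X', Y'] f \<rhd> [W] \<star> [X] \<lhd> brd s W Y \<star> brd s W X \<rhd> [Y]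
      = [X'] \<lhd> brd s W Y' \<star> brd s W X' \<rhd> [Y'] \<star> [W] \<lhd> str [X, Y] [X', Y'] f"
  using slide[OF f W, of s] strableD[OF f] W by (simp_all add: brl_pair brr_pair)

lemma slide21:
  assumes f: "strable [X, Y] [X'] f" and W: "W \<in> Obj C"
  shows "[W] \<lhd> str [X, Y] [X'] f \<star> brd s X W \<rhd> [Y] \<star> [X] \<lhd> brd s Y W
      = brd s X' W \<star> str [X, Y] [X'] f \<rhd> [W]"
    and "str [X, Y] [X'] f \<rhd> [W] \<star> [X] \<lhd> brd s W Y \<star> brd s W X \<rhd> [Y]
      = brd s W X' \<star> [W] \<lhd> str [X, Y] [X'] f"
  using slide[OF f W, of s] strableD[OF f] W by (simp_all add: brl_pair brr_pair)

text \<open>Naturality of the crossing at the unitor of \<open>\<I>\<close> gives the claim with one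
  more \<open>\<I>\<close> strand and one more crossing. The crossing is invertible and cancels; the
  strand goes by faithfulness of tensoring with \<open>\<I>\<close>.\<close>

lemma slide_unit:
  assumes V: "V \<in> Obj C"
  shows "[V] \<lhd> scap \<I> (\<one> \<I>) \<star> brd s \<I> V = scap \<I> (\<one> \<I>) \<rhd> [V]"
    and "scap \<I> (\<one> \<I>) \<rhd> [V] \<star> brd s V \<I> = [V] \<lhd> scap \<I> (\<one> \<I>)"
proof -
  let ?u = "scap \<I> (\<one> \<I>)"
  have h: "\<one> \<I> \<in> hom C \<I> \<I>" by (simp add: hom_iff)
  have F1: "?u \<rhd> [\<I>] = str [\<I>, \<I>] [\<I>] (cap_left C (\<one> \<I>) \<I>)"
    and F2: "[\<I>] \<lhd> ?u = str [\<I>, \<I>] [\<I>] (cap_right C (\<one> \<I>) \<I>)"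
    using scap_whisk[OF h, of \<I>] by simp_all
  have st: "strable [\<I>, \<I>] [\<I>] (cap_left C (\<one> \<I>) \<I>)" "strable [\<I>, \<I>] [\<I>] (cap_right C (\<one> \<I>) \<I>)"
    by (simp_all add: strable_def hom_iff cap_left_def cap_right_def)
  have "[V] \<lhd> ?u \<rhd> [\<I>] \<star> brd s \<I> V \<rhd> [\<I>] \<star> [\<I>] \<lhd> brd s \<I> V
      = brd s \<I> V \<star> ?u \<rhd> [\<I>, V]"
    using slide21(1)[OF st(1) V, of s] unfolding F1[symmetric] by simp
  also have "\<dots> = ?u \<rhd> [V, \<I>] \<star> [\<I>] \<lhd> brd s \<I> V"
    using interchange[of "[]" ?u "[]" "brd s \<I> V" "[]"] V by simp
  finally have 1: "([V] \<lhd> ?u \<rhd> [\<I>] \<star> brd s \<I> V \<rhd> [\<I>]) \<star> [\<I>] \<lhd> brd s \<I> V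
      = ?u \<rhd> [V, \<I>] \<star> [\<I>] \<lhd> brd s \<I> V" by simp
  have "[V] \<lhd> ?u \<rhd> [\<I>] \<star> brd s \<I> V \<rhd> [\<I>] = ?u \<rhd> [V, \<I>]"
  proof (rule strand_iso_cancel[OF _ _ _ _ _ 1])
    show "[\<I>] \<lhd> brd s \<I> V \<star> [\<I>] \<lhd> brd (\<not> s) V \<I> = sid [\<I>, V, \<I>]"
      using brd_whisk_inverse(1)[of V \<I> "[\<I>]" "[]" "\<not> s"] V by simp
  qed simp_all
  then have "([V] \<lhd> ?u \<star> brd s \<I> V) \<rhd> [\<I>] = (?u \<rhd> [V]) \<rhd> [\<I>]" by simp
  then show "[V] \<lhd> ?u \<star> brd s \<I> V = ?u \<rhd> [V]"
    by (rule whisk_unit_faithful(1)[rotated 4]) (use V h in simp_all)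
  have "[\<I>] \<lhd> ?u \<rhd> [V] \<star> [\<I>] \<lhd> brd s V \<I> \<star> brd s V \<I> \<rhd> [\<I>]
      = brd s V \<I> \<star> [V, \<I>] \<lhd> ?u"
    using slide21(2)[OF st(2) V, of s] unfolding F2[symmetric] by simp
  also have "\<dots> = [\<I>, V] \<lhd> ?u \<star> brd s V \<I> \<rhd> [\<I>]"
    using interchange[of "[]" "brd s V \<I>" "[]" ?u "[]"] V by simp
  finally have 2: "([\<I>] \<lhd> ?u \<rhd> [V] \<star> [\<I>] \<lhd> brd s V \<I>) \<star> brd s V \<I> \<rhd> [\<I>]
      = [\<I>, V] \<lhd> ?u \<star> brd s V \<I> \<rhd> [\<I>]" by simp
  have "[\<I>] \<lhd> ?u \<rhd> [V] \<star> [\<I>] \<lhd> brd s V \<I> = [\<I>, V] \<lhd> ?u"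
  proof (rule strand_iso_cancel[OF _ _ _ _ _ 2])
    show "brd s V \<I> \<rhd> [\<I>] \<star> brd (\<not> s) \<I> V \<rhd> [\<I>] = sid [\<I>, V, \<I>]"
      using brd_whisk_inverse(1)[of \<I> V "[]" "[\<I>]" "\<not> s"] V by simp
  qed simp_all
  then have "[\<I>] \<lhd> (?u \<rhd> [V] \<star> brd s V \<I>) = [\<I>] \<lhd> ([V] \<lhd> ?u)" by simp
  then show "?u \<rhd> [V] \<star> brd s V \<I> = [V] \<lhd> ?u"
    by (rule whisk_unit_faithful(2)[rotated 4]) (use V h in simp_all)
qed

text \<open>\<open>scap A e\<close> is the arrow \<open>e\<close> into \<open>\<I>\<close> followed
  by the cap of \<open>\<I>\<close>; the first part slides by naturality, the second by
  \<open>slide_unit\<close>.\<close>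

lemma slide10:
  assumes e: "e \<in> hom C A \<I>" and V: "V \<in> Obj C"
  shows "[V] \<lhd> scap A e \<star> brd s A V = scap A e \<rhd> [V]"
    and "scap A e \<rhd> [V] \<star> brd s V A = [V] \<lhd> scap A e"
proof -
  have h: "\<one> \<I> \<in> hom C \<I> \<I>" "A \<in> Obj C" using e by (auto simp: hom_iff)
  have st: "strable [A] [\<I>] e" using e h by (simp add: strable_def)
  have eq: "scap A e = scap \<I> (\<one> \<I>) \<star> str [A] [\<I>] e"
    by (rule strand_eqI) (use e h st in \<open>auto simp: sat_str hom_iff iso_Id TensA_Id\<close>)
  show "[V] \<lhd> scap A e \<star> brd s A V = scap A e \<rhd> [V]"
    unfolding eq using slide11(1)[OF st V, of s] slide_unit(1)[OF V, of s] by (simp add: ext2)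
  show "scap A e \<rhd> [V] \<star> brd s V A = [V] \<lhd> scap A e"
    unfolding eq using slide11(2)[OF st V, of s] slide_unit(2)[OF V, of s] by (simp add: ext2)
qed

end

section \<open>Regular multiplier Hopf monoids\<close>

locale regular_hopf_monoid = braided_monoidal_category C
  for C :: "('o, 'a, 'm) bmc_data_scheme" (structure) +
  fixes Q :: "'a set" and B :: "('o, 'a) mult_data"
  assumes adm: "admissible_class C Q"
    and reg: "regular_multiplier_bimonoid C B"
    and nondeg: "nondegenerate C (Car B) (mult C B)"
    and counit_Q: "Counit B \<in> Q"
    and hopf: "multiplier_hopf_monoid C (Car B) (T1 B) (T2 B) (Counit B)"
begin

abbreviation A :: 'o where "A \<equiv> Car B"
abbreviation e :: 'a where "e \<equiv> Counit B"
abbreviation mul :: 'a where "mul \<equiv> mult C B"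

lemma bim: "multiplier_bimonoid C A (T1 B) (T2 B) e" "multiplier_bimonoid (rev_braid C) A (T3 B) (T4 B) e"
  using reg by (auto simp: regular_multiplier_bimonoid_def Let_def)

lemma A_Obj [simp]: "A \<in> Obj C"
  using bim by (auto simp: multiplier_bimonoid_def)

lemma e_hom: "e \<in> hom C A \<I>"
  using bim by (auto simp: multiplier_bimonoid_def)

lemma T_simps [simp]:
  "T1 B \<in> Arr C" "Dom C (T1 B) = A \<odot> A" "Cod C (T1 B) = A \<odot> A"
  "T2 B \<in> Arr C" "Dom C (T2 B) = A \<odot> A" "Cod C (T2 B) = A \<odot> A"
  "T3 B \<in> Arr C" "Dom C (T3 B) = A \<odot> A" "Cod C (T3 B) = A \<odot> A"
  "e \<in> Arr C" "Dom C e = A" "Cod C e = \<I>"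
  "is_iso C (T1 B)" "is_iso C (T2 B)"
  using bim hopf by (auto simp: multiplier_bimonoid_def multiplier_hopf_monoid_def hom_iff rev_braid_def)

lemma cap_simps [simp]:
  "X \<in> Obj C \<Longrightarrow> cap_left C e X \<in> Arr C" "X \<in> Obj C \<Longrightarrow> Dom C (cap_left C e X) = A \<odot> X"
  "X \<in> Obj C \<Longrightarrow> Cod C (cap_left C e X) = X"
  "X \<in> Obj C \<Longrightarrow> cap_right C e X \<in> Arr C" "X \<in> Obj C \<Longrightarrow> Dom C (cap_right C e X) = X \<odot> A"
  "X \<in> Obj C \<Longrightarrow> Cod C (cap_right C e X) = X"
  by (simp_all add: cap_left_def cap_right_def)

lemma mul_simps [simp]: "mul \<in> Arr C" "Dom C mul = A \<odot> A" "Cod C mul = A"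
  by (simp_all add: mult_def)

section \<open>The axioms of \<open>A\<close> as equations of strands\<close>

definition t1 :: "('o, 'a) strand" where "t1 = str [A, A] [A, A] (T1 B)"
definition t2 :: "('o, 'a) strand" where "t2 = str [A, A] [A, A] (T2 B)"
definition t3 :: "('o, 'a) strand" where "t3 = str [A, A] [A, A] (T3 B)"
definition t1i :: "('o, 'a) strand" where "t1i = str [A, A] [A, A] (arr_inv C (T1 B))"
definition t2i :: "('o, 'a) strand" where "t2i = str [A, A] [A, A] (arr_inv C (T2 B))"
definition m :: "('o, 'a) strand" where "m = str [A, A] [A] mul"
definition ep :: "('o, 'a) strand" where "ep = scap A e"

abbreviation bd :: "'o \<Rightarrow> 'o \<Rightarrow> ('o, 'a) strand" where "bd \<equiv> brd True"
abbreviation bi :: "'o \<Rightarrow> 'o \<Rightarrow> ('o, 'a) strand" where "bi \<equiv> brd False"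

lemma strable_gens [simp]:
  "strable [A, A] [A, A] (T1 B)" "strable [A, A] [A, A] (T2 B)" "strable [A, A] [A, A] (T3 B)"
  "strable [A, A] [A, A] (arr_inv C (T1 B))" "strable [A, A] [A, A] (arr_inv C (T2 B))"
  "strable [A, A] [A] mul"
  by (simp_all add: strable_def hom_iff)

lemma gens_simps [simp]:
  "sdom t1 = [A, A]" "scod t1 = [A, A]" "rep t1" "normal t1"
  "sdom t2 = [A, A]" "scod t2 = [A, A]" "rep t2" "normal t2"
  "sdom t3 = [A, A]" "scod t3 = [A, A]" "rep t3" "normal t3"
  "sdom t1i = [A, A]" "scod t1i = [A, A]" "rep t1i" "normal t1i"
  "sdom t2i = [A, A]" "scod t2i = [A, A]" "rep t2i" "normal t2i"
  "sdom m = [A, A]" "scod m = [A]" "rep m" "normal m"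
  "sdom ep = [A]" "scod ep = []" "normal ep"
  by (simp_all add: t1_def t2_def t3_def t1i_def t2i_def m_def ep_def)

lemma rep_ep [simp]: "set xs \<subseteq> Obj C \<Longrightarrow> set ys \<subseteq> Obj C \<Longrightarrow> xs @ ys \<noteq> [] \<Longrightarrow> rep (xs \<lhd> ep \<rhd> ys)"
  unfolding ep_def using e_hom by (rule rep_scap)

lemma valid_gens [simp]: "valid t1" "valid t2" "valid t3" "valid t1i" "valid t2i" "valid m" "valid ep"
  "X \<in> Obj C \<Longrightarrow> Y \<in> Obj C \<Longrightarrow> valid (brd s X Y)"
  using e_hom by (simp_all add: rep_valid) (simp add: ep_def)

lemma t_inverse [simp]: "t1i \<star> t1 = sid [A, A]" "t1 \<star> t1i = sid [A, A]"
  "t2i \<star> t2 = sid [A, A]" "t2 \<star> t2i = sid [A, A]"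
  using str_Id[of "[A, A]"] by (simp_all add: t1_def t1i_def t2_def t2i_def str_scomp)

lemma t_whisk_inverse [simp]:
  assumes "set us \<subseteq> Obj C" "set vs \<subseteq> Obj C"
  shows "us \<lhd> t1i \<rhd> vs \<star> us \<lhd> t1 \<rhd> vs = sid (us @ [A, A] @ vs)"
    "us \<lhd> t1 \<rhd> vs \<star> us \<lhd> t1i \<rhd> vs = sid (us @ [A, A] @ vs)"
    "us \<lhd> t2i \<rhd> vs \<star> us \<lhd> t2 \<rhd> vs = sid (us @ [A, A] @ vs)"
    "us \<lhd> t2 \<rhd> vs \<star> us \<lhd> t2i \<rhd> vs = sid (us @ [A, A] @ vs)"
  unfolding swhisk_scomp[symmetric] using assms by simp_all

lemma ep_whisk:
  assumes "X \<in> Obj C"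
  shows "[X] \<lhd> ep = str [X, A] [X] (cap_right C e X)" and "ep \<rhd> [X] = str [A, X] [X] (cap_left C e X)"
  unfolding ep_def using scap_whisk[OF e_hom assms] .

text \<open>Reversal changes nothing but the braiding, and the inverse of the reversed braiding is
  the original one. So the axioms for \<open>t\<^sub>3\<close> and \<open>t\<^sub>4\<close> can be
  read in the given category.\<close>

lemma rev_braid_simps [simp]:
  "lift23 (rev_braid C) X Y Z f = lift23 C X Y Z f" "cap_right (rev_braid C) f X = cap_right C f X"
  "cap_left (rev_braid C) f X = cap_left C f X"
  "X \<in> Obj C \<Longrightarrow> Y \<in> Obj C \<Longrightarrow> braid_inv (rev_braid C) X Y = \<c> X Y"
proof -
  have a: "arr_inv (rev_braid C) = arr_inv C"
    by (rule ext) (simp add: arr_inv_def inverse_arrows_def rev_braid_def hom_def)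
  show "lift23 (rev_braid C) X Y Z f = lift23 C X Y Z f" "cap_right (rev_braid C) f X = cap_right C f X"
    "cap_left (rev_braid C) f X = cap_left C f X"
    by (simp_all add: lift23_def a cap_right_def cap_left_def) (simp_all add: rev_braid_def)
  show "X \<in> Obj C \<Longrightarrow> Y \<in> Obj C \<Longrightarrow> braid_inv (rev_braid C) X Y = \<c> X Y"
    by (simp add: braid_inv_def a) (simp add: rev_braid_def braid_inv_def)
qed

text \<open>Collapses a strand made of generators to \<open>str\<close> of a single arrow. An axiom
  under \<open>str\<close> and the strand equation rewritten by this set then coincide, which
  transfers equations in both directions.\<close>

lemmas to_str = str_whisk_left_simps str_whisk_right_simps ep_whisk str_scomp strable_def hom_iff
  lift23_def mul23_def brd_def t1_def t2_def t3_def m_def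

lemma t1_fusion: "t1 \<rhd> [A] \<star> bi A A \<rhd> [A] \<star> [A] \<lhd> t1 \<star> bd A A \<rhd> [A] \<star> [A] \<lhd> t1
    = [A] \<lhd> t1 \<star> t1 \<rhd> [A]"
proof -
  have "T1 B \<otimes> \<one> A \<cdot> \<c>\<inverse> A A \<otimes> \<one> A \<cdot> lift23 C A A A (T1 B) \<cdot> \<c> A A \<otimes> \<one> A \<cdot> lift23 C A A A (T1 B)
       = lift23 C A A A (T1 B) \<cdot> T1 B \<otimes> \<one> A"
    using bim by (simp add: multiplier_bimonoid_def)
  from arg_cong[OF this, of "str [A, A, A] [A, A, A]"] show ?thesis by (simp add: to_str)
qed

lemma t3_fusion: "t3 \<rhd> [A] \<star> bd A A \<rhd> [A] \<star> [A] \<lhd> t3 \<star> bi A A \<rhd> [A] \<star> [A] \<lhd> t3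
    = [A] \<lhd> t3 \<star> t3 \<rhd> [A]"
proof -
  have "T3 B \<otimes> \<one> A \<cdot> \<c> A A \<otimes> \<one> A \<cdot> lift23 C A A A (T3 B) \<cdot> \<c>\<inverse> A A \<otimes> \<one> A \<cdot> lift23 C A A A (T3 B)
       = lift23 C A A A (T3 B) \<cdot> T3 B \<otimes> \<one> A"
    using bim(2) unfolding multiplier_bimonoid_def by (simp del: T_simps) (simp add: rev_braid_def)
  from arg_cong[OF this, of "str [A, A, A] [A, A, A]"] show ?thesis by (simp add: to_str)
qed

lemma t2_fusion: "[A] \<lhd> t2 \<star> [A] \<lhd> bi A A \<star> t2 \<rhd> [A] \<star> [A] \<lhd> bd A A \<star> t2 \<rhd> [A]
    = t2 \<rhd> [A] \<star> [A] \<lhd> t2"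
proof -
  have "lift23 C A A A (T2 B) \<cdot> lift23 C A A A (\<c>\<inverse> A A) \<cdot> T2 B \<otimes> \<one> A \<cdot> lift23 C A A A (\<c> A A) \<cdot> T2 B \<otimes> \<one> A
       = T2 B \<otimes> \<one> A \<cdot> lift23 C A A A (T2 B)"
    using bim by (simp add: multiplier_bimonoid_def)
  from arg_cong[OF this, of "str [A, A, A] [A, A, A]"] show ?thesis by (simp add: to_str)
qed

lemma t12_commute: "[A] \<lhd> t1 \<star> t2 \<rhd> [A] = t2 \<rhd> [A] \<star> [A] \<lhd> t1"
proof -
  have "lift23 C A A A (T1 B) \<cdot> T2 B \<otimes> \<one> A = T2 B \<otimes> \<one> A \<cdot> lift23 C A A A (T1 B)"
    using bim by (simp add: multiplier_bimonoid_def)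
  from arg_cong[OF this, of "str [A, A, A] [A, A, A]"] show ?thesis by (simp add: to_str)
qed

lemma t32_commute: "[A] \<lhd> t3 \<star> t2 \<rhd> [A] = t2 \<rhd> [A] \<star> [A] \<lhd> t3"
proof -
  have "lift23 C A A A (T3 B) \<cdot> T2 B \<otimes> \<one> A = T2 B \<otimes> \<one> A \<cdot> lift23 C A A A (T3 B)"
    using reg by (simp add: regular_multiplier_bimonoid_def Let_def)
  from arg_cong[OF this, of "str [A, A, A] [A, A, A]"] show ?thesis by (simp add: to_str)
qed

lemma t13_compat: "[A] \<lhd> m \<star> bd A A \<rhd> [A] \<star> [A] \<lhd> t1
    = [A] \<lhd> m \<star> t3 \<rhd> [A] \<star> bd A A \<rhd> [A]"
proof -
  have "mul23 C A A mul \<cdot> \<c> A A \<otimes> \<one> A \<cdot> lift23 C A A A (T1 B) = mul23 C A A mul \<cdot> T3 B \<otimes> \<one> A \<cdot> \<c> A A \<otimes> \<one> A"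
    using reg by (simp add: regular_multiplier_bimonoid_def Let_def)
  from arg_cong[OF this, of "str [A, A, A] [A, A]"] show ?thesis by (simp add: to_str)
qed

lemma ep_t1: "[A] \<lhd> ep \<star> t1 = [A] \<lhd> ep"
proof -
  have "cap_right C e A \<cdot> T1 B = cap_right C e A" using bim by (simp add: multiplier_bimonoid_def)
  from arg_cong[OF this, of "str [A, A] [A]"] show ?thesis by (simp add: to_str)
qed

lemma ep_t3: "[A] \<lhd> ep \<star> t3 = [A] \<lhd> ep"
proof -
  have "cap_right C e A \<cdot> T3 B = cap_right C e A"
    using bim(2) unfolding multiplier_bimonoid_def by (simp del: T_simps) (simp add: rev_braid_def)
  from arg_cong[OF this, of "str [A, A] [A]"] show ?thesis by (simp add: to_str)
qed

lemma m_t1: "ep \<rhd> [A] \<star> t1 = m"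
  by (simp add: to_str mult_def)

lemma m_t2: "[A] \<lhd> ep \<star> t2 = m"
proof -
  have "mul = cap_right C e A \<cdot> T2 B" using bim by (simp add: multiplier_bimonoid_def mult_def)
  then show ?thesis by (simp add: to_str)
qed

lemma m_t3: "ep \<rhd> [A] \<star> t3 = m \<star> bi A A"
proof (rule strand_iso_cancel[where x = "bd A A" and y = "bi A A"])
  have "mul = cap_left C e A \<cdot> T3 B \<cdot> \<c> A A"
    using reg by (simp add: regular_multiplier_bimonoid_def Let_def mult_def)
  then have "m = (ep \<rhd> [A] \<star> t3) \<star> bd A A" by (simp add: to_str)
  then show "(ep \<rhd> [A] \<star> t3) \<star> bd A A = (m \<star> bi A A) \<star> bd A A" by simp
qed simp_all

lemma ep_slide:
  assumes "V \<in> Obj C"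
  shows "[V] \<lhd> ep \<star> brd s A V = ep \<rhd> [V]" and "ep \<rhd> [V] \<star> brd s V A = [V] \<lhd> ep"
  unfolding ep_def using slide10[OF e_hom assms] by simp_all

section \<open>Non-degeneracy as cancellation of a test multiplication\<close>

lemma nondeg_right:
  assumes "rep F" "rep G" "sdom F = sdom G" "scod F = [Y, A]" "scod G = [Y, A]"
    and eq: "[Y] \<lhd> m \<star> F \<rhd> [A] = [Y] \<lhd> m \<star> G \<rhd> [A]"
  shows "F = G"
proof -
  obtain f where f: "strable (sdom F) [Y, A] f" "str (sdom F) [Y, A] f = F"
    using assms unfolding rep_def by metis
  obtain g where g: "strable (sdom F) [Y, A] g" "str (sdom F) [Y, A] g = G"
    using assms unfolding rep_def by metis
  note d = strableD[OF f(1)] strableD[OF g(1)]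
  let ?xs = "sdom F"
  have Y: "Y \<in> Obj C" using d by simp
  have mY: "[Y] \<lhd> m = str [Y, A, A] [Y, A] (mul23 C Y A mul)" using Y by (simp add: to_str)
  have st: "strable [Y, A, A] [Y, A] (mul23 C Y A mul)" using Y by (simp add: strable_def hom_iff mul23_def)
  have w: "[Y] \<lhd> m \<star> str ?xs [Y, A] h \<rhd> [A] = str (?xs @ [A]) [Y, A] (mul23 C Y A mul \<cdot> h \<otimes> \<one> A)"
    and sw: "strable (?xs @ [A]) [Y, A] (mul23 C Y A mul \<cdot> h \<otimes> \<one> A)"
    if "strable ?xs [Y, A] h" for h
  proof -
    have s2: "strable (?xs @ [A]) [Y, A, A] (h \<otimes> \<one> A)" using strable_whisk_right[OF that A_Obj] by simp
    show "[Y] \<lhd> m \<star> str ?xs [Y, A] h \<rhd> [A] = str (?xs @ [A]) [Y, A] (mul23 C Y A mul \<cdot> h \<otimes> \<one> A)"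
      unfolding mY using str_whisk_right[OF that A_Obj] str_scomp[OF s2 st] by simp
    show "strable (?xs @ [A]) [Y, A] (mul23 C Y A mul \<cdot> h \<otimes> \<one> A)"
      using s2 st by (auto simp: strable_def hom_iff)
  qed
  have "str (?xs @ [A]) [Y, A] (mul23 C Y A mul \<cdot> f \<otimes> \<one> A) = str (?xs @ [A]) [Y, A] (mul23 C Y A mul \<cdot> g \<otimes> \<one> A)"
    using eq w[OF f(1)] w[OF g(1)] unfolding f(2) g(2) by simp
  then have "mul23 C Y A mul \<cdot> f \<otimes> \<one> A = mul23 C Y A mul \<cdot> g \<otimes> \<one> A"
    by (rule str_faithful[OF sw[OF f(1)] sw[OF g(1)]])
  moreover have "inj_on (\<lambda>f. mul23 C Y A mul \<cdot> f \<otimes> \<one> A) (hom C (br ?xs) (Y \<odot> A))"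
    using nondeg d Y unfolding nondegenerate_def by simp
  ultimately have "f = g" using f(1) g(1) by (auto simp: strable_def inj_on_def)
  then show ?thesis using f g by simp
qed

lemma nondeg_left:
  assumes "rep F" "rep G" "sdom F = sdom G" "scod F = [A, Y]" "scod G = [A, Y]"
    and eq: "m \<rhd> [Y] \<star> [A] \<lhd> F = m \<rhd> [Y] \<star> [A] \<lhd> G"
  shows "F = G"
proof -
  obtain f where f: "strable (sdom F) [A, Y] f" "str (sdom F) [A, Y] f = F"
    using assms unfolding rep_def by metis
  obtain g where g: "strable (sdom F) [A, Y] g" "str (sdom F) [A, Y] g = G"
    using assms unfolding rep_def by metis
  note d = strableD[OF f(1)] strableD[OF g(1)]
  let ?xs = "sdom F"
  have Y: "Y \<in> Obj C" using d by simp
  have mY: "m \<rhd> [Y] = str [A, A, Y] [A, Y] (mul \<otimes> \<one> Y)" using Y by (simp add: to_str)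
  have st: "strable [A, A, Y] [A, Y] (mul \<otimes> \<one> Y)" using Y by (simp add: strable_def hom_iff)
  define L where "L h = mul \<otimes> \<one> Y \<cdot> arr_inv C (\<a> A A Y) \<cdot> \<one> A \<otimes> h" for h
  have w: "m \<rhd> [Y] \<star> [A] \<lhd> str ?xs [A, Y] h = str (A # ?xs) [A, Y] (L h \<cdot> kap A ?xs)"
    and sw: "strable (A # ?xs) [A, Y] (L h \<cdot> kap A ?xs)"
    and Lh: "L h \<in> hom C (A \<odot> br ?xs) (A \<odot> Y)"
    if h: "strable ?xs [A, Y] h" for h
  proof -
    note dh = strableD[OF h]
    have s2: "strable (A # ?xs) [A, A, Y] (sat (str ?xs [A, Y] h) A)" using sat_str_hom[OF h A_Obj] by simp
    have e1: "mul \<otimes> \<one> Y \<cdot> sat (str ?xs [A, Y] h) A = L h \<cdot> kap A ?xs"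
      using dh Y by (simp add: sat_str[OF h] L_def)
    show "m \<rhd> [Y] \<star> [A] \<lhd> str ?xs [A, Y] h = str (A # ?xs) [A, Y] (L h \<cdot> kap A ?xs)"
      unfolding mY str_whisk_left[OF h A_Obj] str_scomp[OF s2 st] e1 ..
    show "strable (A # ?xs) [A, Y] (L h \<cdot> kap A ?xs)"
      unfolding e1[symmetric] using s2 st by (auto simp: strable_def hom_iff)
    show "L h \<in> hom C (A \<odot> br ?xs) (A \<odot> Y)" using dh Y by (simp add: L_def hom_iff)
  qed
  have "str (A # ?xs) [A, Y] (L f \<cdot> kap A ?xs) = str (A # ?xs) [A, Y] (L g \<cdot> kap A ?xs)"
    using eq w[OF f(1)] w[OF g(1)] unfolding f(2) g(2) by simp
  then have "L f \<cdot> kap A ?xs = L g \<cdot> kap A ?xs"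
    by (rule str_faithful[OF sw[OF f(1)] sw[OF g(1)]])
  then have "L f = L g"
    by (rule epiD[OF iso_epi, rotated 3]) (use d Lh[OF f(1)] Lh[OF g(1)] in simp_all)
  moreover have "inj_on L (hom C (br ?xs) (A \<odot> Y))"
    using nondeg d Y unfolding nondegenerate_def L_def by simp
  ultimately have "f = g" using f(1) g(1) by (auto simp: strable_def inj_on_def)
  then show ?thesis using f g by simp
qed

text \<open>The test factor enters from the left and must pass \<open>V\<close> before it
  multiplies. Composing with the crossing that brings \<open>A\<close> in front of \<open>V\<close>
  reduces this to \<open>nondeg_left\<close>.\<close>

lemma nondeg_cross:
  assumes "rep F" "rep G" "sdom F = sdom G" "scod F = [V, A]" "scod G = [V, A]"
    and eq: "[V] \<lhd> m \<star> brd s A V \<rhd> [A] \<star> [A] \<lhd> F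
      = [V] \<lhd> m \<star> brd s A V \<rhd> [A] \<star> [A] \<lhd> G"
  shows "F = G"
proof -
  have V: "V \<in> Obj C" using validD(2)[OF rep_valid[OF assms(1)]] assms by simp
  let ?b = "brd (\<not> s) V A"
  have sl: "m \<rhd> [V] \<star> [A] \<lhd> ?b = ?b \<star> [V] \<lhd> m \<star> brd s A V \<rhd> [A]"
  proof (rule strand_iso_cancel)
    show "?b \<rhd> [A] \<star> brd s A V \<rhd> [A] = sid [A, V, A]"
      using brd_whisk_inverse(1)[of A V "[]" "[A]" s] V by simp
    show "(m \<rhd> [V] \<star> [A] \<lhd> ?b) \<star> ?b \<rhd> [A]
        = (?b \<star> [V] \<lhd> m \<star> brd s A V \<rhd> [A]) \<star> ?b \<rhd> [A]"
      using slide21(2)[of A A A mul V "\<not> s"] V brd_whisk_inverse(1)[of V A "[]" "[A]" "\<not> s"]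
      unfolding m_def by simp
  qed (use V in simp_all)
  have "?b \<star> F = ?b \<star> G"
  proof (rule nondeg_left)
    show "m \<rhd> [V] \<star> [A] \<lhd> (?b \<star> F) = m \<rhd> [V] \<star> [A] \<lhd> (?b \<star> G)"
      using ext2[OF sl] eq by simp
  qed (use assms V in simp_all)
  moreover have "brd s A V \<star> ?b = sid [V, A]" using brd_inverse(1)[of V A "\<not> s"] V by simp
  ultimately show ?thesis
    using assms rep_valid by (metis scomp_assoc sid_scomp valid_normal)
qed

text \<open>Here the test factor stands on the right but multiplies from the left. Pulling its
  strand across the whole of \<open>F\<close> turns the test into that of
  \<open>nondeg_cross\<close>.\<close>

lemma nondeg_opposite_pair:
  assumes F: "rep F" and G: "rep G" and "sdom F = sdom G" "scod F = [V, A]" "scod G = [V, A]"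
    and eq: "[V] \<lhd> m \<star> [V] \<lhd> bi A A \<star> F \<rhd> [A]
      = [V] \<lhd> m \<star> [V] \<lhd> bi A A \<star> G \<rhd> [A]"
  shows "F = G"
proof -
  have V: "V \<in> Obj C" using validD(2)[OF rep_valid[OF assms(1)]] assms by simp
  have sl: "F \<rhd> [A] \<star> brr True A (sdom F) = [V] \<lhd> bd A A \<star> bd A V \<rhd> [A] \<star> [A] \<lhd> F"
    if "rep F" "scod F = [V, A]" for F
  proof -
    note h = that
    obtain f where f: "strable (sdom F) [V, A] f" "str (sdom F) [V, A] f = F"
      using h unfolding rep_def by metis
    show ?thesis using slide(2)[OF f(1) A_Obj, of True] brr_pair[OF V A_Obj A_Obj, of True] unfolding f(2) by simp
  qed
  have "([V] \<lhd> m \<star> [V] \<lhd> bi A A \<star> F \<rhd> [A]) \<star> brr True A (sdom F)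
     = ([V] \<lhd> m \<star> [V] \<lhd> bi A A \<star> G \<rhd> [A]) \<star> brr True A (sdom F)"
    by (simp only: eq)
  then have "[V] \<lhd> m \<star> bd A V \<rhd> [A] \<star> [A] \<lhd> F = [V] \<lhd> m \<star> bd A V \<rhd> [A] \<star> [A] \<lhd> G"
    using sl[OF F] sl[OF G] assms(1-5) V by (simp add: ext2[OF brd_whisk_inverse(3)])
  then show ?thesis using assms(1-5) by (rule_tac nondeg_cross[of F G V True]) simp_all
qed

lemma nondeg_opposite:
  assumes F: "rep F" and G: "rep G" and "sdom F = sdom G" "scod F = ys @ [A]" "scod G = ys @ [A]" "ys \<noteq> []"
    and eq: "ys \<lhd> m \<star> ys \<lhd> bi A A \<star> F \<rhd> [A]
      = ys \<lhd> m \<star> ys \<lhd> bi A A \<star> G \<rhd> [A]"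
  shows "F = G"
proof -
  have ys: "set ys \<subseteq> Obj C" using validD(2)[OF rep_valid[OF F]] assms by simp
  let ?j = "join ys \<rhd> [A]"
  have x1: "[br ys] \<lhd> m \<star> join ys \<rhd> [A, A] = ?j \<star> ys \<lhd> m"
    using interchange[of "[]" "join ys" "[]" m "[]"] by simp
  have x2: "[br ys] \<lhd> bi A A \<star> join ys \<rhd> [A, A] = join ys \<rhd> [A, A] \<star> ys \<lhd> bi A A"
    using interchange[of "[]" "join ys" "[]" "bi A A" "[]"] by simp
  have "?j \<star> F = ?j \<star> G"
  proof (rule nondeg_opposite_pair[where V = "br ys"])
    show "[br ys] \<lhd> m \<star> [br ys] \<lhd> bi A A \<star> (?j \<star> F) \<rhd> [A]
        = [br ys] \<lhd> m \<star> [br ys] \<lhd> bi A A \<star> (?j \<star> G) \<rhd> [A]"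
      using eq by (simp add: ext2[OF x1] ext2[OF x2])
  qed (use assms ys in simp_all)
  moreover have "split ys \<rhd> [A] \<star> ?j = sid (ys @ [A])"
    unfolding swhisk_scomp[symmetric] using assms ys by simp
  ultimately show ?thesis
    using assms rep_valid by (metis scomp_assoc sid_scomp valid_normal)
qed


section \<open>The class \<open>Q\<close> and the two halves of the antipode\<close>

lemma Q_Comp: "p \<in> Q \<Longrightarrow> q \<in> Q \<Longrightarrow> Cod C p = Dom C q \<Longrightarrow> q \<cdot> p \<in> Q"
  and Q_TensA: "p \<in> Q \<Longrightarrow> q \<in> Q \<Longrightarrow> p \<otimes> q \<in> Q"
  and Q_iso: "is_iso C f \<Longrightarrow> f \<in> Q"
  and Q_regular: "q \<in> Q \<Longrightarrow> is_regular_epi C q"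
  using adm by (auto simp: admissible_class_def)

lemma Q_strong: "q \<in> Q \<Longrightarrow> is_strong_epi C q"
  by (simp add: Q_regular regular_epi_strong)

lemma Q_epi: "q \<in> Q \<Longrightarrow> is_epi C q"
  using Q_strong by (simp add: is_strong_epi_def)

lemma Q_Id: "X \<in> Obj C \<Longrightarrow> \<one> X \<in> Q"
  by (simp add: Q_iso iso_Id)

lemma Q_cap: "X \<in> Obj C \<Longrightarrow> cap_left C e X \<in> Q" "X \<in> Obj C \<Longrightarrow> cap_right C e X \<in> Q"
  unfolding cap_left_def cap_right_def by (simp_all add: Q_Comp Q_TensA Q_iso Q_Id counit_Q)

lemmas brd_cancel = brd_whisk_inverse[THEN ext2] brd_inverse[THEN ext2]
lemmas t_cancel = t_whisk_inverse[THEN ext2] t_inverse[THEN ext2]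

definition sC :: 'a where "sC = cap_left C e A \<cdot> arr_inv C (T1 B)"
definition sC' :: 'a where "sC' = cap_right C e A \<cdot> arr_inv C (T2 B)"

lemma sC_simps [simp]: "sC \<in> Arr C" "Dom C sC = A \<odot> A" "Cod C sC = A" "sC \<in> Q"
  "sC' \<in> Arr C" "Dom C sC' = A \<odot> A" "Cod C sC' = A" "sC' \<in> Q"
  by (simp_all add: sC_def sC'_def Q_Comp Q_iso Q_cap)

text \<open>In element notation \<open>s\<close> is \<open>a b \<mapsto> S(a) b\<close> and \<open>s'\<close> is \<open>a b \<mapsto> a S(b)\<close>.\<close>

definition s :: "('o, 'a) strand" where "s = str [A, A] [A] sC"
definition s' :: "('o, 'a) strand" where "s' = str [A, A] [A] sC'"
text \<open>The opposite multiplication \<open>a \<otimes> b \<mapsto> b a\<close>. By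
  \<open>n_t3\<close> it is the multiplication that \<open>t\<^sub>3\<close> and \<open>e\<close>
  define in the category with reversed braiding.\<close>

definition n :: "('o, 'a) strand" where "n = m \<star> bi A A"

lemma strable_s [simp]: "strable [A, A] [A] sC" "strable [A, A] [A] sC'"
  by (simp_all add: strable_def hom_iff)

lemma s_simps [simp]:
  "sdom s = [A, A]" "scod s = [A]" "rep s" "normal s" "valid s"
  "sdom s' = [A, A]" "scod s' = [A]" "rep s'" "normal s'" "valid s'"
  "sdom n = [A, A]" "scod n = [A]" "rep n" "normal n" "valid n"
  by (simp_all add: s_def s'_def n_def rep_valid)

lemma s_t1: "s \<star> t1 = ep \<rhd> [A]" and s'_t2: "s' \<star> t2 = [A] \<lhd> ep"
  by (simp_all add: s_def s'_def sC_def sC'_def to_str)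

lemma n_t3: "ep \<rhd> [A] \<star> t3 = n"
  by (simp add: n_def m_t3)

text \<open>The counit on the middle factor collapses the fusion law to linearity of the coaction.
  The sign, \<open>t\<close> and \<open>k\<close> are kept variable to serve both
  \<open>v\<^sup>1\<close> with \<open>t\<^sub>1\<close> and \<open>v\<^sup>3\<close> with
  \<open>t\<^sub>3\<close>.\<close>

lemma fusion_linear:
  assumes r: "rep r" "sdom r = [V, A]" "scod r = [V, A]"
    and fusion: "r \<rhd> [A] \<star> brd (\<not> sg) A V \<rhd> [A] \<star> [A] \<lhd> r \<star> brd sg V A \<rhd> [A] \<star> [V] \<lhd> t
      = [V] \<lhd> t \<star> r \<rhd> [A]"
    and counit: "[V] \<lhd> ep \<star> r = [V] \<lhd> ep"
    and k: "ep \<rhd> [A] \<star> t = k"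
  shows "[V] \<lhd> k \<star> r \<rhd> [A] = r \<star> [V] \<lhd> k"
proof -
  have V: "V \<in> Obj C" using validD(1)[OF rep_valid[OF r(1)]] r by simp
  have e1: "[V] \<lhd> ep \<rhd> [A] \<star> r \<rhd> [A] = [V] \<lhd> ep \<rhd> [A]"
    using whisk_eq[OF counit, of "[]" "[A]"] by simp
  have e2: "[V] \<lhd> ep \<rhd> [A] \<star> brd s A V \<rhd> [A] = ep \<rhd> [V, A]"
    "ep \<rhd> [V, A] \<star> brd s V A \<rhd> [A] = [V] \<lhd> ep \<rhd> [A]" for s
    using whisk_eq[OF ep_slide(1)[OF V, of s], of "[]" "[A]"] whisk_eq[OF ep_slide(2)[OF V, of s], of "[]" "[A]"] by simp_all
  have e3: "ep \<rhd> [V, A] \<star> [A] \<lhd> r = r \<star> ep \<rhd> [V, A]"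
    using interchange[of "[]" ep "[]" r "[]"] r rep_valid[OF r(1)] by simp
  have e4: "[V] \<lhd> ep \<rhd> [A] \<star> [V] \<lhd> t = [V] \<lhd> k"
    using whisk_eq[OF k, of "[V]" "[]"] by simp
  have "[V] \<lhd> k \<star> r \<rhd> [A] = [V] \<lhd> ep \<rhd> [A] \<star> [V] \<lhd> t \<star> r \<rhd> [A]"
    by (simp only: e4[symmetric] scomp_assoc)
  also have "\<dots> = r \<star> [V] \<lhd> k"
    unfolding fusion[symmetric] by (simp add: ext2[OF e1] ext2[OF e2(1)] ext2[OF e2(2)] ext2[OF e3] e4)
  finally show ?thesis .
qed

text \<open>\<open>t\<^sub>1\<close> is itself a coaction and hence linear; the counit on the first
  factor turns \<open>t\<^sub>1\<close> into the multiplication.\<close>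

lemma m_assoc: "m \<star> m \<rhd> [A] = m \<star> [A] \<lhd> m"
proof -
  have l: "[A] \<lhd> m \<star> t1 \<rhd> [A] = t1 \<star> [A] \<lhd> m"
    using fusion_linear[of t1 A True t1 m] t1_fusion ep_t1 m_t1 by simp
  have x: "ep \<rhd> [A] \<star> [A] \<lhd> m = m \<star> ep \<rhd> [A, A]"
    using interchange[of "[]" ep "[]" m "[]"] by simp
  have y: "ep \<rhd> [A, A] \<star> t1 \<rhd> [A] = m \<rhd> [A]"
    using whisk_eq[OF m_t1, of "[]" "[A]"] by simp
  have "m \<star> m \<rhd> [A] = ep \<rhd> [A] \<star> [A] \<lhd> m \<star> t1 \<rhd> [A]"
    by (simp add: ext2[OF x] y)
  also have "\<dots> = m \<star> [A] \<lhd> m"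
    unfolding l by (simp add: ext2[OF m_t1])
  finally show ?thesis .
qed

text \<open>In elements \<open>a (S(b) c) = (a S(b)) c\<close>. It is checked on
  \<open>a b\<^sub>1 \<otimes> b\<^sub>2 \<otimes> b\<^sub>3 c\<close>, where the antipode cancels
  and \<open>a b c\<close> remains on both sides. This ties \<open>s\<close> and \<open>s'\<close>
  to one antipode.\<close>

lemma m_s_assoc: "m \<star> [A] \<lhd> s = m \<star> s' \<rhd> [A]"
proof (rule strand_iso_cancel[where x = "[A] \<lhd> t1 \<star> t2 \<rhd> [A]" and y = "t2i \<rhd> [A] \<star> [A] \<lhd> t1i"])
  have a: "[A] \<lhd> s \<star> [A] \<lhd> t1 = [A] \<lhd> ep \<rhd> [A]"
    and b: "s' \<rhd> [A] \<star> t2 \<rhd> [A] = [A] \<lhd> ep \<rhd> [A]"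
    using whisk_eq[OF s_t1, of "[A]" "[]"] whisk_eq[OF s'_t2, of "[]" "[A]"] by simp_all
  have c: "[A] \<lhd> ep \<rhd> [A] \<star> t2 \<rhd> [A] = m \<rhd> [A]"
    and d: "[A] \<lhd> ep \<rhd> [A] \<star> [A] \<lhd> t1 = [A] \<lhd> m"
    using whisk_eq[OF m_t2, of "[]" "[A]"] whisk_eq[OF m_t1, of "[A]" "[]"] by simp_all
  have "(m \<star> [A] \<lhd> s) \<star> [A] \<lhd> t1 \<star> t2 \<rhd> [A] = m \<star> m \<rhd> [A]"
    by (simp add: ext2[OF a] c)
  also have "\<dots> = (m \<star> s' \<rhd> [A]) \<star> t2 \<rhd> [A] \<star> [A] \<lhd> t1"
    by (simp add: ext2[OF b] d m_assoc)
  finally show "(m \<star> [A] \<lhd> s) \<star> [A] \<lhd> t1 \<star> t2 \<rhd> [A]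
      = (m \<star> s' \<rhd> [A]) \<star> [A] \<lhd> t1 \<star> t2 \<rhd> [A]"
    by (simp add: t12_commute)
qed (simp_all add: t_cancel)

text \<open>Both sides are \<open>a b\<^sub>1 \<otimes> c b\<^sub>2\<close>: a test factor on the
  left of the second leg exchanges \<open>t\<^sub>2\<close> for \<open>t\<^sub>3\<close>.\<close>

lemma n_t2: "[A] \<lhd> n \<star> t2 \<rhd> [A] = m \<rhd> [A] \<star> [A] \<lhd> t3"
proof -
  have a: "[A] \<lhd> ep \<rhd> [A] \<star> [A] \<lhd> t3 = [A] \<lhd> n"
    and b: "[A] \<lhd> ep \<rhd> [A] \<star> t2 \<rhd> [A] = m \<rhd> [A]"
    using whisk_eq[OF n_t3, of "[A]" "[]"] whisk_eq[OF m_t2, of "[]" "[A]"] by simp_all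
  have "[A] \<lhd> n \<star> t2 \<rhd> [A] = [A] \<lhd> ep \<rhd> [A] \<star> [A] \<lhd> t3 \<star> t2 \<rhd> [A]"
    by (simp add: ext2[OF a])
  then show ?thesis by (simp add: t32_commute ext2[OF b])
qed

end

section \<open>Comodules\<close>

locale hopf_comodule = regular_hopf_monoid C Q B
  for C :: "('o, 'a, 'm) bmc_data_scheme" (structure) and Q B +
  fixes V :: 'o and v1 v3 :: 'a
  assumes comod: "is_comodule C B V v1 v3"
begin

lemma V_Obj [simp]: "V \<in> Obj C"
  and v_simps [simp]: "v1 \<in> Arr C" "Dom C v1 = V \<odot> A" "Cod C v1 = V \<odot> A"
    "v3 \<in> Arr C" "Dom C v3 = V \<odot> A" "Cod C v3 = V \<odot> A"
  using comod by (auto simp: is_comodule_def Let_def hom_iff)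

definition r :: "('o, 'a) strand" where "r = str [V, A] [V, A] v1"
definition w :: "('o, 'a) strand" where "w = str [V, A] [V, A] v3"

lemma strable_v [simp]: "strable [V, A] [V, A] v1" "strable [V, A] [V, A] v3"
  by (simp_all add: strable_def hom_iff)

lemma rw_simps [simp]:
  "sdom r = [V, A]" "scod r = [V, A]" "rep r" "normal r" "valid r"
  "sdom w = [V, A]" "scod w = [V, A]" "rep w" "normal w" "valid w"
  by (simp_all add: r_def w_def rep_valid)

lemma r_fusion: "r \<rhd> [A] \<star> bi A V \<rhd> [A] \<star> [A] \<lhd> r \<star> bd V A \<rhd> [A] \<star> [V] \<lhd> t1
    = [V] \<lhd> t1 \<star> r \<rhd> [A]"
proof -
  have "v1 \<otimes> \<one> A \<cdot> \<c>\<inverse> A V \<otimes> \<one> A \<cdot> lift23 C A V A v1 \<cdot> \<c> V A \<otimes> \<one> A \<cdot> lift23 C V A A (T1 B)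
         = lift23 C V A A (T1 B) \<cdot> v1 \<otimes> \<one> A"
    using comod by (simp add: is_comodule_def Let_def)
  from arg_cong[OF this, of "str [V, A, A] [V, A, A]"] show ?thesis by (simp add: to_str r_def)
qed

lemma w_fusion: "w \<rhd> [A] \<star> bd A V \<rhd> [A] \<star> [A] \<lhd> w \<star> bi V A \<rhd> [A] \<star> [V] \<lhd> t3
    = [V] \<lhd> t3 \<star> w \<rhd> [A]"
proof -
  have "v3 \<otimes> \<one> A \<cdot> \<c> A V \<otimes> \<one> A \<cdot> lift23 C A V A v3 \<cdot> \<c>\<inverse> V A \<otimes> \<one> A \<cdot> lift23 C V A A (T3 B)
         = lift23 C V A A (T3 B) \<cdot> v3 \<otimes> \<one> A"
    using comod by (simp add: is_comodule_def Let_def)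
  from arg_cong[OF this, of "str [V, A, A] [V, A, A]"] show ?thesis by (simp add: to_str w_def)
qed

lemma ep_r: "[V] \<lhd> ep \<star> r = [V] \<lhd> ep"
proof -
  have "cap_right C e V \<cdot> v1 = cap_right C e V" using comod by (simp add: is_comodule_def Let_def)
  from arg_cong[OF this, of "str [V, A] [V]"] show ?thesis by (simp add: to_str r_def)
qed

lemma ep_w: "[V] \<lhd> ep \<star> w = [V] \<lhd> ep"
proof -
  have "cap_right C e V \<cdot> v3 = cap_right C e V" using comod by (simp add: is_comodule_def Let_def)
  from arg_cong[OF this, of "str [V, A] [V]"] show ?thesis by (simp add: to_str w_def)
qed

lemma rw_compat: "[V] \<lhd> m \<star> bd A V \<rhd> [A] \<star> [A] \<lhd> r
    = [V] \<lhd> m \<star> w \<rhd> [A] \<star> bd A V \<rhd> [A]"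
proof -
  have "mul23 C V A mul \<cdot> \<c> A V \<otimes> \<one> A \<cdot> lift23 C A V A v1 = mul23 C V A mul \<cdot> v3 \<otimes> \<one> A \<cdot> \<c> A V \<otimes> \<one> A"
    using comod by (simp add: is_comodule_def Let_def)
  from arg_cong[OF this, of "str [A, V, A] [V, A]"] show ?thesis by (simp add: to_str r_def w_def)
qed

lemma r_linear: "[V] \<lhd> m \<star> r \<rhd> [A] = r \<star> [V] \<lhd> m"
  using fusion_linear[of r V True t1 m] r_fusion ep_r m_t1 by simp

lemma w_linear: "[V] \<lhd> n \<star> w \<rhd> [A] = w \<star> [V] \<lhd> n"
  using fusion_linear[of w V False t3 n] w_fusion ep_w n_t3 by simp

text \<open>\<open>v\<^sup>3\<close> multiplies from the left, so it commutes with left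
  multiplication on its second leg. This is \<open>w_linear\<close> with the additional strand
  pulled across \<open>w\<close> to the other side.\<close>

lemma w_left: "[] \<lhd> w \<rhd> [] \<star> [V] \<lhd> m \<star> bd A V \<rhd> [A]
    = [V] \<lhd> m \<star> bd A V \<rhd> [A] \<star> [A] \<lhd> w"
proof -
  have sl: "w \<rhd> [A] \<star> [V] \<lhd> bd A A \<star> bd A V \<rhd> [A]
     = [V] \<lhd> bd A A \<star> bd A V \<rhd> [A] \<star> [A] \<lhd> w"
    unfolding w_def by (rule slide22(2)) simp_all
  have "[V] \<lhd> m \<star> bd A V \<rhd> [A] \<star> [A] \<lhd> w
     = [V] \<lhd> n \<star> [V] \<lhd> bd A A \<star> bd A V \<rhd> [A] \<star> [A] \<lhd> w"
    by (simp add: n_def brd_cancel)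
  also have "\<dots> = [V] \<lhd> n \<star> w \<rhd> [A] \<star> [V] \<lhd> bd A A \<star> bd A V \<rhd> [A]"
    by (simp only: sl)
  also have "\<dots> = w \<star> [V] \<lhd> n \<star> [V] \<lhd> bd A A \<star> bd A V \<rhd> [A]"
    by (simp only: ext2[OF w_linear] scomp_assoc)
  also have "\<dots> = [] \<lhd> w \<rhd> [] \<star> [V] \<lhd> m \<star> bd A V \<rhd> [A]"
    by (simp add: n_def brd_cancel)
  finally show ?thesis ..
qed

text \<open>In element notation: \<open>c (a x\<^sub>1)\<^sub>1 \<otimes> (a x\<^sub>1)\<^sub>2 = c a\<^sub>1 x\<^sub>1 \<otimes> a\<^sub>2 x\<^sub>2\<close>, tested by a multiplication on the last
  factor, which turns \<open>t2\<close> into \<open>t3\<close>.\<close>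

lemma w_t2: "w \<rhd> [A] \<star> bd A V \<rhd> [A] \<star> [A] \<lhd> w \<star> bi V A \<rhd> [A] \<star> [V] \<lhd> t2
    = [V] \<lhd> t2 \<star> bd A V \<rhd> [A] \<star> [A] \<lhd> w \<star> bi V A \<rhd> [A]"
proof (rule nondeg_opposite[where ys = "[V, A]"])
  have a1: "[V, A] \<lhd> n \<star> w \<rhd> [A, A] = w \<rhd> [A] \<star> [V, A] \<lhd> n"
    using interchange[of "[]" w "[]" n "[]"] by simp
  have a2: "[V, A] \<lhd> n \<star> bd A V \<rhd> [A, A] = bd A V \<rhd> [A] \<star> [A, V] \<lhd> n"
    using interchange[of "[]" "bd A V" "[]" n "[]"] by simp
  have a3: "[A, V] \<lhd> n \<star> [A] \<lhd> w \<rhd> [A] = [A] \<lhd> w \<star> [A, V] \<lhd> n"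
    using whisk_eq[OF w_linear, of "[A]" "[]"] by simp
  have a4: "[A, V] \<lhd> n \<star> bi V A \<rhd> [A, A] = bi V A \<rhd> [A] \<star> [V, A] \<lhd> n"
    using interchange[of "[]" "bi V A" "[]" n "[]"] by simp
  have a5: "[V, A] \<lhd> n \<star> [V] \<lhd> t2 \<rhd> [A] = [V] \<lhd> m \<rhd> [A] \<star> [V, A] \<lhd> t3"
    using whisk_eq[OF n_t2, of "[V]" "[]"] by simp
  have b1: "[V, A] \<lhd> t3 \<star> bd A V \<rhd> [A, A] = bd A V \<rhd> [A, A] \<star> [A, V] \<lhd> t3"
    using interchange[of "[]" "bd A V" "[]" t3 "[]"] by simp
  have b2: "[A, V] \<lhd> t3 \<star> [A] \<lhd> w \<rhd> [A] = [A] \<lhd> w \<rhd> [A] \<star> [A] \<lhd> bd A V \<rhd> [A] \<star> [A, A] \<lhd> w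
      \<star> [A] \<lhd> bi V A \<rhd> [A] \<star> [A, V] \<lhd> t3"
    using whisk_eq[OF w_fusion, of "[A]" "[]"] by simp
  have b3: "[A, V] \<lhd> t3 \<star> bi V A \<rhd> [A, A] = bi V A \<rhd> [A, A] \<star> [V, A] \<lhd> t3"
    using interchange[of "[]" "bi V A" "[]" t3 "[]"] by simp
  have c1: "bi V A \<rhd> [A] \<star> [V] \<lhd> m \<rhd> [A] = m \<rhd> [V, A] \<star> [A] \<lhd> bi V A \<rhd> [A] \<star> bi V A \<rhd> [A, A]"
    using whisk_eq[OF slide21(2)[of A A A mul V False], of "[]" "[A]"] unfolding m_def by simp
  have c2: "[A] \<lhd> w \<star> m \<rhd> [V, A] = m \<rhd> [V, A] \<star> [A, A] \<lhd> w"
    using interchange[of "[]" m "[]" w "[]"] by simp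
  have c3: "bd A V \<rhd> [A] \<star> m \<rhd> [V, A] = [V] \<lhd> m \<rhd> [A] \<star> bd A V \<rhd> [A, A] \<star> [A] \<lhd> bd A V \<rhd> [A]"
    using whisk_eq[OF slide21(1)[of A A A mul V True], of "[]" "[A]"] unfolding m_def by simp
  have c4: "w \<rhd> [A] \<star> [V] \<lhd> m \<rhd> [A] \<star> bd A V \<rhd> [A, A]
      = [V] \<lhd> m \<rhd> [A] \<star> bd A V \<rhd> [A, A] \<star> [A] \<lhd> w \<rhd> [A]"
    using whisk_eq[OF w_left, of "[]" "[A]"] by simp
  \<comment> \<open>With test factor \<open>d\<close>, this is \<open>x \<otimes> a \<otimes> b
    \<otimes> d \<mapsto> x\<^sub>1 \<otimes> a b\<^sub>1 x\<^sub>2 \<otimes> d b\<^sub>2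
    x\<^sub>3\<close>.\<close>
  let ?X = "[V] \<lhd> m \<rhd> [A] \<star> bd A V \<rhd> [A, A] \<star> [A] \<lhd> w \<rhd> [A] \<star> [A] \<lhd> bd A V \<rhd> [A] \<star> [A, A] \<lhd> w
      \<star> [A] \<lhd> bi V A \<rhd> [A] \<star> bi V A \<rhd> [A, A] \<star> [V, A] \<lhd> t3"
  have L: "[V, A] \<lhd> n \<star> (w \<rhd> [A] \<star> bd A V \<rhd> [A] \<star> [A] \<lhd> w \<star> bi V A \<rhd> [A] \<star> [V] \<lhd> t2) \<rhd> [A] = ?X"
    by (simp add: ext2[OF a1] ext2[OF a2] ext2[OF a3] ext2[OF a4] a5 ext2[OF c1] ext2[OF c2] ext2[OF c3] ext3[OF c4])
  have R: "[V, A] \<lhd> n \<star> ([V] \<lhd> t2 \<star> bd A V \<rhd> [A] \<star> [A] \<lhd> w \<star> bi V A \<rhd> [A]) \<rhd> [A] = ?X"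
    by (simp add: ext2[OF a5] ext2[OF b1] ext2[OF b2] b3)
  show "[V, A] \<lhd> m \<star> [V, A] \<lhd> bi A A \<star> (w \<rhd> [A] \<star> bd A V \<rhd> [A] \<star> [A] \<lhd> w \<star> bi V A \<rhd> [A] \<star> [V] \<lhd> t2) \<rhd> [A]
      = [V, A] \<lhd> m \<star> [V, A] \<lhd> bi A A \<star> ([V] \<lhd> t2 \<star> bd A V \<rhd> [A] \<star> [A] \<lhd> w \<star> bi V A \<rhd> [A]) \<rhd> [A]"
    using trans[OF L R[symmetric]] by (simp add: n_def)
qed simp_all

text \<open>In element notation: \<open>c x\<^sub>1 S(a x\<^sub>2) = c S(a)\<close>.\<close>

lemma w_s': "[V] \<lhd> s' \<star> w \<rhd> [A] \<star> bd A V \<rhd> [A] \<star> [A] \<lhd> w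
    = [V] \<lhd> s' \<star> bd A V \<rhd> [A]"
proof (rule strand_iso_cancel[where x = "bi V A \<rhd> [A] \<star> [V] \<lhd> t2"
    and y = "[V] \<lhd> t2i \<star> bd A V \<rhd> [A]"])
  have a: "[V] \<lhd> s' \<star> [V] \<lhd> t2 = [V, A] \<lhd> ep"
    using whisk_eq[OF s'_t2, of "[V]" "[]"] by simp
  have b: "[V, A] \<lhd> ep \<star> bd A V \<rhd> [A] = bd A V \<star> [A, V] \<lhd> ep"
    using interchange[of "[]" "bd A V" "[]" ep "[]"] by simp
  have c: "[A, V] \<lhd> ep \<star> [A] \<lhd> w = [A, V] \<lhd> ep"
    using whisk_eq[OF ep_w, of "[A]" "[]"] by simp
  have d: "[A, V] \<lhd> ep \<star> bi V A \<rhd> [A] = bi V A \<star> [V, A] \<lhd> ep"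
    using interchange[of "[]" "bi V A" "[]" ep "[]"] by simp
  have "([V] \<lhd> s' \<star> w \<rhd> [A] \<star> bd A V \<rhd> [A] \<star> [A] \<lhd> w) \<star> bi V A \<rhd> [A] \<star> [V] \<lhd> t2
      = [V] \<lhd> s' \<star> [V] \<lhd> t2 \<star> bd A V \<rhd> [A] \<star> [A] \<lhd> w \<star> bi V A \<rhd> [A]"
    by (simp only: w_t2 scomp_assoc)
  also have "\<dots> = [V, A] \<lhd> ep"
    by (simp add: ext2[OF a] ext2[OF b] ext2[OF c] d brd_cancel)
  also have "\<dots> = ([V] \<lhd> s' \<star> bd A V \<rhd> [A]) \<star> bi V A \<rhd> [A] \<star> [V] \<lhd> t2"
    by (simp add: brd_cancel a)
  finally show "([V] \<lhd> s' \<star> w \<rhd> [A] \<star> bd A V \<rhd> [A] \<star> [A] \<lhd> w) \<star> bi V A \<rhd> [A] \<star> [V] \<lhd> t2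
      = ([V] \<lhd> s' \<star> bd A V \<rhd> [A]) \<star> bi V A \<rhd> [A] \<star> [V] \<lhd> t2" .
qed (simp_all add: t_cancel brd_cancel)

text \<open>A test factor \<open>c\<close> on the left turns \<open>v\<^sup>1\<close> into
  \<open>v\<^sup>3\<close>. Then \<open>m_s_assoc\<close> splits off the factor \<open>b\<close>,
  and \<open>w_s'\<close> shortens \<open>c x\<^sub>2 S(a x\<^sub>3)\<close> to
  \<open>c S(a)\<close>.\<close>

lemma r_s_w: "r \<star> [V] \<lhd> s \<star> w \<rhd> [A] = [V] \<lhd> s"
proof (rule nondeg_cross[where s = True and V = V])
  have d2: "bd A V \<rhd> [A] \<star> [A, V] \<lhd> s = [V, A] \<lhd> s \<star> bd A V \<rhd> [A, A]"
    using interchange[of "[]" "bd A V" "[]" s "[]"] by simp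
  have d2': "w \<rhd> [A] \<star> [V, A] \<lhd> s = [V, A] \<lhd> s \<star> w \<rhd> [A, A]"
    using interchange[of "[]" w "[]" s "[]"] by simp
  have d3: "[V] \<lhd> m \<star> [V, A] \<lhd> s = [V] \<lhd> m \<star> [V] \<lhd> s' \<rhd> [A]"
    using whisk_eq[OF m_s_assoc, of "[V]" "[]"] by simp
  have d4: "[V] \<lhd> s' \<rhd> [A] \<star> w \<rhd> [A, A] \<star> bd A V \<rhd> [A, A] \<star> [A] \<lhd> w \<rhd> [A]
      = [V] \<lhd> s' \<rhd> [A] \<star> bd A V \<rhd> [A, A]"
    using whisk_eq[OF w_s', of "[]" "[A]"] by simp
  show "[V] \<lhd> m \<star> bd A V \<rhd> [A] \<star> [A] \<lhd> (r \<star> [V] \<lhd> s \<star> w \<rhd> [A])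
      = [V] \<lhd> m \<star> bd A V \<rhd> [A] \<star> [A] \<lhd> ([V] \<lhd> s)"
    by (simp add: ext3[OF rw_compat] d2 ext2[OF d2] ext2[OF d2'] ext2[OF d3] d4)
qed simp_all

text \<open>In element notation: \<open>S(x\<^sub>1 a) x\<^sub>2 b = S(a) b\<close>.\<close>

lemma s_r: "[V] \<lhd> s \<star> r \<rhd> [A] \<star> bi A V \<rhd> [A] \<star> [A] \<lhd> r \<star> bd V A \<rhd> [A] = [V] \<lhd> s"
proof (rule strand_iso_cancel[where x = "[V] \<lhd> t1" and y = "[V] \<lhd> t1i"])
  have a: "[V] \<lhd> s \<star> [V] \<lhd> t1 = [V] \<lhd> ep \<rhd> [A]"
    using whisk_eq[OF s_t1, of "[V]" "[]"] by simp
  have b: "[V] \<lhd> ep \<rhd> [A] \<star> r \<rhd> [A] = [V] \<lhd> ep \<rhd> [A]"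
    using whisk_eq[OF ep_r, of "[]" "[A]"] by simp
  show "([V] \<lhd> s \<star> r \<rhd> [A] \<star> bi A V \<rhd> [A] \<star> [A] \<lhd> r \<star> bd V A \<rhd> [A]) \<star> [V] \<lhd> t1
      = [V] \<lhd> s \<star> [V] \<lhd> t1"
    by (simp add: r_fusion ext2[OF a] a b)
qed simp_all

text \<open>If \<open>H\<close> has the value \<open>x \<otimes> b\<close>, then \<open>s_r\<close>
  computes \<open>x \<otimes> S(a) b\<close>, and so also \<open>x \<otimes> c S(a) b\<close>, from
  \<open>r \<star> H\<close>. The map \<open>c S(a)\<close> lies in \<open>Q\<close>, hence is epic
  even next to \<open>X\<close>; so it can be replaced by an arbitrary test factor, and
  non-degeneracy applies.\<close>

lemma r_mono:
  assumes "rep F" "rep G" "sdom F = [X]" "sdom G = [X]" "scod F = [V, A]" "scod G = [V, A]"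
    and eq: "r \<star> F = r \<star> G"
  shows "F = G"
proof (rule nondeg_cross[where s = False and V = V])
  have X: "X \<in> Obj C" using validD(1)[OF rep_valid[OF assms(1)]] assms by simp
  have M: "[V] \<lhd> s \<star> bi A V \<rhd> [A] \<star> [A] \<lhd> H
      = [V] \<lhd> s \<star> r \<rhd> [A] \<star> bi A V \<rhd> [A] \<star> [A] \<lhd> (r \<star> H)"
    if "rep H" "scod H = [V, A]" for H
  proof -
    have "[V] \<lhd> s \<star> bi A V \<rhd> [A] \<star> [A] \<lhd> H
      = ([V] \<lhd> s \<star> r \<rhd> [A] \<star> bi A V \<rhd> [A] \<star> [A] \<lhd> r \<star> bd V A \<rhd> [A])
        \<star> bi A V \<rhd> [A] \<star> [A] \<lhd> H"
      by (simp only: s_r)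
    then show ?thesis using that by (simp add: brd_cancel)
  qed
  have N: "([V] \<lhd> m \<star> bi A V \<rhd> [A] \<star> [A] \<lhd> H) \<star> s' \<rhd> [X]
     = [V] \<lhd> m \<star> bi A V \<rhd> [A] \<star> [A] \<lhd> ([V] \<lhd> s \<star> bi A V \<rhd> [A] \<star> [A] \<lhd> H)"
    if "rep H" "sdom H = [X]" "scod H = [V, A]" for H
  proof -
    have a: "bi A V \<rhd> [A] \<star> [A, V] \<lhd> s = [V, A] \<lhd> s \<star> bi A V \<rhd> [A, A]"
      using interchange[of "[]" "bi A V" "[]" s "[]"] by simp
    have b: "[V] \<lhd> m \<star> [V, A] \<lhd> s = [V] \<lhd> m \<star> [V] \<lhd> s' \<rhd> [A]"
      using whisk_eq[OF m_s_assoc, of "[V]" "[]"] by simp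
    have c: "[V] \<lhd> s' \<rhd> [A] \<star> bi A V \<rhd> [A, A] \<star> [A] \<lhd> bi A V \<rhd> [A] = bi A V \<rhd> [A] \<star> s' \<rhd> [V, A]"
      using whisk_eq[OF slide21(1)[of A A A sC' V False], of "[]" "[A]"] unfolding s'_def by simp
    have d: "[A] \<lhd> H \<star> s' \<rhd> [X] = s' \<rhd> [V, A] \<star> [A, A] \<lhd> H"
      using interchange[of "[]" s' "[]" H "[]"] that by simp
    show ?thesis by (simp add: d ext2[OF a] ext2[OF b] ext3[OF c])
  qed
  have q: "s' \<rhd> [X] = str [A, A, X] [A, X] (sC' \<otimes> \<one> X)"
    unfolding s'_def using X by (simp add: str_whisk_right_simps)
  have "([V] \<lhd> m \<star> bi A V \<rhd> [A] \<star> [A] \<lhd> F) \<star> s' \<rhd> [X]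
      = ([V] \<lhd> m \<star> bi A V \<rhd> [A] \<star> [A] \<lhd> G) \<star> s' \<rhd> [X]"
    unfolding N[OF assms(1,3,5)] N[OF assms(2,4,6)] M[OF assms(1,5)] M[OF assms(2,6)] eq ..
  then show "[V] \<lhd> m \<star> bi A V \<rhd> [A] \<star> [A] \<lhd> F = [V] \<lhd> m \<star> bi A V \<rhd> [A] \<star> [A] \<lhd> G"
    unfolding q
    by (rule strand_epi_cancel[rotated 7]) (use assms X in \<open>simp_all add: Q_epi Q_TensA Q_Id strable_def hom_iff\<close>)
qed (use assms in simp_all)

lemma v1_iso: "is_iso C v1"
proof -
  have mono: "is_mono C v1"
    unfolding is_mono_def
  proof (intro conjI allI ballI impI)
    fix X f g assume h: "f \<in> hom C X (Dom C v1)" "g \<in> hom C X (Dom C v1)" and eq: "v1 \<cdot> f = v1 \<cdot> g"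
    have st: "strable [X] [V, A] f" "strable [X] [V, A] g"
      using h by (auto simp: strable_def hom_iff)
    have "r \<star> str [X] [V, A] f = r \<star> str [X] [V, A] g"
      unfolding r_def using st eq by (simp add: str_scomp)
    then have "str [X] [V, A] f = str [X] [V, A] g"
      by (rule r_mono[rotated 6]) (use st in simp_all)
    then show "f = g" by (rule str_faithful[OF st])
  qed simp
  \<comment> \<open>\<open>q\<close> is \<open>1s\<close>. A strong epimorphism that factors through
    a monomorphism forces the latter to be invertible: the diagonal against the identity is a
    section, and \<open>v1\<close> is monic.\<close>
  define q where "q = mul23 C V A sC"
  have q: "q \<in> Arr C" "Dom C q = V \<odot> A \<odot> A" "Cod C q = V \<odot> A" "q \<in> Q"
    by (simp_all add: q_def mul23_def Q_Comp Q_TensA Q_Id Q_iso)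
  define k where "k = q \<cdot> v3 \<otimes> \<one> A"
  have "str [V, A, A] [V, A] (v1 \<cdot> k) = str [V, A, A] [V, A] q"
    using r_s_w q by (simp add: r_def w_def s_def to_str k_def q_def)
  then have "v1 \<cdot> k = q"
    by (rule str_faithful[rotated 2]) (use q in \<open>simp_all add: strable_def hom_iff k_def\<close>)
  then have sq: "is_mono C v1 \<and> k \<in> hom C (Dom C q) (Dom C v1) \<and> \<one> (V \<odot> A) \<in> hom C (Cod C q) (Cod C v1) \<and>
      v1 \<cdot> k = \<one> (V \<odot> A) \<cdot> q"
    using mono q by (simp add: hom_iff k_def)
  then obtain d where d: "d \<in> hom C (Cod C q) (Dom C v1)" "v1 \<cdot> d = \<one> (V \<odot> A)"
    using Q_strong[OF q(4)] unfolding is_strong_epi_def by blast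
  have "v1 \<cdot> (d \<cdot> v1) = v1 \<cdot> d \<cdot> v1" using d(1) q by (simp add: hom_iff)
  then have "v1 \<cdot> (d \<cdot> v1) = v1 \<cdot> \<one> (V \<odot> A)" using d(2) by simp
  then have "d \<cdot> v1 = \<one> (V \<odot> A)"
    by (rule monoD[OF mono, rotated 2]) (use d q in \<open>simp_all add: hom_iff\<close>)
  then have "inverse_arrows C v1 d" using d q by (simp add: inverse_arrows_def hom_iff)
  then show ?thesis by (auto simp: is_iso_def)
qed

end

section \<open>Modules and Hopf modules\<close>

locale hopf_right_module = regular_hopf_monoid C Q B
  for C :: "('o, 'a, 'm) bmc_data_scheme" (structure) and Q B +
  fixes V :: 'o and v2 v3 :: 'a
  assumes mod: "is_module C Q B V v2 v3"
begin

lemma V_Obj [simp]: "V \<in> Obj C"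
  and v_simps [simp]: "v2 \<in> Arr C" "Dom C v2 = V \<odot> A" "Cod C v2 = V \<odot> A"
    "v3 \<in> Arr C" "Dom C v3 = A \<odot> V" "Cod C v3 = A \<odot> V"
  using mod by (auto simp: is_module_def Let_def hom_iff)

definition alC :: 'a where "alC = cap_right C e V \<cdot> v2"
definition al :: "('o, 'a) strand" where "al = str [V, A] [V] alC"
definition x2 :: "('o, 'a) strand" where "x2 = str [V, A] [V, A] v2"
definition x3 :: "('o, 'a) strand" where "x3 = str [A, V] [A, V] v3"

lemma alC_simps [simp]: "alC \<in> Arr C" "Dom C alC = V \<odot> A" "Cod C alC = V" "alC \<in> Q"
  using mod by (auto simp: alC_def is_module_def Let_def)

lemma strable_mod [simp]: "strable [V, A] [V, A] v2" "strable [A, V] [A, V] v3" "strable [V, A] [V] alC"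
  by (simp_all add: strable_def hom_iff)

lemma mod_simps [simp]:
  "sdom al = [V, A]" "scod al = [V]" "rep al" "normal al" "valid al"
  "sdom x2 = [V, A]" "scod x2 = [V, A]" "rep x2" "normal x2" "valid x2"
  "sdom x3 = [A, V]" "scod x3 = [A, V]" "rep x3" "normal x3" "valid x3"
  by (simp_all add: al_def x2_def x3_def rep_valid)

lemma ep_x2: "[V] \<lhd> ep \<star> x2 = al"
  by (simp add: to_str x2_def al_def alC_def)

lemma x2_fusion: "[V] \<lhd> t2 \<star> [V] \<lhd> bi A A \<star> x2 \<rhd> [A] \<star> [V] \<lhd> bd A A \<star> x2 \<rhd> [A]
    = x2 \<rhd> [A] \<star> [V] \<lhd> t2"
proof -
  have "lift23 C V A A (T2 B) \<cdot> lift23 C V A A (\<c>\<inverse> A A) \<cdot> v2 \<otimes> \<one> A \<cdot> lift23 C V A A (\<c> A A) \<cdot> v2 \<otimes> \<one> A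
         = v2 \<otimes> \<one> A \<cdot> lift23 C V A A (T2 B)"
    using mod by (simp add: is_module_def Let_def)
  from arg_cong[OF this, of "str [V, A, A] [V, A, A]"] show ?thesis by (simp add: to_str x2_def)
qed

lemma x2_t3: "[V] \<lhd> t3 \<star> x2 \<rhd> [A] = x2 \<rhd> [A] \<star> [V] \<lhd> t3"
proof -
  have "lift23 C V A A (T3 B) \<cdot> v2 \<otimes> \<one> A = v2 \<otimes> \<one> A \<cdot> lift23 C V A A (T3 B)"
    using mod by (simp add: is_module_def Let_def)
  from arg_cong[OF this, of "str [V, A, A] [V, A, A]"] show ?thesis by (simp add: to_str x2_def)
qed

lemma x3_t2: "t2 \<rhd> [V] \<star> [A] \<lhd> x3 = [A] \<lhd> x3 \<star> t2 \<rhd> [V]"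
proof -
  have "T2 B \<otimes> \<one> V \<cdot> lift23 C A A V v3 = lift23 C A A V v3 \<cdot> T2 B \<otimes> \<one> V"
    using mod by (simp add: is_module_def Let_def)
  from arg_cong[OF this, of "str [A, A, V] [A, A, V]"] show ?thesis by (simp add: to_str x3_def)
qed

lemma ep_x3: "ep \<rhd> [V] \<star> x3 = al \<star> bi A V"
proof (rule strand_iso_cancel[where x = "bd V A" and y = "bi A V"])
  have "alC = cap_left C e V \<cdot> v3 \<cdot> \<c> V A" using mod by (simp add: is_module_def Let_def alC_def)
  then have "al = (ep \<rhd> [V] \<star> x3) \<star> bd V A" by (simp add: to_str al_def x3_def)
  then show "(ep \<rhd> [V] \<star> x3) \<star> bd V A = (al \<star> bi A V) \<star> bd V A" by simp
qed simp_all

text \<open>Two counits on \<open>t\<^sub>1\<close>: evaluated in one order they give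
  \<open>e(a b)\<close>, in the other \<open>e(a) e(b)\<close>.\<close>

lemma ep_m: "ep \<star> m = ep \<star> [A] \<lhd> ep"
  using interchange[of "[]" ep "[]" ep "[]"] by (simp add: m_t1[symmetric] ext2 ep_t1)

text \<open>Counits on both \<open>A\<close> factors of the fusion law for \<open>v\<^sub>2\<close>
  leave the associativity of the action.\<close>

lemma al_assoc: "al \<star> al \<rhd> [A] = al \<star> [V] \<lhd> m"
proof -
  have a: "[V, A] \<lhd> ep \<star> [V] \<lhd> t2 = [V] \<lhd> m"
    using whisk_eq[OF m_t2, of "[V]" "[]"] by simp
  have b: "[V] \<lhd> ep \<star> [V] \<lhd> m = [V] \<lhd> ep \<star> [V, A] \<lhd> ep"
    using whisk_eq[OF ep_m, of "[V]" "[]"] by simp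
  have c: "[V, A] \<lhd> ep \<star> [V] \<lhd> brd sg A A = [V] \<lhd> ep \<rhd> [A]" for sg
    using whisk_eq[OF ep_slide(1)[OF A_Obj, of sg], of "[V]" "[]"] by simp
  have d: "[V] \<lhd> ep \<rhd> [A] \<star> x2 \<rhd> [A] = al \<rhd> [A]"
    using whisk_eq[OF ep_x2, of "[]" "[A]"] by simp
  have f: "[V] \<lhd> ep \<star> al \<rhd> [A] = al \<star> [V, A] \<lhd> ep"
    using interchange[of "[]" al "[]" ep "[]"] by simp
  have g: "[V, A] \<lhd> ep \<star> x2 \<rhd> [A] = x2 \<star> [V, A] \<lhd> ep"
    using interchange[of "[]" x2 "[]" ep "[]"] by simp
  have "al \<star> al \<rhd> [A] = [V] \<lhd> ep \<star> [V, A] \<lhd> ep \<star>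
      [V] \<lhd> t2 \<star> [V] \<lhd> bi A A \<star> x2 \<rhd> [A] \<star> [V] \<lhd> bd A A \<star> x2 \<rhd> [A]"
    by (simp add: ext2[OF a] ext2[OF b] ext2[OF c] ext2[OF d] d ext2[OF f])
  also have "\<dots> = [V] \<lhd> ep \<star> [V, A] \<lhd> ep \<star> x2 \<rhd> [A] \<star> [V] \<lhd> t2"
    by (simp only: x2_fusion)
  also have "\<dots> = al \<star> [V] \<lhd> m"
    by (simp add: ext2[OF g] ext2[OF ep_x2] a)
  finally show ?thesis .
qed

text \<open>Both sides are \<open>x a\<^sub>1 \<otimes> b a\<^sub>2\<close>. Together with
  \<open>m_x3\<close> this shows that, by non-degeneracy, the action determines
  \<open>v\<^sub>2\<close> and \<open>v\<^sub>3\<close>.\<close>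

lemma n_x2: "[V] \<lhd> n \<star> x2 \<rhd> [A] = al \<rhd> [A] \<star> [V] \<lhd> t3"
proof -
  have a: "[V] \<lhd> ep \<rhd> [A] \<star> [V] \<lhd> t3 = [V] \<lhd> n"
    and b: "[V] \<lhd> ep \<rhd> [A] \<star> x2 \<rhd> [A] = al \<rhd> [A]"
    using whisk_eq[OF n_t3, of "[V]" "[]"] whisk_eq[OF ep_x2, of "[]" "[A]"] by simp_all
  have "[V] \<lhd> n \<star> x2 \<rhd> [A] = [V] \<lhd> ep \<rhd> [A] \<star> [V] \<lhd> t3 \<star> x2 \<rhd> [A]"
    by (simp add: ext2[OF a])
  then show ?thesis by (simp add: x2_t3 ext2[OF b])
qed

lemma m_x3: "m \<rhd> [V] \<star> [A] \<lhd> x3 = [A] \<lhd> al \<star> [A] \<lhd> bi A V \<star> t2 \<rhd> [V]"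
proof -
  have a: "[A] \<lhd> ep \<rhd> [V] \<star> t2 \<rhd> [V] = m \<rhd> [V]"
    and b: "[A] \<lhd> ep \<rhd> [V] \<star> [A] \<lhd> x3 = [A] \<lhd> al \<star> [A] \<lhd> bi A V"
    using whisk_eq[OF m_t2, of "[]" "[V]"] whisk_eq[OF ep_x3, of "[A]" "[]"] by simp_all
  have "m \<rhd> [V] \<star> [A] \<lhd> x3 = [A] \<lhd> ep \<rhd> [V] \<star> t2 \<rhd> [V] \<star> [A] \<lhd> x3"
    by (simp add: ext2[OF a])
  then show ?thesis by (simp add: x3_t2 ext2[OF b])
qed

end

section \<open>Hopf modules and the projection onto coinvariants\<close>

locale hopf_bimodule = regular_hopf_monoid C Q B
  for C :: "('o, 'a, 'm) bmc_data_scheme" (structure) and Q B +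
  fixes M :: "('o, 'a) hopf_data"
  assumes hm: "hopf_module C Q B M"
begin

abbreviation V :: 'o where "V \<equiv> HObj M"

sublocale co: hopf_comodule C Q B V "Co1 M" "Co3 M"
  by unfold_locales (use hm in \<open>simp add: hopf_module_def Let_def\<close>)

sublocale mo: hopf_right_module C Q B V "Ac2 M" "Ac3 M"
  by unfold_locales (use hm in \<open>simp add: hopf_module_def Let_def\<close>)

abbreviation r where "r \<equiv> co.r"
abbreviation w where "w \<equiv> co.w"
abbreviation al where "al \<equiv> mo.al"

lemma action_eq: "action C B M = mo.alC"
  by (simp add: action_def mo.alC_def)

lemma compat: "al \<rhd> [A] \<star> bi A V \<rhd> [A] \<star> [A] \<lhd> r \<star> bd V A \<rhd> [A] \<star> [V] \<lhd> t1 = r \<star> al \<rhd> [A]"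
proof -
  let ?v = "mo.alC"
  have "(?v \<otimes> \<one> A \<cdot> \<c>\<inverse> A V \<otimes> \<one> A \<cdot> lift23 C A V A (Co1 M) \<cdot> \<c> V A \<otimes> \<one> A \<cdot> lift23 C V A A (T1 B)
          = Co1 M \<cdot> ?v \<otimes> \<one> A) \<or>
        (?v \<otimes> \<one> A \<cdot> lift23 C V A A (T3 B) \<cdot> lift23 C V A A (\<c> A A) \<cdot> Co3 M \<otimes> \<one> A \<cdot> lift23 C V A A (\<c>\<inverse> A A)
          = Co3 M \<cdot> ?v \<otimes> \<one> A)"
    using hm unfolding action_eq[symmetric] by (simp add: hopf_module_def Let_def)
  then show ?thesis
  proof
    assume "?v \<otimes> \<one> A \<cdot> \<c>\<inverse> A V \<otimes> \<one> A \<cdot> lift23 C A V A (Co1 M) \<cdot> \<c> V A \<otimes> \<one> A \<cdot> lift23 C V A A (T1 B)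
          = Co1 M \<cdot> ?v \<otimes> \<one> A"
    from arg_cong[OF this, of "str [V, A, A] [V, A]"] show ?thesis by (simp add: to_str co.r_def mo.al_def)
  next
    assume "?v \<otimes> \<one> A \<cdot> lift23 C V A A (T3 B) \<cdot> lift23 C V A A (\<c> A A) \<cdot> Co3 M \<otimes> \<one> A \<cdot> lift23 C V A A (\<c>\<inverse> A A)
          = Co3 M \<cdot> ?v \<otimes> \<one> A"
    from arg_cong[OF this, of "str [V, A, A] [V, A]"]
    have w_al: "w \<star> al \<rhd> [A]
      = al \<rhd> [A] \<star> [V] \<lhd> t3 \<star> [V] \<lhd> bd A A \<star> w \<rhd> [A] \<star> [V] \<lhd> bi A A"
      by (simp add: to_str co.w_def mo.al_def)
    \<comment> \<open>The second compatibility law concerns \<open>v\<^sup>3\<close> and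
      \<open>t\<^sub>3\<close>. A test factor on the left of the last leg brings in
      \<open>rw_compat\<close> and \<open>t13_compat\<close>, which translate it into the
      first.\<close>
    show ?thesis
    proof (rule nondeg_cross[where s = True and V = V])
      have g1: "bd A V \<rhd> [A] \<star> [A] \<lhd> al \<rhd> [A]
          = al \<rhd> [A, A] \<star> [V] \<lhd> bd A A \<rhd> [A] \<star> bd A V \<rhd> [A, A]"
        using whisk_eq[OF slide21(2)[of V A V mo.alC A True], of "[]" "[A]"] unfolding mo.al_def by simp
      have g2: "w \<rhd> [A] \<star> al \<rhd> [A, A]
          = al \<rhd> [A, A] \<star> [V] \<lhd> t3 \<rhd> [A] \<star> [V] \<lhd> bd A A \<rhd> [A] \<star> w \<rhd> [A, A] \<star> [V] \<lhd> bi A A \<rhd> [A]"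
        using whisk_eq[OF w_al, of "[]" "[A]"] by simp
      have g3: "[V] \<lhd> m \<star> al \<rhd> [A, A] = al \<rhd> [A] \<star> [V, A] \<lhd> m"
        using interchange[of "[]" al "[]" m "[]"] by simp
      have g4: "[V, A] \<lhd> m \<star> [V] \<lhd> t3 \<rhd> [A] \<star> [V] \<lhd> bd A A \<rhd> [A]
          = [V, A] \<lhd> m \<star> [V] \<lhd> bd A A \<rhd> [A] \<star> [V, A] \<lhd> t1"
        using whisk_eq[OF t13_compat, of "[V]" "[]"] by simp
      have g5: "[V, A] \<lhd> t1 \<star> w \<rhd> [A, A] = w \<rhd> [A, A] \<star> [V, A] \<lhd> t1"
        using interchange[of "[]" w "[]" t1 "[]"] by simp
      have g6: "[V, A] \<lhd> t1 \<star> bd A V \<rhd> [A, A] = bd A V \<rhd> [A, A] \<star> [A, V] \<lhd> t1"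
        using interchange[of "[]" "bd A V" "[]" t1 "[]"] by simp
      have h1: "[V] \<lhd> bd A A \<rhd> [A] \<star> bd A V \<rhd> [A, A] \<star> [A] \<lhd> bi A V \<rhd> [A]
          = bi A V \<rhd> [A, A] \<star> [A] \<lhd> bd A V \<rhd> [A] \<star> bd A A \<rhd> [V, A]"
        using whisk_eq[OF slide22(2)[of A V V A "\<c>\<inverse> A V" A True], of "[]" "[A]"]
        by (simp add: brd_def[of False] strable_def hom_iff)
      have h2: "bd A A \<rhd> [V, A] \<star> [A, A] \<lhd> r = [A, A] \<lhd> r \<star> bd A A \<rhd> [V, A]"
        using interchange[of "[]" "bd A A" "[]" r "[]"] by simp
      have h3: "[V, A] \<lhd> m \<star> bi A V \<rhd> [A, A] = bi A V \<rhd> [A] \<star> [A, V] \<lhd> m"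
        using interchange[of "[]" "bi A V" "[]" m "[]"] by simp
      have h4: "[A, V] \<lhd> m \<star> [A] \<lhd> bd A V \<rhd> [A] \<star> [A, A] \<lhd> r
          = [A, V] \<lhd> m \<star> [A] \<lhd> w \<rhd> [A] \<star> [A] \<lhd> bd A V \<rhd> [A]"
        using whisk_eq[OF co.rw_compat, of "[A]" "[]"] by simp
      have sw: "bi A V \<rhd> [A] \<star> [A] \<lhd> w \<star> bd V A \<rhd> [A] \<star> [V] \<lhd> bd A A = [V] \<lhd> bd A A \<star> w \<rhd> [A]"
        using slide22(1)[of V A V A "Co3 M" A True] unfolding co.w_def[symmetric]
        by (simp add: brd_cancel)
      \<comment> \<open>The Yang-Baxter relation: a crossing, taken as an arrow, slides across a
        third strand.\<close>
      have yb: "[A] \<lhd> bd A V \<star> bd A A \<rhd> [V] \<star> [A] \<lhd> bd V A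
          = bd V A \<rhd> [A] \<star> [V] \<lhd> bd A A \<star> bd A V \<rhd> [A]"
        using slide22(2)[of V A A V "\<c> V A" A True] by (simp add: brd_def[of True V A] strable_def hom_iff)
      have "bi A V \<rhd> [A] \<star> [A] \<lhd> w \<star> [A] \<lhd> bd A V \<star> bd A A \<rhd> [V] \<star> [A] \<lhd> bd V A
          = [V] \<lhd> bd A A \<star> w \<rhd> [A] \<star> bd A V \<rhd> [A]"
        by (simp only: yb ext4[OF sw] scomp_assoc)
      from whisk_eq[OF this, of "[]" "[A]"]
      have Y: "bi A V \<rhd> [A, A] \<star> [A] \<lhd> w \<rhd> [A] \<star> [A] \<lhd> bd A V \<rhd> [A] \<star> bd A A \<rhd> [V, A] \<star> [A] \<lhd> bd V A \<rhd> [A]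
          = [V] \<lhd> bd A A \<rhd> [A] \<star> w \<rhd> [A, A] \<star> bd A V \<rhd> [A, A]"
        by simp
      \<comment> \<open>With test factor \<open>c\<close>, this is \<open>c \<otimes> x \<otimes> a
        \<otimes> b \<mapsto> x\<^sub>1 a\<^sub>1 \<otimes> c x\<^sub>2 a\<^sub>2 b\<close>.\<close>
      let ?X = "al \<rhd> [A] \<star> [V, A] \<lhd> m \<star> [V] \<lhd> bd A A \<rhd> [A] \<star> w \<rhd> [A, A] \<star> bd A V \<rhd> [A, A] \<star> [A, V] \<lhd> t1"
      have G: "[V] \<lhd> m \<star> bd A V \<rhd> [A] \<star> [A] \<lhd> (r \<star> al \<rhd> [A]) = ?X"
        by (simp add: ext3[OF co.rw_compat] g1 ext2[OF g2] brd_cancel ext2[OF g3] ext3[OF g4] ext2[OF g5] g6)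
      have "[V] \<lhd> m \<star> bd A V \<rhd> [A] \<star> [A] \<lhd> (al \<rhd> [A] \<star> bi A V \<rhd> [A] \<star> [A] \<lhd> r \<star> bd V A \<rhd> [A] \<star> [V] \<lhd> t1)
          = al \<rhd> [A] \<star> [V, A] \<lhd> m \<star> bi A V \<rhd> [A, A] \<star> [A] \<lhd> w \<rhd> [A] \<star> [A] \<lhd> bd A V \<rhd> [A]
            \<star> bd A A \<rhd> [V, A] \<star> [A] \<lhd> bd V A \<rhd> [A] \<star> [A, V] \<lhd> t1"
        by (simp add: ext2[OF g1] ext2[OF g3] ext3[OF h1] ext2[OF h2] ext2[OF h3] ext3[OF h4])
      also have "\<dots> = ?X"
        by (simp only: ext5[OF Y] scomp_assoc)
      finally show "[V] \<lhd> m \<star> bd A V \<rhd> [A] \<star> [A] \<lhd> (al \<rhd> [A] \<star> bi A V \<rhd> [A] \<star> [A] \<lhd> r \<star> bd V A \<rhd> [A] \<star> [V] \<lhd> t1)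
          = [V] \<lhd> m \<star> bd A V \<rhd> [A] \<star> [A] \<lhd> (r \<star> al \<rhd> [A])"
        using G by simp
    qed simp_all
  qed
qed

definition ri :: "('o, 'a) strand" where "ri = str [V, A] [V, A] (arr_inv C (Co1 M))"

lemma ri_simps [simp]: "sdom ri = [V, A]" "scod ri = [V, A]" "rep ri" "normal ri" "valid ri"
  using co.v1_iso by (simp_all add: ri_def rep_valid strable_def hom_iff)

lemma ri_r: "ri \<star> r = sid [V, A]" "r \<star> ri = sid [V, A]"
  using co.v1_iso str_Id[of "[V, A]"] by (simp_all add: ri_def co.r_def str_scomp strable_def hom_iff)

text \<open>The counit at \<open>a\<^sub>1\<close> in \<open>x\<^sub>1 \<otimes> a\<^sub>1 \<otimes>
  x\<^sub>2 a\<^sub>2 b\<close> leaves \<open>x\<^sub>1 \<otimes> x\<^sub>2 a b\<close>.\<close>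

lemma ep_r13: "[V] \<lhd> ep \<rhd> [A] \<star> bi A V \<rhd> [A] \<star> [A] \<lhd> r \<star> bd V A \<rhd> [A] \<star> [V] \<lhd> t1
    = r \<star> [V] \<lhd> m"
proof -
  have a: "[V] \<lhd> ep \<rhd> [A] \<star> bi A V \<rhd> [A] = ep \<rhd> [V, A]"
    "ep \<rhd> [V, A] \<star> bd V A \<rhd> [A] = [V] \<lhd> ep \<rhd> [A]"
    using whisk_eq[OF ep_slide(1)[OF co.V_Obj, of False], of "[]" "[A]"]
      whisk_eq[OF ep_slide(2)[OF co.V_Obj, of True], of "[]" "[A]"] by simp_all
  have b: "ep \<rhd> [V, A] \<star> [A] \<lhd> r = r \<star> ep \<rhd> [V, A]"
    using interchange[of "[]" ep "[]" r "[]"] by simp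
  have c: "[V] \<lhd> ep \<rhd> [A] \<star> [V] \<lhd> t1 = [V] \<lhd> m"
    using whisk_eq[OF m_t1, of "[V]" "[]"] by simp
  show ?thesis by (simp add: ext2[OF a(1)] ext2[OF b] ext2[OF a(2)] c)
qed

text \<open>In element notation, with \<open>E(x) = x\<^sub>1 S(x\<^sub>2)\<close>: \<open>E(x a) = E(x) e(a)\<close>.\<close>

lemma projection_action: "al \<star> ri \<star> al \<rhd> [A] = al \<star> ri \<star> [V] \<lhd> ep \<rhd> [A]"
proof -
  \<comment> \<open>\<open>?x\<close> sends \<open>x \<otimes> a \<otimes> b\<close> to
    \<open>x\<^sub>1 \<otimes> a\<^sub>1 \<otimes> x\<^sub>2 a\<^sub>2 b\<close> and
    \<open>?y\<close> is inverse to it. On the values of \<open>?x\<close> both sides of the claim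
    become \<open>x a b\<close>.\<close>
  let ?x = "bi A V \<rhd> [A] \<star> [A] \<lhd> r \<star> bd V A \<rhd> [A] \<star> [V] \<lhd> t1"
  let ?y = "[V] \<lhd> t1i \<star> bi A V \<rhd> [A] \<star> [A] \<lhd> ri \<star> bd V A \<rhd> [A]"
  have k: "[A] \<lhd> r \<star> [A] \<lhd> ri = sid [A, V, A]"
    unfolding swhisk_scomp[symmetric] ri_r by simp
  have "(al \<star> ri \<star> al \<rhd> [A]) \<star> ?x = al \<star> [V] \<lhd> m"
    by (simp add: compat ext2[OF ri_r(1)] mo.al_assoc)
  also have "\<dots> = (al \<star> ri \<star> [V] \<lhd> ep \<rhd> [A]) \<star> ?x"
    by (simp add: ep_r13 ext2[OF ri_r(1)])
  finally show ?thesis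
    by (rule strand_iso_cancel[rotated 5, where y = ?y and zs = "[V, A, A]"])
      (simp_all add: t_cancel brd_cancel ext2[OF k])
qed

end

section \<open>Recognizing morphisms of Hopf modules\<close>

context regular_hopf_monoid
begin

text \<open>\<open>rw_compat\<close> expresses \<open>x\<^sub>1 \<otimes> a x\<^sub>2 b\<close>
  through \<open>v\<^sup>1(x \<otimes> b)\<close>, so after a right test factor \<open>b\<close> the
  equation for \<open>v\<^sup>3\<close> follows from that for \<open>v\<^sup>1\<close>.\<close>

lemma comodule_morphismI:
  assumes M: "hopf_module C Q B M" and N: "hopf_module C Q B N" and f: "f \<in> hom C (HObj M) (HObj N)"
    and eq: "Co1 N \<cdot> f \<otimes> \<one> A = f \<otimes> \<one> A \<cdot> Co1 M"
  shows "comodule_morphism C B M N f"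
proof -
  interpret M: hopf_bimodule C Q B M by unfold_locales (fact M)
  interpret N: hopf_bimodule C Q B N by unfold_locales (fact N)
  let ?V = "HObj M" and ?W = "HObj N"
  have fh [simp]: "f \<in> Arr C" "Dom C f = ?V" "Cod C f = ?W" using f by (auto simp: hom_iff)
  define F where "F = str [?V] [?W] f"
  have st: "strable [?V] [?W] f" using f by (simp add: strable_def)
  have F [simp]: "sdom F = [?V]" "scod F = [?W]" "rep F" "normal F" "valid F"
    using st by (simp_all add: F_def)
  have r: "N.r \<star> F \<rhd> [A] = F \<rhd> [A] \<star> M.r"
    using arg_cong[OF eq, of "str [?V, A] [?W, A]"] by (simp add: F_def M.co.r_def N.co.r_def to_str)
  have "N.w \<star> F \<rhd> [A] = F \<rhd> [A] \<star> M.w"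
  proof (rule nondeg_right[where Y = ?W])
    have a: "F \<rhd> [A, A] \<star> bd A ?V \<rhd> [A] = bd A ?W \<rhd> [A] \<star> [A] \<lhd> F \<rhd> [A]"
      using whisk_eq[OF slide11(2)[OF st A_Obj, of True], of "[]" "[A]"] unfolding F_def[symmetric] by simp
    have b: "[A] \<lhd> N.r \<star> [A] \<lhd> F \<rhd> [A] = [A] \<lhd> F \<rhd> [A] \<star> [A] \<lhd> M.r"
      using whisk_eq[OF r, of "[A]" "[]"] by simp
    have c: "[?W] \<lhd> m \<star> F \<rhd> [A, A] = F \<rhd> [A] \<star> [?V] \<lhd> m"
      using interchange[of "[]" F "[]" m "[]"] by simp
    have "([?W] \<lhd> m \<star> N.w \<rhd> [A] \<star> F \<rhd> [A, A]) \<star> bd A ?V \<rhd> [A]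
        = ([?W] \<lhd> m \<star> bd A ?W \<rhd> [A] \<star> [A] \<lhd> N.r) \<star> [A] \<lhd> F \<rhd> [A]"
      by (simp add: a N.co.rw_compat)
    also have "\<dots> = [?W] \<lhd> m \<star> F \<rhd> [A, A] \<star> bd A ?V \<rhd> [A] \<star> [A] \<lhd> M.r"
      by (simp add: b ext2[OF a])
    also have "\<dots> = ([?W] \<lhd> m \<star> F \<rhd> [A, A] \<star> M.w \<rhd> [A]) \<star> bd A ?V \<rhd> [A]"
      by (simp add: ext2[OF c] M.co.rw_compat)
    finally have "[?W] \<lhd> m \<star> N.w \<rhd> [A] \<star> F \<rhd> [A, A]
        = [?W] \<lhd> m \<star> F \<rhd> [A, A] \<star> M.w \<rhd> [A]"
      by (rule strand_iso_cancel[rotated 5, where y = "bi ?V A \<rhd> [A]" and zs = "[?V, A, A]"]) simp_all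
    then show "[?W] \<lhd> m \<star> (N.w \<star> F \<rhd> [A]) \<rhd> [A]
        = [?W] \<lhd> m \<star> (F \<rhd> [A] \<star> M.w) \<rhd> [A]" by simp
  qed simp_all
  then have "str [?V, A] [?W, A] (Co3 N \<cdot> f \<otimes> \<one> A) = str [?V, A] [?W, A] (f \<otimes> \<one> A \<cdot> Co3 M)"
    by (simp add: F_def M.co.w_def N.co.w_def to_str)
  then have "Co3 N \<cdot> f \<otimes> \<one> A = f \<otimes> \<one> A \<cdot> Co3 M"
    by (rule str_faithful[rotated 2]) (simp_all add: strable_def hom_iff)
  then show ?thesis using f eq by (simp add: comodule_morphism_def)
qed

text \<open>After a test multiplication \<open>n_x2\<close> and \<open>m_x3\<close> write
  \<open>v\<^sub>2\<close> and \<open>v\<^sub>3\<close> in terms of the action, with which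
  \<open>f\<close> commutes by assumption.\<close>

lemma module_morphismI:
  assumes M: "hopf_module C Q B M" and N: "hopf_module C Q B N" and f: "f \<in> hom C (HObj M) (HObj N)"
    and eq: "action C B N \<cdot> f \<otimes> \<one> A = f \<cdot> action C B M"
  shows "module_morphism C B M N f"
proof -
  interpret M: hopf_bimodule C Q B M by unfold_locales (fact M)
  interpret N: hopf_bimodule C Q B N by unfold_locales (fact N)
  let ?V = "HObj M" and ?W = "HObj N"
  have fh [simp]: "f \<in> Arr C" "Dom C f = ?V" "Cod C f = ?W" using f by (auto simp: hom_iff)
  define F where "F = str [?V] [?W] f"
  have st: "strable [?V] [?W] f" using f by (simp add: strable_def)
  have F [simp]: "sdom F = [?V]" "scod F = [?W]" "rep F" "normal F" "valid F"
    using st by (simp_all add: F_def)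
  have al: "N.al \<star> F \<rhd> [A] = F \<star> M.al"
    using arg_cong[OF eq, of "str [?V, A] [?W]"]
    by (simp add: F_def M.mo.al_def N.mo.al_def M.action_eq N.action_eq to_str)
  have "N.mo.x2 \<star> F \<rhd> [A] = F \<rhd> [A] \<star> M.mo.x2"
  proof (rule nondeg_opposite[where ys = "[?W]"])
    have a: "[?W] \<lhd> t3 \<star> F \<rhd> [A, A] = F \<rhd> [A, A] \<star> [?V] \<lhd> t3"
      using interchange[of "[]" F "[]" t3 "[]"] by simp
    have b: "[?W] \<lhd> n \<star> F \<rhd> [A, A] = F \<rhd> [A] \<star> [?V] \<lhd> n"
      using interchange[of "[]" F "[]" n "[]"] by simp
    have c: "N.al \<rhd> [A] \<star> F \<rhd> [A, A] = F \<rhd> [A] \<star> M.al \<rhd> [A]"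
      using whisk_eq[OF al, of "[]" "[A]"] by simp
    have "[?W] \<lhd> n \<star> N.mo.x2 \<rhd> [A] \<star> F \<rhd> [A, A]
        = [?W] \<lhd> n \<star> F \<rhd> [A, A] \<star> M.mo.x2 \<rhd> [A]"
      by (simp add: ext2[OF N.mo.n_x2] a ext2[OF b] ext2[OF c] M.mo.n_x2)
    then show "[?W] \<lhd> m \<star> [?W] \<lhd> bi A A \<star> (N.mo.x2 \<star> F \<rhd> [A]) \<rhd> [A]
        = [?W] \<lhd> m \<star> [?W] \<lhd> bi A A \<star> (F \<rhd> [A] \<star> M.mo.x2) \<rhd> [A]"
      by (simp add: n_def)
  qed simp_all
  then have "str [?V, A] [?W, A] (Ac2 N \<cdot> f \<otimes> \<one> A) = str [?V, A] [?W, A] (f \<otimes> \<one> A \<cdot> Ac2 M)"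
    by (simp add: F_def M.mo.x2_def N.mo.x2_def to_str)
  then have 2: "Ac2 N \<cdot> f \<otimes> \<one> A = f \<otimes> \<one> A \<cdot> Ac2 M"
    by (rule str_faithful[rotated 2]) (simp_all add: strable_def hom_iff)
  have "N.mo.x3 \<star> [A] \<lhd> F = [A] \<lhd> F \<star> M.mo.x3"
  proof (rule nondeg_left[where Y = ?W])
    have a: "t2 \<rhd> [?W] \<star> [A, A] \<lhd> F = [A, A] \<lhd> F \<star> t2 \<rhd> [?V]"
      using interchange[of "[]" t2 "[]" F "[]"] by simp
    have b: "m \<rhd> [?W] \<star> [A, A] \<lhd> F = [A] \<lhd> F \<star> m \<rhd> [?V]"
      using interchange[of "[]" m "[]" F "[]"] by simp
    have c: "[A] \<lhd> bi A ?W \<star> [A, A] \<lhd> F = [A] \<lhd> F \<rhd> [A] \<star> [A] \<lhd> bi A ?V"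
      using whisk_eq[OF slide11(2)[OF st A_Obj, of False], of "[A]" "[]"] unfolding F_def[symmetric] by simp
    have d: "[A] \<lhd> N.al \<star> [A] \<lhd> F \<rhd> [A] = [A] \<lhd> F \<star> [A] \<lhd> M.al"
      using whisk_eq[OF al, of "[A]" "[]"] by simp
    show "m \<rhd> [?W] \<star> [A] \<lhd> (N.mo.x3 \<star> [A] \<lhd> F)
        = m \<rhd> [?W] \<star> [A] \<lhd> ([A] \<lhd> F \<star> M.mo.x3)"
      by (simp add: ext2[OF N.mo.m_x3] a ext2[OF b] ext2[OF c] ext2[OF d] M.mo.m_x3)
  qed simp_all
  then have "str [A, ?V] [A, ?W] (Ac3 N \<cdot> \<one> A \<otimes> f) = str [A, ?V] [A, ?W] (\<one> A \<otimes> f \<cdot> Ac3 M)"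
    by (simp add: F_def M.mo.x3_def N.mo.x3_def to_str)
  then have "Ac3 N \<cdot> \<one> A \<otimes> f = \<one> A \<otimes> f \<cdot> Ac3 M"
    by (rule str_faithful[rotated 2]) (simp_all add: strable_def hom_iff)
  then show ?thesis using f 2 by (simp add: module_morphism_def)
qed

end

section \<open>Comparison with free Hopf modules\<close>

context hopf_bimodule
begin

text \<open>\<open>q\<close> is the coequalizer of some pair, and \<open>h\<close> identifies every
  pair that \<open>q\<close> identifies, hence that one. In this form the pair need not be known and
  no kernel pair has to exist.\<close>

lemma Q_coequalizer_factor:
  assumes q: "q \<in> Q" and h: "h \<in> hom C (Dom C q) W"
    and eq: "\<And>X f g. \<lbrakk>f \<in> hom C X (Dom C q); g \<in> hom C X (Dom C q); q \<cdot> f = q \<cdot> g\<rbrakk> \<Longrightarrow> h \<cdot> f = h \<cdot> g"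
  obtains k where "k \<in> hom C (Cod C q) W" "k \<cdot> q = h"
proof -
  obtain f g where "is_coequalizer C f g q" using Q_regular[OF q] by (auto simp: is_regular_epi_def)
  then obtain X Y Z where f: "f \<in> hom C X Y" and g: "g \<in> hom C X Y" and q: "q \<in> hom C Y Z" "q \<cdot> f = q \<cdot> g"
    and univ: "\<And>W h. \<lbrakk>h \<in> hom C Y W; h \<cdot> f = h \<cdot> g\<rbrakk> \<Longrightarrow> \<exists>!k. k \<in> hom C Z W \<and> k \<cdot> q = h"
    unfolding is_coequalizer_def by blast
  have d: "Dom C q = Y" "Cod C q = Z" using q by (auto simp: hom_iff)
  have "h \<cdot> f = h \<cdot> g" using eq[of f X g] f g q d by simp
  then obtain k where "k \<in> hom C Z W" "k \<cdot> q = h" using univ[of h W] h d by auto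
  then show ?thesis using that d by simp
qed

context
  fixes U p
  assumes p: "p \<in> hom C V U" and p_al: "p \<cdot> mo.alC = p \<cdot> cap_right C e V"
begin

lemma p_simps: "p \<in> Arr C" "Dom C p = V" "Cod C p = U" "U \<in> Obj C" "strable [V] [U] p"
  using p by (auto simp: hom_iff strable_def)

definition P where "P = str [V] [U] p"

lemma P_simps: "sdom P = [V]" "scod P = [U]" "rep P" "normal P" "valid P"
  using p_simps by (simp_all add: P_def)

lemma P_al: "P \<star> al = P \<star> [V] \<lhd> ep"
  using arg_cong[OF p_al, of "str [V, A] [U]"] p_simps by (simp add: P_def mo.al_def to_str)

text \<open>In element notation: \<open>p((x a)\<^sub>1) \<otimes> (x a)\<^sub>2 b = p(x\<^sub>1) \<otimes> x\<^sub>2 a b\<close>.\<close>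

lemma P_r_al: "P \<rhd> [A] \<star> r \<star> al \<rhd> [A] = P \<rhd> [A] \<star> r \<star> [V] \<lhd> m"
proof -
  have a: "P \<rhd> [A] \<star> al \<rhd> [A] = P \<rhd> [A] \<star> [V] \<lhd> ep \<rhd> [A]"
    using whisk_eq[OF P_al, of "[]" "[A]"] by simp
  show ?thesis
    unfolding compat[symmetric] by (simp add: ext2[OF a] ep_r13)
qed

lemma comparison_exists:
  obtains \<theta> where "\<theta> \<in> hom C V (U \<odot> A)" "\<theta> \<cdot> mo.alC = p \<otimes> \<one> A \<cdot> Co1 M"
proof (rule Q_coequalizer_factor[of mo.alC "p \<otimes> \<one> A \<cdot> Co1 M" "U \<odot> A"])
  fix X f g
  assume f: "f \<in> hom C X (Dom C mo.alC)" and g: "g \<in> hom C X (Dom C mo.alC)" and fg: "mo.alC \<cdot> f = mo.alC \<cdot> g"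
  have st: "strable [X] [V, A] f" "strable [X] [V, A] g"
    using f g by (auto simp: strable_def hom_iff)
  note [simp] = p_simps P_simps st
  have X: "X \<in> Obj C" using f by (auto simp: hom_iff)
  define F where "F = str [X] [V, A] f"
  define G where "G = str [X] [V, A] g"
  have FG [simp]: "sdom F = [X]" "scod F = [V, A]" "rep F" "normal F" "valid F"
    "sdom G = [X]" "scod G = [V, A]" "rep G" "normal G" "valid G"
    by (simp_all add: F_def G_def)
  have e: "al \<star> F = al \<star> G"
    unfolding F_def G_def mo.al_def using fg by (simp add: str_scomp)
  have "P \<rhd> [A] \<star> r \<star> F = P \<rhd> [A] \<star> r \<star> G"
  proof (rule nondeg_right[where Y = U])
    have a: "[U] \<lhd> m \<star> P \<rhd> [A, A] = P \<rhd> [A] \<star> [V] \<lhd> m"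
      using interchange[of "[]" P "[]" m "[]"] by simp
    \<comment> \<open>After a right test factor the map
      \<open>x \<otimes> a \<mapsto> p(x\<^sub>1) \<otimes> x\<^sub>2 a\<close> sees
      \<open>H\<close> only through \<open>al \<star> H\<close>, by \<open>P_r_al\<close>; so it
      cannot distinguish \<open>F\<close> from \<open>G\<close>.\<close>
    have H: "[U] \<lhd> m \<star> (P \<rhd> [A] \<star> r \<star> H) \<rhd> [A]
        = P \<rhd> [A] \<star> r \<star> (al \<star> H) \<rhd> [A]" for H
    proof -
      have "[U] \<lhd> m \<star> (P \<rhd> [A] \<star> r \<star> H) \<rhd> [A]
          = (P \<rhd> [A] \<star> r \<star> [V] \<lhd> m) \<star> H \<rhd> [A]"
        by (simp add: ext2[OF a] ext2[OF co.r_linear])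
      also have "\<dots> = P \<rhd> [A] \<star> r \<star> (al \<star> H) \<rhd> [A]"
        unfolding P_r_al[symmetric] by simp
      finally show ?thesis .
    qed
    show "[U] \<lhd> m \<star> (P \<rhd> [A] \<star> r \<star> F) \<rhd> [A]
        = [U] \<lhd> m \<star> (P \<rhd> [A] \<star> r \<star> G) \<rhd> [A]"
      unfolding H e ..
  qed simp_all
  then have "str [X] [U, A] (p \<otimes> \<one> A \<cdot> Co1 M \<cdot> f) = str [X] [U, A] (p \<otimes> \<one> A \<cdot> Co1 M \<cdot> g)"
    using f g X by (simp add: P_def F_def G_def co.r_def to_str)
  then show "p \<otimes> \<one> A \<cdot> Co1 M \<cdot> f = p \<otimes> \<one> A \<cdot> Co1 M \<cdot> g"
    by (rule str_faithful[rotated 2]) (use f g X in \<open>simp_all add: strable_def hom_iff\<close>)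
qed (use p_simps in \<open>simp_all add: hom_iff\<close>)

context
  fixes \<theta>
  assumes \<theta>: "\<theta> \<in> hom C V (U \<odot> A)" and \<theta>_al: "\<theta> \<cdot> mo.alC = p \<otimes> \<one> A \<cdot> Co1 M"
begin

definition T where "T = str [V] [U, A] \<theta>"

lemma T_simps: "\<theta> \<in> Arr C" "Dom C \<theta> = V" "Cod C \<theta> = U \<odot> A" "strable [V] [U, A] \<theta>"
  "sdom T = [V]" "scod T = [U, A]" "rep T" "normal T" "valid T"
proof -
  show 1: "\<theta> \<in> Arr C" "Dom C \<theta> = V" "Cod C \<theta> = U \<odot> A" and st: "strable [V] [U, A] \<theta>"
    using \<theta> p_simps by (auto simp: hom_iff strable_def)
  show "sdom T = [V]" "scod T = [U, A]" "rep T" "normal T" "valid T"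
    using st by (simp_all add: T_def)
qed

lemma T_al: "T \<star> al = P \<rhd> [A] \<star> r"
  using arg_cong[OF \<theta>_al, of "str [V, A] [U, A]"] p_simps T_simps
  by (simp add: P_def T_def mo.al_def co.r_def to_str)

lemma al_whisk_epi:
  assumes "rep F" "rep G" "sdom F = [V, A]" "sdom G = [V, A]" "scod F = scod G"
    and "F \<star> al \<rhd> [A] = G \<star> al \<rhd> [A]"
  shows "F = G"
proof -
  have q: "al \<rhd> [A] = str [V, A, A] [V, A] (mo.alC \<otimes> \<one> A)"
    by (simp add: mo.al_def to_str)
  show ?thesis
    by (rule strand_epi_cancel[OF _ _ assms(1-5) assms(6)[unfolded q]])
      (simp_all add: Q_epi Q_TensA Q_Id strable_def hom_iff)
qed

text \<open>Tested on \<open>x a \<otimes> b\<close>, where \<open>T_al\<close> gives the value of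
  \<open>T\<close>. The compatibility law and the fusion law of \<open>v\<^sup>1\<close> then bring
  both sides to the same composite.\<close>

lemma T_coaction: "[U] \<lhd> t1 \<star> T \<rhd> [A] = T \<rhd> [A] \<star> r"
proof (rule al_whisk_epi)
  note [simp] = p_simps P_simps T_simps
  have a: "T \<rhd> [A] \<star> al \<rhd> [A] = P \<rhd> [A, A] \<star> r \<rhd> [A]"
    using whisk_eq[OF T_al, of "[]" "[A]"] by simp
  have b: "[U] \<lhd> t1 \<star> P \<rhd> [A, A] = P \<rhd> [A, A] \<star> [V] \<lhd> t1"
    using interchange[of "[]" P "[]" t1 "[]"] by simp
  show "([U] \<lhd> t1 \<star> T \<rhd> [A]) \<star> al \<rhd> [A] = (T \<rhd> [A] \<star> r) \<star> al \<rhd> [A]"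
    by (simp add: a ext2[OF b] compat[symmetric] ext2[OF a] co.r_fusion)
qed (simp_all add: p_simps T_simps)

lemma T_action: "[U] \<lhd> m \<star> T \<rhd> [A] = T \<star> al"
proof (rule al_whisk_epi)
  note [simp] = p_simps P_simps T_simps
  have a: "T \<rhd> [A] \<star> al \<rhd> [A] = P \<rhd> [A, A] \<star> r \<rhd> [A]"
    using whisk_eq[OF T_al, of "[]" "[A]"] by simp
  have b: "[U] \<lhd> m \<star> P \<rhd> [A, A] = P \<rhd> [A] \<star> [V] \<lhd> m"
    using interchange[of "[]" P "[]" m "[]"] by simp
  show "([U] \<lhd> m \<star> T \<rhd> [A]) \<star> al \<rhd> [A] = (T \<star> al) \<star> al \<rhd> [A]"
    by (simp add: a ext2[OF b] mo.al_assoc ext2[OF T_al] co.r_linear)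
qed (simp_all add: p_simps T_simps)

lemma comparison_coaction: "lift23 C U A A (T1 B) \<cdot> \<theta> \<otimes> \<one> A = \<theta> \<otimes> \<one> A \<cdot> Co1 M"
proof -
  note [simp] = p_simps P_simps T_simps
  have "str [V, A] [U, A, A] (lift23 C U A A (T1 B) \<cdot> \<theta> \<otimes> \<one> A) = str [V, A] [U, A, A] (\<theta> \<otimes> \<one> A \<cdot> Co1 M)"
    using T_coaction by (simp add: T_def co.r_def to_str)
  then show ?thesis
    by (rule str_faithful[rotated 2]) (simp_all add: strable_def hom_iff lift23_def)
qed

lemma comparison_action: "mul23 C U A mul \<cdot> \<theta> \<otimes> \<one> A = \<theta> \<cdot> mo.alC"
proof -
  note [simp] = p_simps P_simps T_simps
  have "str [V, A] [U, A] (mul23 C U A mul \<cdot> \<theta> \<otimes> \<one> A) = str [V, A] [U, A] (\<theta> \<cdot> mo.alC)"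
    using T_action by (simp add: T_def mo.al_def to_str)
  then show ?thesis
    by (rule str_faithful[rotated 2]) (simp_all add: strable_def hom_iff mul23_def)
qed

end

end

end

section \<open>Free Hopf modules\<close>

context regular_hopf_monoid
begin

text \<open>The counit on the first factor of the fusion law for \<open>t\<^sub>1\<close>. Next to a
  strand \<open>X\<close> this is the compatibility law of the free Hopf module.\<close>

lemma m_fusion: "m \<rhd> [A] \<star> bi A A \<rhd> [A] \<star> [A] \<lhd> t1 \<star> bd A A \<rhd> [A] \<star> [A] \<lhd> t1
    = t1 \<star> m \<rhd> [A]"
proof -
  have a: "ep \<rhd> [A, A] \<star> t1 \<rhd> [A] = m \<rhd> [A]"
    using whisk_eq[OF m_t1, of "[]" "[A]"] by simp
  have b: "ep \<rhd> [A, A] \<star> [A] \<lhd> t1 = t1 \<star> ep \<rhd> [A, A]"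
    using interchange[of "[]" ep "[]" t1 "[]"] by simp
  have "m \<rhd> [A] \<star> bi A A \<rhd> [A] \<star> [A] \<lhd> t1 \<star> bd A A \<rhd> [A] \<star> [A] \<lhd> t1
     = ep \<rhd> [A, A] \<star> [A] \<lhd> t1 \<star> t1 \<rhd> [A]"
    unfolding t1_fusion[symmetric] by (simp add: ext2[OF a])
  then show ?thesis by (simp add: ext2[OF b] a)
qed

context
  fixes X :: 'o
  assumes X [simp]: "X \<in> Obj C"
begin

abbreviation XA :: 'o where "XA \<equiv> X \<odot> A"
text \<open>The axioms see \<open>X \<odot> A\<close> as one object, while the laws of
  \<open>A\<close> act on its second factor alone. \<open>jn\<close> and \<open>sp\<close> pass
  between the single strand and the pair and cancel inside every composite.\<close>

abbreviation jn :: "('o, 'a) strand" where "jn \<equiv> join [X, A]"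
abbreviation sp :: "('o, 'a) strand" where "sp \<equiv> split [X, A]"

lemma jn_sp_simps [simp]: "rep jn" "rep sp" "valid jn" "valid sp" "scod jn = [XA]" "sdom sp = [XA]"
  "set us \<subseteq> Obj C \<Longrightarrow> set vs \<subseteq> Obj C \<Longrightarrow> us \<lhd> jn \<rhd> vs \<star> us \<lhd> sp \<rhd> vs = sid (us @ [XA] @ vs)"
  "set us \<subseteq> Obj C \<Longrightarrow> set vs \<subseteq> Obj C \<Longrightarrow> us \<lhd> sp \<rhd> vs \<star> us \<lhd> jn \<rhd> vs = sid (us @ [X, A] @ vs)"
  unfolding swhisk_scomp[symmetric] by (simp_all add: rep_valid)

lemmas jn_sp_cancel = jn_sp_simps(7,8)[THEN ext2]

lemma free_strand:
  assumes "strable [A, A] [A, A] f"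
  shows "str [XA, A] [XA, A] (lift23 C X A A f)
    = jn \<rhd> [A] \<star> [X] \<lhd> str [A, A] [A, A] f \<star> sp \<rhd> [A]"
  using strableD[OF assms] assms by (simp add: to_str join_def split_def TensA_Id)

lemma brd_free:
  "brd sg XA A = [A] \<lhd> jn \<star> brd sg X A \<rhd> [A] \<star> [X] \<lhd> brd sg A A \<star> sp \<rhd> [A]"
  "brd sg A XA = jn \<rhd> [A] \<star> [X] \<lhd> brd sg A A \<star> brd sg A X \<rhd> [A] \<star> [A] \<lhd> sp"
proof -
  have "brd sg XA A = [A] \<lhd> jn \<star> brl sg [X, A] A \<star> sp \<rhd> [A]"
    by (simp add: brl_def jn_sp_cancel)
  then show "brd sg XA A = [A] \<lhd> jn \<star> brd sg X A \<rhd> [A] \<star> [X] \<lhd> brd sg A A \<star> sp \<rhd> [A]"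
    by (simp add: brl_pair)
  have "brd sg A XA = jn \<rhd> [A] \<star> brr sg A [X, A] \<star> [A] \<lhd> sp"
    by (simp add: brr_def jn_sp_cancel)
  then show "brd sg A XA = jn \<rhd> [A] \<star> [X] \<lhd> brd sg A A \<star> brd sg A X \<rhd> [A] \<star> [A] \<lhd> sp"
    by (simp add: brr_pair)
qed

abbreviation FM :: "('o, 'a) hopf_data" where "FM \<equiv> free_hopf_module C B X"

lemma FM_simps [simp]:
  "HObj FM = XA" "Co1 FM = lift23 C X A A (T1 B)" "Co3 FM = lift23 C X A A (T3 B)" "Ac2 FM = lift23 C X A A (T2 B)"
  by (simp_all add: free_hopf_module_def Let_def)

lemma FM_arrows [simp]:
  "f \<in> Arr C \<Longrightarrow> Dom C f = A \<odot> A \<Longrightarrow> Cod C f = A \<odot> A \<Longrightarrow> lift23 C X A A f \<in> Arr C"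
  "f \<in> Arr C \<Longrightarrow> Dom C f = A \<odot> A \<Longrightarrow> Cod C f = A \<odot> A \<Longrightarrow> Dom C (lift23 C X A A f) = X \<odot> A \<odot> A"
  "f \<in> Arr C \<Longrightarrow> Dom C f = A \<odot> A \<Longrightarrow> Cod C f = A \<odot> A \<Longrightarrow> Cod C (lift23 C X A A f) = X \<odot> A \<odot> A"
  "Ac3 FM \<in> Arr C" "Dom C (Ac3 FM) = A \<odot> XA" "Cod C (Ac3 FM) = A \<odot> XA"
  by (simp_all add: lift23_def free_hopf_module_def Let_def)

definition fr :: "('o, 'a) strand" where "fr = str [XA, A] [XA, A] (lift23 C X A A (T1 B))"
definition fw :: "('o, 'a) strand" where "fw = str [XA, A] [XA, A] (lift23 C X A A (T3 B))"
definition fx2 :: "('o, 'a) strand" where "fx2 = str [XA, A] [XA, A] (lift23 C X A A (T2 B))"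
definition fx3 :: "('o, 'a) strand" where "fx3 = str [A, XA] [A, XA] (Ac3 FM)"
definition fal :: "('o, 'a) strand" where "fal = str [XA, A] [XA] (action C B FM)"

lemma action_FM: "action C B FM = cap_right C e XA \<cdot> lift23 C X A A (T2 B)"
  by (simp add: action_def)

lemma fr_eq: "fr = jn \<rhd> [A] \<star> [X] \<lhd> t1 \<star> sp \<rhd> [A]"
  and fw_eq: "fw = jn \<rhd> [A] \<star> [X] \<lhd> t3 \<star> sp \<rhd> [A]"
  and fx2_eq: "fx2 = jn \<rhd> [A] \<star> [X] \<lhd> t2 \<star> sp \<rhd> [A]"
  by (simp_all add: fr_def fw_def fx2_def free_strand t1_def t2_def t3_def)

lemma ep_jn: "[XA] \<lhd> ep \<star> jn \<rhd> [A] = jn \<star> [X, A] \<lhd> ep"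
  using interchange[of "[]" jn "[]" ep "[]"] by simp

lemma ep_sp: "[X, A] \<lhd> ep \<star> sp \<rhd> [A] = sp \<star> [XA] \<lhd> ep"
  using interchange[of "[]" sp "[]" ep "[]"] by simp

lemma fal_eq: "fal = jn \<star> [X] \<lhd> m \<star> sp \<rhd> [A]"
proof -
  have "fal = [XA] \<lhd> ep \<star> fx2"
    by (simp add: fal_def fx2_def action_FM ep_whisk str_scomp strable_def hom_iff)
  also have "\<dots> = jn \<star> [X] \<lhd> m \<star> sp \<rhd> [A]"
    using ext2[OF whisk_eq[OF m_t2, of "[X]" "[]", simplified]] by (simp add: fx2_eq ext2[OF ep_jn])
  finally show ?thesis .
qed

lemma fx3_eq: "fx3 = [A] \<lhd> jn \<star> bd X A \<rhd> [A] \<star> [X] \<lhd> t3 \<star> bi A X \<rhd> [A] \<star> [A] \<lhd> sp"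
proof -
  have j: "[A] \<lhd> jn = str [A, X, A] [A, XA] (\<a> A X A)"
    and s: "[A] \<lhd> sp = str [A, XA] [A, X, A] (arr_inv C (\<a> A X A))"
    by (simp_all add: join_def split_def to_str TensA_Id)
  show ?thesis
    unfolding j s by (simp add: fx3_def free_hopf_module_def Let_def to_str)
qed

lemma push:
  assumes "normal g" "sdom g = us" "scod g = vs"
  shows "[XA] \<lhd> g \<star> jn \<rhd> us = jn \<rhd> vs \<star> [X, A] \<lhd> g"
    and "sp \<rhd> vs \<star> [XA] \<lhd> g = [X, A] \<lhd> g \<star> sp \<rhd> us"
  using interchange[of "[]" jn "[]" g "[]"] interchange[of "[]" sp "[]" g "[]"] assms by simp_all

lemma cross:
  assumes "normal g" "sdom g = us" "scod g = vs" "P \<in> Obj C" "P' \<in> Obj C"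
  shows "[P', P] \<lhd> g \<star> brd sg P P' \<rhd> us = brd sg P P' \<rhd> vs \<star> [P, P'] \<lhd> g"
  using interchange[of "[]" "brd sg P P'" "[]" g "[]"] assms by simp

text \<open>The two crossings of \<open>X\<close> with \<open>A\<close> that \<open>brd_free\<close>
  produces are mutually inverse. Once they cancel, \<open>X\<close> merely stands beside the fusion
  law of \<open>t\<close>.\<close>

lemma free_fusion:
  assumes t: "t = str [A, A] [A, A] f" "strable [A, A] [A, A] f"
    and fusion: "t \<rhd> [A] \<star> brd (\<not> sg) A A \<rhd> [A] \<star> [A] \<lhd> t \<star> brd sg A A \<rhd> [A] \<star> [A] \<lhd> t
      = [A] \<lhd> t \<star> t \<rhd> [A]"
    and ft: "ft = jn \<rhd> [A] \<star> [X] \<lhd> t \<star> sp \<rhd> [A]"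
  shows "ft \<rhd> [A] \<star> brd (\<not> sg) A XA \<rhd> [A] \<star> [A] \<lhd> ft \<star> brd sg XA A \<rhd> [A] \<star> [XA] \<lhd> t
      = [XA] \<lhd> t \<star> ft \<rhd> [A]"
proof -
  have [simp]: "sdom t = [A, A]" "scod t = [A, A]" "normal t" "valid t"
    using t by simp_all
  have f': "[X] \<lhd> t \<rhd> [A] \<star> [X] \<lhd> brd (\<not> sg) A A \<rhd> [A] \<star> [X, A] \<lhd> t \<star> [X] \<lhd> brd sg A A \<rhd> [A] \<star> [X, A] \<lhd> t
      = [X, A] \<lhd> t \<star> [X] \<lhd> t \<rhd> [A]"
    using whisk_eq[OF fusion, of "[X]" "[]"] by simp
  have c: "brd (\<not> sg) A X \<rhd> [A, A] \<star> brd sg X A \<rhd> [A, A] = sid [X, A, A, A]"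
    by (simp add: brd_whisk_inverse(1)[where us = "[]", simplified])
  note p1 = push(1)[of t "[A, A]" "[A, A]", simplified] and p2 = push(2)[of t "[A, A]" "[A, A]", simplified]
    and x = cross[of t "[A, A]" "[A, A]" X A sg, simplified]
  show ?thesis
    by (simp add: ft brd_free jn_sp_cancel ext2[OF p1] p2 ext2[OF x] ext2[OF c] ext5[OF f'])
qed

lemma free_counit:
  assumes "normal t" "sdom t = [A, A]" "scod t = [A, A]" "[A] \<lhd> ep \<star> t = [A] \<lhd> ep"
    and ft: "ft = jn \<rhd> [A] \<star> [X] \<lhd> t \<star> sp \<rhd> [A]"
  shows "[XA] \<lhd> ep \<star> ft = [XA] \<lhd> ep"
proof -
  have a: "[X, A] \<lhd> ep \<star> [X] \<lhd> t = [X, A] \<lhd> ep"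
    using whisk_eq[OF assms(4), of "[X]" "[]"] by simp
  have b: "jn \<star> sp = sid [XA]" by simp
  show ?thesis by (simp add: ft ext2[OF ep_jn] ext2[OF a] ep_sp ext2[OF b])
qed

lemma free_comodule: "is_comodule C B XA (lift23 C X A A (T1 B)) (lift23 C X A A (T3 B))"
proof -
  have 1: "fr \<rhd> [A] \<star> bi A XA \<rhd> [A] \<star> [A] \<lhd> fr \<star> bd XA A \<rhd> [A] \<star> [XA] \<lhd> t1
      = [XA] \<lhd> t1 \<star> fr \<rhd> [A]"
    using free_fusion[OF t1_def _ _ fr_eq, of True] t1_fusion by simp
  have 2: "fw \<rhd> [A] \<star> bd A XA \<rhd> [A] \<star> [A] \<lhd> fw \<star> bi XA A \<rhd> [A] \<star> [XA] \<lhd> t3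
      = [XA] \<lhd> t3 \<star> fw \<rhd> [A]"
    using free_fusion[OF t3_def _ _ fw_eq, of False] t3_fusion by simp
  have 3: "[XA] \<lhd> ep \<star> fr = [XA] \<lhd> ep" "[XA] \<lhd> ep \<star> fw = [XA] \<lhd> ep"
    using free_counit[OF _ _ _ ep_t1 fr_eq] free_counit[OF _ _ _ ep_t3 fw_eq] by simp_all
  have c: "[X, A] \<lhd> m \<star> [X] \<lhd> bd A A \<rhd> [A] \<star> [X, A] \<lhd> t1
      = [X, A] \<lhd> m \<star> [X] \<lhd> t3 \<rhd> [A] \<star> [X] \<lhd> bd A A \<rhd> [A]"
    using whisk_eq[OF t13_compat, of "[X]" "[]"] by simp
  note p = push(1)[of m "[A, A]" "[A]", simplified]
    and x = cross[of t1 "[A, A]" "[A, A]" A X True, simplified]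
  have 4: "[XA] \<lhd> m \<star> bd A XA \<rhd> [A] \<star> [A] \<lhd> fr
      = [XA] \<lhd> m \<star> fw \<rhd> [A] \<star> bd A XA \<rhd> [A]"
    by (simp add: fr_eq fw_eq brd_free jn_sp_cancel ext2[OF p] ext2[OF x[symmetric]] ext3[OF c[symmetric]])
  define v1 where "v1 = lift23 C X A A (T1 B)"
  define v3 where "v3 = lift23 C X A A (T3 B)"
  have [simp]: "v1 \<in> Arr C" "Dom C v1 = XA \<odot> A" "Cod C v1 = XA \<odot> A"
    "v3 \<in> Arr C" "Dom C v3 = XA \<odot> A" "Cod C v3 = XA \<odot> A"
    by (simp_all add: v1_def v3_def)
  have fr: "fr = str [XA, A] [XA, A] v1" and fw: "fw = str [XA, A] [XA, A] v3"
    by (simp_all add: fr_def fw_def v1_def v3_def)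
  have "v1 \<otimes> \<one> A \<cdot> \<c>\<inverse> A XA \<otimes> \<one> A \<cdot> lift23 C A XA A v1 \<cdot> \<c> XA A \<otimes> \<one> A \<cdot> lift23 C XA A A (T1 B)
         = lift23 C XA A A (T1 B) \<cdot> v1 \<otimes> \<one> A"
    by (rule str_faithful[of "[XA, A, A]" "[XA, A, A]"])
      (use 1 in \<open>simp_all add: fr to_str\<close>)
  moreover have "v3 \<otimes> \<one> A \<cdot> \<c> A XA \<otimes> \<one> A \<cdot> lift23 C A XA A v3 \<cdot> \<c>\<inverse> XA A \<otimes> \<one> A \<cdot> lift23 C XA A A (T3 B)
         = lift23 C XA A A (T3 B) \<cdot> v3 \<otimes> \<one> A"
    by (rule str_faithful[of "[XA, A, A]" "[XA, A, A]"])
      (use 2 in \<open>simp_all add: fw to_str\<close>)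
  moreover have "cap_right C e XA \<cdot> v1 = cap_right C e XA"
    by (rule str_faithful[of "[XA, A]" "[XA]"]) (use 3(1) in \<open>simp_all add: fr to_str\<close>)
  moreover have "cap_right C e XA \<cdot> v3 = cap_right C e XA"
    by (rule str_faithful[of "[XA, A]" "[XA]"]) (use 3(2) in \<open>simp_all add: fw to_str\<close>)
  moreover have "mul23 C XA A mul \<cdot> \<c> A XA \<otimes> \<one> A \<cdot> lift23 C A XA A v1 = mul23 C XA A mul \<cdot> v3 \<otimes> \<one> A \<cdot> \<c> A XA \<otimes> \<one> A"
    by (rule str_faithful[of "[A, XA, A]" "[XA, A]"])
      (use 4 in \<open>simp_all add: fr fw to_str\<close>)
  ultimately show ?thesis
    unfolding v1_def[symmetric] v3_def[symmetric] by (simp add: is_comodule_def Let_def hom_iff)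
qed

lemma free_module: "is_module C Q B XA (lift23 C X A A (T2 B)) (Ac3 FM)"
proof -
  \<comment> \<open>\<open>si\<close> carries \<open>X\<close> across two strands \<open>A\<close>.
    Conjugation by it turns \<open>[A] \<lhd> c3\<close>, where \<open>X\<close> stands between the
    factors, into \<open>t\<^sub>3\<close> with \<open>X\<close> on the far left
    (\<open>c3s\<close>), so the module laws become laws of \<open>t\<^sub>3\<close>.\<close>
  define si where "si = [A] \<lhd> bd X A \<rhd> [A] \<star> bd X A \<rhd> [A, A]"
  define si' where "si' = bi A X \<rhd> [A, A] \<star> [A] \<lhd> bi A X \<rhd> [A]"
  have si [simp]: "normal si" "normal si'" "sdom si = [X, A, A, A]" "scod si = [A, A, X, A]"
    "si \<star> si' = sid [A, A, X, A]"
    by (simp_all add: si_def si'_def brd_cancel)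
  define c3 where "c3 = bd X A \<rhd> [A] \<star> [X] \<lhd> t3 \<star> bi A X \<rhd> [A]"
  have c3 [simp]: "sdom c3 = [A, X, A]" "scod c3 = [A, X, A]" "normal c3" "valid c3"
    by (simp_all add: c3_def)
  have x3: "fx3 = [A] \<lhd> jn \<star> c3 \<star> [A] \<lhd> sp"
    by (simp add: fx3_eq c3_def)
  have sl: "str [A, A] [A, A] f \<rhd> [X, A] \<star> si = si \<star> [X] \<lhd> str [A, A] [A, A] f \<rhd> [A]"
    if "strable [A, A] [A, A] f" for f
    using whisk_eq[OF slide22(2)[OF that X, of True], of "[]" "[A]"] unfolding si_def by simp
  have sl2: "t2 \<rhd> [X, A] \<star> si = si \<star> [X] \<lhd> t2 \<rhd> [A]" "t3 \<rhd> [X, A] \<star> si = si \<star> [X] \<lhd> t3 \<rhd> [A]"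
    "brd sg A A \<rhd> [X, A] \<star> si = si \<star> [X] \<lhd> brd sg A A \<rhd> [A]" for sg
    unfolding t2_def t3_def brd_def[of _ A A] by (rule sl; simp add: strable_def hom_iff)+
  have x: "[A, X] \<lhd> t3 \<star> bd X A \<rhd> [A, A] = bd X A \<rhd> [A, A] \<star> [X, A] \<lhd> t3"
    using cross[of t3 "[A, A]" "[A, A]" X A True] by simp
  have c3s: "[A] \<lhd> c3 \<star> si = si \<star> [X, A] \<lhd> t3"
    by (simp add: c3_def si_def brd_cancel x)
  have tf: "[X] \<lhd> t3 \<rhd> [A] \<star> [X] \<lhd> bd A A \<rhd> [A] \<star> [X, A] \<lhd> t3 \<star> [X] \<lhd> bi A A \<rhd> [A] \<star> [X, A] \<lhd> t3
      = [X, A] \<lhd> t3 \<star> [X] \<lhd> t3 \<rhd> [A]"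
    using whisk_eq[OF t3_fusion, of "[X]" "[]"] by simp
  have e3: "t3 \<rhd> [X, A] \<star> bd A A \<rhd> [X, A] \<star> [A] \<lhd> c3 \<star> bi A A \<rhd> [X, A] \<star> [A] \<lhd> c3
      = [A] \<lhd> c3 \<star> t3 \<rhd> [X, A]"
    by (rule strand_iso_cancel[where x = si and y = si' and zs = "[A, A, X, A]"])
      (simp_all add: c3s ext2[OF c3s] sl2 ext2[OF sl2(1)] ext2[OF sl2(2)] ext2[OF sl2(3)] tf)
  have t32: "[X] \<lhd> t2 \<rhd> [A] \<star> [X, A] \<lhd> t3 = [X, A] \<lhd> t3 \<star> [X] \<lhd> t2 \<rhd> [A]"
    using whisk_eq[OF t32_commute, of "[X]" "[]"] by simp
  have e5: "t2 \<rhd> [X, A] \<star> [A] \<lhd> c3 = [A] \<lhd> c3 \<star> t2 \<rhd> [X, A]"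
    by (rule strand_iso_cancel[where x = si and y = si' and zs = "[A, A, X, A]"])
      (simp_all add: c3s ext2[OF c3s] sl2 ext2[OF sl2(1)] t32)
  have xj: "g \<rhd> [XA] \<star> [A, A] \<lhd> jn = [A, A] \<lhd> jn \<star> g \<rhd> [X, A]"
    "[A, A] \<lhd> sp \<star> g \<rhd> [XA] = g \<rhd> [X, A] \<star> [A, A] \<lhd> sp"
    if "sdom g = [A, A]" "scod g = [A, A]" for g
    using interchange[of "[]" g "[]" jn "[]"] interchange[of "[]" g "[]" sp "[]"] that by simp_all
  have 1: "[XA] \<lhd> t2 \<star> [XA] \<lhd> bi A A \<star> fx2 \<rhd> [A] \<star> [XA] \<lhd> bd A A \<star> fx2 \<rhd> [A]
      = fx2 \<rhd> [A] \<star> [XA] \<lhd> t2"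
  proof -
    have f: "[X, A] \<lhd> t2 \<star> [X, A] \<lhd> bi A A \<star> [X] \<lhd> t2 \<rhd> [A] \<star> [X, A] \<lhd> bd A A \<star> [X] \<lhd> t2 \<rhd> [A]
      = [X] \<lhd> t2 \<rhd> [A] \<star> [X, A] \<lhd> t2"
      using whisk_eq[OF t2_fusion, of "[X]" "[]"] by simp
    note p = push(1)[of t2 "[A, A]" "[A, A]", simplified] push(2)[of t2 "[A, A]" "[A, A]", simplified]
      push(1)[of "brd sg A A" "[A, A]" "[A, A]" for sg, simplified]
    show ?thesis
      by (simp add: fx2_eq ext2[OF p(1)] ext2[OF p(3)] p(2) jn_sp_cancel ext5[OF f])
  qed
  have 2: "t3 \<rhd> [XA] \<star> bd A A \<rhd> [XA] \<star> [A] \<lhd> fx3 \<star> bi A A \<rhd> [XA] \<star> [A] \<lhd> fx3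
      = [A] \<lhd> fx3 \<star> t3 \<rhd> [XA]"
    by (simp add: x3 ext2[OF xj(1)] xj(2) jn_sp_cancel ext5[OF e3])
  have 3: "[XA] \<lhd> t3 \<star> fx2 \<rhd> [A] = fx2 \<rhd> [A] \<star> [XA] \<lhd> t3"
    using ext2[OF push(1)[of t3 "[A, A]" "[A, A]", simplified]] push(2)[of t3 "[A, A]" "[A, A]"]
    by (simp add: fx2_eq ext2[OF t32])
  have 4: "t2 \<rhd> [XA] \<star> [A] \<lhd> fx3 = [A] \<lhd> fx3 \<star> t2 \<rhd> [XA]"
    by (simp add: x3 ext2[OF xj(1)] xj(2) ext2[OF e5])
  have 5: "fal = ep \<rhd> [XA] \<star> fx3 \<star> bd XA A"
  proof -
    have a: "ep \<rhd> [XA] \<star> [A] \<lhd> jn = jn \<star> ep \<rhd> [X, A]"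
      using interchange[of "[]" ep "[]" jn "[]"] by simp
    have b: "ep \<rhd> [X, A] \<star> bd X A \<rhd> [A] = [X] \<lhd> ep \<rhd> [A]"
      using whisk_eq[OF ep_slide(2)[OF X, of True], of "[]" "[A]"] by simp
    have c: "[X] \<lhd> ep \<rhd> [A] \<star> [X] \<lhd> t3 = [X] \<lhd> m \<star> [X] \<lhd> bi A A"
      using whisk_eq[OF m_t3, of "[X]" "[]"] by simp
    show ?thesis
      by (simp add: fal_eq fx3_eq brd_free jn_sp_cancel brd_cancel ext2[OF a] ext2[OF b] ext2[OF c])
  qed
  define v2 where "v2 = lift23 C X A A (T2 B)"
  define v3 where "v3 = Ac3 FM"
  have [simp]: "v2 \<in> Arr C" "Dom C v2 = XA \<odot> A" "Cod C v2 = XA \<odot> A"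
    "v3 \<in> Arr C" "Dom C v3 = A \<odot> XA" "Cod C v3 = A \<odot> XA"
    by (simp_all add: v2_def v3_def)
  have f2: "fx2 = str [XA, A] [XA, A] v2" and f3: "fx3 = str [A, XA] [A, XA] v3"
    and fal: "fal = str [XA, A] [XA] (cap_right C e XA \<cdot> v2)"
    by (simp_all add: fx2_def fx3_def fal_def action_FM v2_def v3_def)
  have "lift23 C XA A A (T2 B) \<cdot> lift23 C XA A A (\<c>\<inverse> A A) \<cdot> v2 \<otimes> \<one> A \<cdot> lift23 C XA A A (\<c> A A) \<cdot> v2 \<otimes> \<one> A
         = v2 \<otimes> \<one> A \<cdot> lift23 C XA A A (T2 B)"
    by (rule str_faithful[of "[XA, A, A]" "[XA, A, A]"])
      (use 1 in \<open>simp_all add: f2 to_str\<close>)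
  moreover have "T3 B \<otimes> \<one> XA \<cdot> \<c> A A \<otimes> \<one> XA \<cdot> lift23 C A A XA v3 \<cdot> \<c>\<inverse> A A \<otimes> \<one> XA \<cdot> lift23 C A A XA v3
         = lift23 C A A XA v3 \<cdot> T3 B \<otimes> \<one> XA"
    by (rule str_faithful[of "[A, A, XA]" "[A, A, XA]"])
      (use 2 in \<open>simp_all add: f3 to_str\<close>)
  moreover have "lift23 C XA A A (T3 B) \<cdot> v2 \<otimes> \<one> A = v2 \<otimes> \<one> A \<cdot> lift23 C XA A A (T3 B)"
    by (rule str_faithful[of "[XA, A, A]" "[XA, A, A]"])
      (use 3 in \<open>simp_all add: f2 to_str\<close>)
  moreover have "T2 B \<otimes> \<one> XA \<cdot> lift23 C A A XA v3 = lift23 C A A XA v3 \<cdot> T2 B \<otimes> \<one> XA"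
    by (rule str_faithful[of "[A, A, XA]" "[A, A, XA]"])
      (use 4 in \<open>simp_all add: f3 to_str\<close>)
  moreover have "cap_right C e XA \<cdot> v2 = cap_left C e XA \<cdot> v3 \<cdot> \<c> XA A"
    by (rule str_faithful[of "[XA, A]" "[XA]"])
      (use 5 in \<open>simp_all add: f3 fal to_str\<close>)
  \<comment> \<open>\<open>t\<^sub>2\<close> is invertible, so the action is a counit in
    \<open>Q\<close> composed with an isomorphism.\<close>
  moreover have "is_iso C v2"
    unfolding v2_def lift23_def by (simp add: iso_Comp iso_TensA iso_Id)
  then have "cap_right C e XA \<cdot> v2 \<in> Q"
    by (simp add: Q_Comp Q_cap Q_iso)
  ultimately show ?thesis
    unfolding v2_def[symmetric] v3_def[symmetric] by (simp add: is_module_def Let_def hom_iff)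
qed

lemma free_compat: "fal \<rhd> [A] \<star> bi A XA \<rhd> [A] \<star> [A] \<lhd> fr \<star> bd XA A \<rhd> [A] \<star> [XA] \<lhd> t1
    = fr \<star> fal \<rhd> [A]"
proof -
  have f: "[X] \<lhd> m \<rhd> [A] \<star> [X] \<lhd> bi A A \<rhd> [A] \<star> [X, A] \<lhd> t1 \<star> [X] \<lhd> bd A A \<rhd> [A] \<star> [X, A] \<lhd> t1
      = [X] \<lhd> t1 \<star> [X] \<lhd> m \<rhd> [A]"
    using whisk_eq[OF m_fusion, of "[X]" "[]"] by simp
  note p = push(2)[of t1 "[A, A]" "[A, A]", simplified]
    and x = cross[of t1 "[A, A]" "[A, A]" X A True, simplified]
  show ?thesis
    by (simp add: fr_eq fal_eq brd_free jn_sp_cancel brd_cancel p ext2[OF x] ext5[OF f])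
qed

lemma free_hopf: "hopf_module C Q B FM"
proof -
  define v where "v = action C B FM"
  define v1 where "v1 = lift23 C X A A (T1 B)"
  have [simp]: "v1 \<in> Arr C" "Dom C v1 = XA \<odot> A" "Cod C v1 = XA \<odot> A"
    "v \<in> Arr C" "Dom C v = XA \<odot> A" "Cod C v = XA"
    by (simp_all add: v1_def v_def action_FM)
  have fr: "fr = str [XA, A] [XA, A] v1" and fal: "fal = str [XA, A] [XA] v"
    by (simp_all add: fr_def fal_def v1_def v_def)
  have "v \<otimes> \<one> A \<cdot> \<c>\<inverse> A XA \<otimes> \<one> A \<cdot> lift23 C A XA A v1 \<cdot> \<c> XA A \<otimes> \<one> A \<cdot> lift23 C XA A A (T1 B) = v1 \<cdot> v \<otimes> \<one> A"
    by (rule str_faithful[of "[XA, A, A]" "[XA, A]"])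
      (use free_compat in \<open>simp_all add: fr fal to_str\<close>)
  then show ?thesis
    using free_comodule free_module by (simp add: hopf_module_def Let_def v_def v1_def)
qed

lemma action_free: "action C B FM = mul23 C X A mul"
proof (rule str_faithful[of "[XA, A]" "[XA]"])
  have "str [XA, A] [XA] (mul23 C X A mul) = jn \<star> [X] \<lhd> m \<star> sp \<rhd> [A]"
    by (simp add: to_str join_def split_def TensA_Id)
  then show "str [XA, A] [XA] (action C B FM) = str [XA, A] [XA] (mul23 C X A mul)"
    using fal_eq by (simp add: fal_def)
qed (simp_all add: action_FM strable_def hom_iff mul23_def)

text \<open>\<open>m\<close> is \<open>e1\<close> after \<open>t\<^sub>1\<close>, so on a free
  module the action is a counit after the coaction. The inverse coaction in the projection onto
  coinvariants then cancels and leaves the counit.\<close>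

lemma free_projection: "action C B FM = cap_right C e X \<otimes> \<one> A \<cdot> lift23 C X A A (T1 B)"
  unfolding action_free
proof (rule str_faithful[of "[X, A, A]" "[X, A]"])
  have "[X] \<lhd> ep \<rhd> [A] = ([X] \<lhd> ep) \<rhd> [A]" by simp
  then have w: "[X] \<lhd> ep \<rhd> [A] = str [X, A, A] [X, A] (cap_right C e X \<otimes> \<one> A)"
    by (simp add: to_str del: swhisk_swhisk)
  have "[X] \<lhd> ep \<rhd> [A] \<star> [X] \<lhd> t1 = [X] \<lhd> m"
    using whisk_eq[OF m_t1, of "[X]" "[]"] by simp
  then show "str [X, A, A] [X, A] (mul23 C X A mul) = str [X, A, A] [X, A] (cap_right C e X \<otimes> \<one> A \<cdot> lift23 C X A A (T1 B))"
    unfolding w by (simp add: to_str)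
qed (simp_all add: strable_def hom_iff mul23_def lift23_def)

end

lemma free_arrow:
  assumes f: "f \<in> hom C X Y"
  shows "comodule_morphism C B (free_hopf_module C B X) (free_hopf_module C B Y) (f \<otimes> \<one> A)"
    and "module_morphism C B (free_hopf_module C B X) (free_hopf_module C B Y) (f \<otimes> \<one> A)"
proof -
  have o: "f \<in> Arr C" "Dom C f = X" "Cod C f = Y" "X \<in> Obj C" "Y \<in> Obj C" using f by (auto simp: hom_iff)
  define F where "F = str [X] [Y] f"
  have F [simp]: "sdom F = [X]" "scod F = [Y]" "normal F" "valid F"
    using o by (simp_all add: F_def strable_def hom_iff)
  have a: "[Y] \<lhd> t1 \<star> F \<rhd> [A, A] = F \<rhd> [A, A] \<star> [X] \<lhd> t1"
    using interchange[of "[]" F "[]" t1 "[]"] by simp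
  have b: "[Y] \<lhd> m \<star> F \<rhd> [A, A] = F \<rhd> [A] \<star> [X] \<lhd> m"
    using interchange[of "[]" F "[]" m "[]"] by simp
  have w2: "F \<rhd> [A, A] = str [X, A, A] [Y, A, A] (f \<otimes> \<one> A \<otimes> \<one> A)"
  proof -
    have "F \<rhd> [A, A] = (F \<rhd> [A]) \<rhd> [A]" by simp
    then show ?thesis using o by (simp add: F_def to_str del: swhisk_swhisk)
  qed
  have c1: "lift23 C Y A A (T1 B) \<cdot> f \<otimes> \<one> A \<otimes> \<one> A = f \<otimes> \<one> A \<otimes> \<one> A \<cdot> lift23 C X A A (T1 B)"
    by (rule str_faithful[of "[X, A, A]" "[Y, A, A]"]) (use a[unfolded w2] o in \<open>simp_all add: to_str\<close>)
  have c2: "mul23 C Y A mul \<cdot> f \<otimes> \<one> A \<otimes> \<one> A = f \<otimes> \<one> A \<cdot> mul23 C X A mul"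
    by (rule str_faithful[of "[X, A, A]" "[Y, A]"]) (use b[unfolded w2] o in \<open>simp_all add: F_def to_str\<close>)
  show "comodule_morphism C B (free_hopf_module C B X) (free_hopf_module C B Y) (f \<otimes> \<one> A)"
    by (rule comodule_morphismI) (use o c1 in \<open>simp_all add: free_hopf FM_simps hom_iff\<close>)
  show "module_morphism C B (free_hopf_module C B X) (free_hopf_module C B Y) (f \<otimes> \<one> A)"
    by (rule module_morphismI) (use o c2 in \<open>simp_all add: free_hopf FM_simps action_free hom_iff\<close>)
qed

end

section \<open>The category of Hopf modules and the free functor\<close>

context regular_hopf_monoid
begin

definition hopf_arrow :: "('o, 'a) hopf_data \<Rightarrow> ('o, 'a) hopf_data \<Rightarrow> 'a \<Rightarrow> bool" where
  "hopf_arrow M N f \<longleftrightarrow> hopf_module C Q B M \<and> hopf_module C Q B N \<and>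
     comodule_morphism C B M N f \<and> module_morphism C B M N f"

abbreviation HC where "HC \<equiv> hopf_cat C Q B"

lemma hopf_module_simps [simp]:
  assumes "hopf_module C Q B M"
  shows "HObj M \<in> Obj C"
    "Co1 M \<in> Arr C" "Dom C (Co1 M) = HObj M \<odot> A" "Cod C (Co1 M) = HObj M \<odot> A"
    "Co3 M \<in> Arr C" "Dom C (Co3 M) = HObj M \<odot> A" "Cod C (Co3 M) = HObj M \<odot> A"
    "Ac2 M \<in> Arr C" "Dom C (Ac2 M) = HObj M \<odot> A" "Cod C (Ac2 M) = HObj M \<odot> A"
    "Ac3 M \<in> Arr C" "Dom C (Ac3 M) = A \<odot> HObj M" "Cod C (Ac3 M) = A \<odot> HObj M"
    "action C B M \<in> Arr C" "Dom C (action C B M) = HObj M \<odot> A" "Cod C (action C B M) = HObj M"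
    "action C B M \<in> Q" "is_iso C (Co1 M)"
proof -
  interpret hopf_bimodule C Q B M by unfold_locales (fact assms)
  show "HObj M \<in> Obj C"
    "Co1 M \<in> Arr C" "Dom C (Co1 M) = HObj M \<odot> A" "Cod C (Co1 M) = HObj M \<odot> A"
    "Co3 M \<in> Arr C" "Dom C (Co3 M) = HObj M \<odot> A" "Cod C (Co3 M) = HObj M \<odot> A"
    "Ac2 M \<in> Arr C" "Dom C (Ac2 M) = HObj M \<odot> A" "Cod C (Ac2 M) = HObj M \<odot> A"
    "Ac3 M \<in> Arr C" "Dom C (Ac3 M) = A \<odot> HObj M" "Cod C (Ac3 M) = A \<odot> HObj M"
    "action C B M \<in> Arr C" "Dom C (action C B M) = HObj M \<odot> A" "Cod C (action C B M) = HObj M"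
    "action C B M \<in> Q" "is_iso C (Co1 M)"
    by (simp_all add: action_eq co.v1_iso)
qed

lemma hopf_arrowD:
  assumes "hopf_arrow M N f"
  shows "hopf_module C Q B M" "hopf_module C Q B N" "f \<in> Arr C" "Dom C f = HObj M" "Cod C f = HObj N"
    "Co1 N \<cdot> f \<otimes> \<one> A = f \<otimes> \<one> A \<cdot> Co1 M" "Co3 N \<cdot> f \<otimes> \<one> A = f \<otimes> \<one> A \<cdot> Co3 M"
    "Ac2 N \<cdot> f \<otimes> \<one> A = f \<otimes> \<one> A \<cdot> Ac2 M" "Ac3 N \<cdot> \<one> A \<otimes> f = \<one> A \<otimes> f \<cdot> Ac3 M"
  using assms by (auto simp: hopf_arrow_def comodule_morphism_def module_morphism_def hom_iff)

lemma cap_right_nat: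
  assumes "f \<in> Arr C"
  shows "cap_right C e (Cod C f) \<cdot> f \<otimes> \<one> A = f \<cdot> cap_right C e (Dom C f)"
proof -
  have "cap_right C e (Cod C f) \<cdot> f \<otimes> \<one> A = \<r> (Cod C f) \<cdot> (\<one> (Cod C f) \<otimes> e \<cdot> f \<otimes> \<one> A)"
    using assms by (simp add: cap_right_def)
  also have "\<dots> = (\<r> (Cod C f) \<cdot> f \<otimes> \<one> \<I>) \<cdot> \<one> (Dom C f) \<otimes> e"
    using assms by (simp add: TensA_Comp')
  also have "\<dots> = f \<cdot> cap_right C e (Dom C f)"
    using assms RUnit_nat[of f "Dom C f" "Cod C f"] by (simp add: cap_right_def hom_iff)
  finally show ?thesis .
qed

lemma hopf_arrow_action:
  assumes "hopf_arrow M N f"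
  shows "action C B N \<cdot> f \<otimes> \<one> A = f \<cdot> action C B M"
proof -
  note d [simp] = hopf_arrowD(1-5)[OF assms]
  have "action C B N \<cdot> f \<otimes> \<one> A = cap_right C e (HObj N) \<cdot> (Ac2 N \<cdot> f \<otimes> \<one> A)"
    by (simp add: action_def)
  also have "\<dots> = (cap_right C e (HObj N) \<cdot> f \<otimes> \<one> A) \<cdot> Ac2 M"
    by (simp add: hopf_arrowD(8)[OF assms])
  also have "\<dots> = f \<cdot> action C B M"
    using cap_right_nat[of f] by (simp add: action_def)
  finally show ?thesis .
qed

lemma hopf_arrowI:
  assumes "hopf_module C Q B M" "hopf_module C Q B N" "f \<in> hom C (HObj M) (HObj N)"
    "Co1 N \<cdot> f \<otimes> \<one> A = f \<otimes> \<one> A \<cdot> Co1 M" "action C B N \<cdot> f \<otimes> \<one> A = f \<cdot> action C B M"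
  shows "hopf_arrow M N f"
  using assms comodule_morphismI module_morphismI by (simp add: hopf_arrow_def)

lemma hopf_arrow_Id: "hopf_module C Q B M \<Longrightarrow> hopf_arrow M M (\<one> (HObj M))"
  by (rule hopf_arrowI) (simp_all add: hom_iff TensA_Id)

lemma hopf_arrow_Comp:
  assumes f: "hopf_arrow M N f" and g: "hopf_arrow N K g"
  shows "hopf_arrow M K (g \<cdot> f)"
proof (rule hopf_arrowI)
  note d [simp] = hopf_arrowD(1-5)[OF f] hopf_arrowD(1-5)[OF g]
  show "hopf_module C Q B M" "hopf_module C Q B K" "g \<cdot> f \<in> hom C (HObj M) (HObj K)"
    by (simp_all add: hom_iff)
  have "Co1 K \<cdot> (g \<cdot> f) \<otimes> \<one> A = (Co1 K \<cdot> g \<otimes> \<one> A) \<cdot> f \<otimes> \<one> A"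
    by (simp add: Id_tensor_Comp)
  also have "\<dots> = g \<otimes> \<one> A \<cdot> (Co1 N \<cdot> f \<otimes> \<one> A)"
    by (simp add: hopf_arrowD(6)[OF g])
  also have "\<dots> = (g \<cdot> f) \<otimes> \<one> A \<cdot> Co1 M"
    by (simp add: hopf_arrowD(6)[OF f] Id_tensor_Comp)
  finally show "Co1 K \<cdot> (g \<cdot> f) \<otimes> \<one> A = (g \<cdot> f) \<otimes> \<one> A \<cdot> Co1 M" .
  have "action C B K \<cdot> (g \<cdot> f) \<otimes> \<one> A = (action C B K \<cdot> g \<otimes> \<one> A) \<cdot> f \<otimes> \<one> A"
    by (simp add: Id_tensor_Comp)
  also have "\<dots> = g \<cdot> (action C B N \<cdot> f \<otimes> \<one> A)"
    by (simp add: hopf_arrow_action[OF g])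
  also have "\<dots> = g \<cdot> f \<cdot> action C B M"
    by (simp add: hopf_arrow_action[OF f])
  finally show "action C B K \<cdot> (g \<cdot> f) \<otimes> \<one> A = g \<cdot> f \<cdot> action C B M" .
qed

lemma hopf_arrow_inv:
  assumes f: "hopf_arrow M N f" and iso: "is_iso C f"
  shows "hopf_arrow N M (arr_inv C f)"
proof (rule hopf_arrowI)
  note d [simp] = hopf_arrowD(1-5)[OF f] iso
  let ?g = "arr_inv C f"
  have i: "is_iso C (f \<otimes> \<one> A)" by (simp add: iso_TensA iso_Id)
  show "hopf_module C Q B N" "hopf_module C Q B M" "?g \<in> hom C (HObj N) (HObj M)"
    by (simp_all add: hom_iff)
  have g: "?g \<otimes> \<one> A \<cdot> f \<otimes> \<one> A = \<one> (HObj M \<odot> A)" "f \<otimes> \<one> A \<cdot> ?g \<otimes> \<one> A = \<one> (HObj N \<odot> A)"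
    by (simp_all add: TensA_Comp' TensA_Id)
  have "Co1 M \<cdot> ?g \<otimes> \<one> A = (?g \<otimes> \<one> A \<cdot> f \<otimes> \<one> A) \<cdot> Co1 M \<cdot> ?g \<otimes> \<one> A"
    unfolding g by simp
  also have "\<dots> = ?g \<otimes> \<one> A \<cdot> (f \<otimes> \<one> A \<cdot> Co1 M) \<cdot> ?g \<otimes> \<one> A"
    by simp
  also have "\<dots> = ?g \<otimes> \<one> A \<cdot> (Co1 N \<cdot> f \<otimes> \<one> A) \<cdot> ?g \<otimes> \<one> A"
    unfolding hopf_arrowD(6)[OF f] ..
  also have "\<dots> = ?g \<otimes> \<one> A \<cdot> Co1 N \<cdot> (f \<otimes> \<one> A \<cdot> ?g \<otimes> \<one> A)"
    by simp
  also have "\<dots> = ?g \<otimes> \<one> A \<cdot> Co1 N"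
    unfolding g by simp
  finally show "Co1 M \<cdot> ?g \<otimes> \<one> A = ?g \<otimes> \<one> A \<cdot> Co1 N" .
  have "action C B M \<cdot> ?g \<otimes> \<one> A = ?g \<cdot> (f \<cdot> action C B M) \<cdot> ?g \<otimes> \<one> A"
    by simp
  also have "\<dots> = ?g \<cdot> (action C B N \<cdot> f \<otimes> \<one> A) \<cdot> ?g \<otimes> \<one> A"
    unfolding hopf_arrow_action[OF f] ..
  also have "\<dots> = ?g \<cdot> action C B N \<cdot> (f \<otimes> \<one> A \<cdot> ?g \<otimes> \<one> A)"
    by simp
  also have "\<dots> = ?g \<cdot> action C B N"
    unfolding g by simp
  finally show "action C B M \<cdot> ?g \<otimes> \<one> A = ?g \<cdot> action C B N" .
qed

lemma HC_simps [simp]: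
  "M \<in> Obj HC \<longleftrightarrow> hopf_module C Q B M"
  "F \<in> Arr HC \<longleftrightarrow> (case F of (M, f, N) \<Rightarrow> hopf_arrow M N f)"
  "Dom HC (M, f, N) = M" "Cod HC (M, f, N) = N"
  "\<one>\<^bsub>HC\<^esub> M = (M, \<one> (HObj M), M)"
  "(K, g, L) \<cdot>\<^bsub>HC\<^esub> (M, f, N) = (M, g \<cdot> f, L)"
  by (auto simp: hopf_cat_def hopf_arrow_def split: prod.splits)

lemma HC_hom: "F \<in> hom HC M N \<longleftrightarrow> (\<exists>f. F = (M, f, N) \<and> hopf_arrow M N f)"
  by (cases F) (auto simp: hom_def)

lemma HC_category: "category HC"
proof
  fix F assume "F \<in> Arr HC"
  then show "Dom HC F \<in> Obj HC" "Cod HC F \<in> Obj HC"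
    by (cases F; simp add: hopf_arrowD)+
next
  fix F G H M N K L
  show "M \<in> Obj HC \<Longrightarrow> \<one>\<^bsub>HC\<^esub> M \<in> hom HC M M" by (simp add: HC_hom hopf_arrow_Id)
  assume "F \<in> hom HC M N"
  then obtain f where f: "F = (M, f, N)" "hopf_arrow M N f" by (auto simp: HC_hom)
  show "F \<cdot>\<^bsub>HC\<^esub> \<one>\<^bsub>HC\<^esub> M = F" "\<one>\<^bsub>HC\<^esub> N \<cdot>\<^bsub>HC\<^esub> F = F"
    using f(1) hopf_arrowD(3-5)[OF f(2)] by simp_all
  assume "G \<in> hom HC N K"
  then obtain g where g: "G = (N, g, K)" "hopf_arrow N K g" by (auto simp: HC_hom)
  show "G \<cdot>\<^bsub>HC\<^esub> F \<in> hom HC M K" using f g by (auto simp: HC_hom intro: hopf_arrow_Comp)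
  assume "H \<in> hom HC K L"
  then obtain h where h: "H = (K, h, L)" "hopf_arrow K L h" by (auto simp: HC_hom)
  show "H \<cdot>\<^bsub>HC\<^esub> G \<cdot>\<^bsub>HC\<^esub> F = H \<cdot>\<^bsub>HC\<^esub> (G \<cdot>\<^bsub>HC\<^esub> F)"
    using f(1) g(1) h(1) hopf_arrowD(3-5)[OF f(2)] hopf_arrowD(3-5)[OF g(2)] hopf_arrowD(3-5)[OF h(2)] by simp
qed

lemma HC_iso:
  assumes "hopf_arrow M N f" "is_iso C f"
  shows "is_iso HC (M, f, N)"
proof -
  have "inverse_arrows HC (M, f, N) (N, arr_inv C f, M)"
    using assms hopf_arrow_inv[OF assms] hopf_arrowD[OF assms(1)]
    by (simp add: inverse_arrows_def HC_hom)
  then show ?thesis by (auto simp: is_iso_def)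
qed

lemma free_functor_simps [simp]:
  "FObj (free_functor C B) = free_hopf_module C B"
  "FArr (free_functor C B) f = (free_hopf_module C B (Dom C f), f \<otimes> \<one> A, free_hopf_module C B (Cod C f))"
  by (simp_all add: free_functor_def)

lemma free_hopf_arrow: "f \<in> hom C X Y \<Longrightarrow> hopf_arrow (free_hopf_module C B X) (free_hopf_module C B Y) (f \<otimes> \<one> A)"
  using free_arrow[of f X Y] free_hopf[of X] free_hopf[of Y] by (auto simp: hopf_arrow_def hom_iff)

lemma free_is_functor: "is_functor C HC (free_functor C B)"
  unfolding is_functor_def
proof (intro conjI ballI allI)
  show "category C" by unfold_locales
  show "category HC" by (fact HC_category)
next
  fix X Y Z f g assume f: "f \<in> hom C X Y"
  then show "FArr (free_functor C B) f \<in> hom HC (FObj (free_functor C B) X) (FObj (free_functor C B) Y)"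
    using free_hopf_arrow[OF f] by (auto simp: HC_hom hom_iff)
  assume "g \<in> hom C Y Z"
  then show "FArr (free_functor C B) (g \<cdot> f) = FArr (free_functor C B) g \<cdot>\<^bsub>HC\<^esub> FArr (free_functor C B) f"
    using f by (simp add: hom_iff Id_tensor_Comp)
qed (simp_all add: free_hopf FM_simps TensA_Id)

end

section \<open>Coinvariants\<close>

context closed_braided_monoidal_category
begin

section \<open>Transposition along the internal hom\<close>

context
  fixes A
  assumes A: "A \<in> Obj C"
begin

lemma ihom_simps:
  "Y \<in> Obj C \<Longrightarrow> IHomO C A Y \<in> Obj C"
  "f \<in> hom C X Y \<Longrightarrow> IHomA C A f \<in> hom C (IHomO C A X) (IHomO C A Y)"
  "X \<in> Obj C \<Longrightarrow> \<eta> A X \<in> hom C X (IHomO C A (A \<odot> X))"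
  "Y \<in> Obj C \<Longrightarrow> Ev C A Y \<in> hom C (A \<odot> IHomO C A Y) Y"
  "f \<in> hom C X Y \<Longrightarrow> g \<in> hom C Y Z \<Longrightarrow> IHomA C A (g \<cdot> f) = IHomA C A g \<cdot> IHomA C A f"
  "f \<in> hom C X Y \<Longrightarrow> \<eta> A Y \<cdot> f = IHomA C A (\<one> A \<otimes> f) \<cdot> \<eta> A X"
  "f \<in> hom C X Y \<Longrightarrow> Ev C A Y \<cdot> \<one> A \<otimes> IHomA C A f = f \<cdot> Ev C A X"
  "X \<in> Obj C \<Longrightarrow> Ev C A (A \<odot> X) \<cdot> \<one> A \<otimes> \<eta> A X = \<one> (A \<odot> X)"
  "Y \<in> Obj C \<Longrightarrow> IHomA C A (Ev C A Y) \<cdot> \<eta> A (IHomO C A Y) = \<one> (IHomO C A Y)"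
proof -
  let ?T = "tensor_functor C A" and ?H = "ihom_functor C A"
  have h: "is_functor C C ?H" and n: "is_nat_trans C C id_functor (comp_functor ?H ?T) (Coev C A)"
    "is_nat_trans C C (comp_functor ?T ?H) id_functor (Ev C A)"
    and t: "\<forall>X \<in> Obj C. Ev C A (FObj ?T X) \<cdot> FArr ?T (\<eta> A X) = \<one> (FObj ?T X)"
      "\<forall>Y \<in> Obj C. FArr ?H (Ev C A Y) \<cdot> \<eta> A (FObj ?H Y) = \<one> (FObj ?H Y)"
    using closed[OF A] unfolding is_adjunction_def by blast+
  show "Y \<in> Obj C \<Longrightarrow> IHomO C A Y \<in> Obj C"
    "f \<in> hom C X Y \<Longrightarrow> IHomA C A f \<in> hom C (IHomO C A X) (IHomO C A Y)"
    "f \<in> hom C X Y \<Longrightarrow> g \<in> hom C Y Z \<Longrightarrow> IHomA C A (g \<cdot> f) = IHomA C A g \<cdot> IHomA C A f"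
    using h by (simp_all add: is_functor_def ihom_functor_def del: Comp_simps)
  show "X \<in> Obj C \<Longrightarrow> \<eta> A X \<in> hom C X (IHomO C A (A \<odot> X))"
    "f \<in> hom C X Y \<Longrightarrow> \<eta> A Y \<cdot> f = IHomA C A (\<one> A \<otimes> f) \<cdot> \<eta> A X"
    using n(1) unfolding is_nat_trans_def id_functor_def comp_functor_def tensor_functor_def ihom_functor_def
      functor_data.simps o_apply by blast+
  show "Y \<in> Obj C \<Longrightarrow> Ev C A Y \<in> hom C (A \<odot> IHomO C A Y) Y"
    "f \<in> hom C X Y \<Longrightarrow> Ev C A Y \<cdot> \<one> A \<otimes> IHomA C A f = f \<cdot> Ev C A X"
    using n(2) unfolding is_nat_trans_def id_functor_def comp_functor_def tensor_functor_def ihom_functor_def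
      functor_data.simps o_apply by blast+
  show "X \<in> Obj C \<Longrightarrow> Ev C A (A \<odot> X) \<cdot> \<one> A \<otimes> \<eta> A X = \<one> (A \<odot> X)"
    "Y \<in> Obj C \<Longrightarrow> IHomA C A (Ev C A Y) \<cdot> \<eta> A (IHomO C A Y) = \<one> (IHomO C A Y)"
    using t by (simp_all add: tensor_functor_def ihom_functor_def)
qed

text \<open>The transpose of \<open>g\<close> under the adjunction between tensoring with
  \<open>A\<close> on the left and the internal hom.\<close>

definition cur :: "'o \<Rightarrow> 'a \<Rightarrow> 'a" where
  "cur X g = IHomA C A g \<cdot> \<eta> A X"

lemma cur_hom: "X \<in> Obj C \<Longrightarrow> g \<in> hom C (A \<odot> X) Y \<Longrightarrow> cur X g \<in> hom C X (IHomO C A Y)"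
  unfolding cur_def by (rule Comp_hom[OF ihom_simps(3) ihom_simps(2)])

lemma ev_cur:
  assumes X: "X \<in> Obj C" and g: "g \<in> hom C (A \<odot> X) Y"
  shows "Ev C A Y \<cdot> \<one> A \<otimes> cur X g = g"
proof -
  have h: "Y \<in> Obj C" "\<eta> A X \<in> Arr C" "Dom C (\<eta> A X) = X" "Cod C (\<eta> A X) = IHomO C A (A \<odot> X)"
    "IHomA C A g \<in> Arr C" "Dom C (IHomA C A g) = IHomO C A (A \<odot> X)" "Cod C (IHomA C A g) = IHomO C A Y"
    "Ev C A Y \<in> Arr C" "Dom C (Ev C A Y) = A \<odot> IHomO C A Y" "Cod C (Ev C A Y) = Y"
    "Ev C A (A \<odot> X) \<in> Arr C" "Dom C (Ev C A (A \<odot> X)) = A \<odot> IHomO C A (A \<odot> X)" "Cod C (Ev C A (A \<odot> X)) = A \<odot> X"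
    "g \<in> Arr C" "Dom C g = A \<odot> X" "Cod C g = Y"
    using g X A ihom_simps(3)[OF X] ihom_simps(2)[OF g] ihom_simps(4)[of Y] ihom_simps(4)[of "A \<odot> X"]
    by (auto simp: hom_iff)
  have "Ev C A Y \<cdot> \<one> A \<otimes> cur X g = (Ev C A Y \<cdot> \<one> A \<otimes> IHomA C A g) \<cdot> \<one> A \<otimes> \<eta> A X"
    using h X A by (simp add: cur_def Id_tensor_Comp)
  also have "\<dots> = g \<cdot> (Ev C A (A \<odot> X) \<cdot> \<one> A \<otimes> \<eta> A X)"
    unfolding ihom_simps(7)[OF g] using h X A by simp
  also have "\<dots> = g" unfolding ihom_simps(8)[OF X] using h by simp
  finally show ?thesis .
qed

lemma cur_ev:
  assumes u: "u \<in> hom C X (IHomO C A Y)" and Y: "Y \<in> Obj C"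
  shows "cur X (Ev C A Y \<cdot> \<one> A \<otimes> u) = u"
proof -
  have X: "X \<in> Obj C" using u by (auto simp: hom_iff)
  have au: "\<one> A \<otimes> u \<in> hom C (A \<odot> X) (A \<odot> IHomO C A Y)" using u A by (simp add: hom_iff)
  have I: "IHomO C A Y \<in> Obj C" by (rule ihom_simps(1)[OF Y])
  note h = ihom_simps(4)[OF Y] ihom_simps(2)[OF ihom_simps(4)[OF Y]] ihom_simps(2)[OF au] ihom_simps(3)[OF X]
    ihom_simps(3)[OF I]
  have "cur X (Ev C A Y \<cdot> \<one> A \<otimes> u) = IHomA C A (Ev C A Y) \<cdot> (IHomA C A (\<one> A \<otimes> u) \<cdot> \<eta> A X)"
    unfolding cur_def ihom_simps(5)[OF au ihom_simps(4)[OF Y]] using h by (simp add: hom_iff)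
  also have "\<dots> = (IHomA C A (Ev C A Y) \<cdot> \<eta> A (IHomO C A Y)) \<cdot> u"
    unfolding ihom_simps(6)[OF u, symmetric] using h u by (simp add: hom_iff)
  also have "\<dots> = u" unfolding ihom_simps(9)[OF Y] using u by (simp add: hom_iff)
  finally show ?thesis .
qed

lemma ev_inj:
  assumes "u \<in> hom C X (IHomO C A Y)" "u' \<in> hom C X (IHomO C A Y)" "Y \<in> Obj C"
    and "Ev C A Y \<cdot> \<one> A \<otimes> u = Ev C A Y \<cdot> \<one> A \<otimes> u'"
  shows "u = u'"
  by (metis cur_ev[OF assms(1,3)] cur_ev[OF assms(2,3)] assms(4))

lemma ev_cur_Comp:
  assumes X: "X \<in> Obj C" and g: "g \<in> hom C (A \<odot> X) Y" and f: "f \<in> hom C W X"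
  shows "Ev C A Y \<cdot> \<one> A \<otimes> (cur X g \<cdot> f) = g \<cdot> \<one> A \<otimes> f"
proof -
  have Y: "Y \<in> Obj C" using g by (auto simp: hom_iff)
  have "Ev C A Y \<cdot> \<one> A \<otimes> (cur X g \<cdot> f) = (Ev C A Y \<cdot> \<one> A \<otimes> cur X g) \<cdot> \<one> A \<otimes> f"
    using cur_hom[OF X g] f A ihom_simps(4)[OF Y] by (simp add: hom_iff Id_tensor_Comp)
  then show ?thesis unfolding ev_cur[OF X g] .
qed

text \<open>Left adjoints preserve epimorphisms: transposition moves the cancellation to
  \<open>p\<close> itself.\<close>

lemma tensor_epi:
  assumes "is_epi C p"
  shows "is_epi C (\<one> A \<otimes> p)"
proof -
  have p: "p \<in> Arr C" using assms by (simp add: is_epi_def)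
  show ?thesis
    unfolding is_epi_def
  proof (intro conjI allI ballI impI)
    show "\<one> A \<otimes> p \<in> Arr C" using p A by simp
    fix W g h
    assume gh: "g \<in> hom C (Cod C (\<one> A \<otimes> p)) W" "h \<in> hom C (Cod C (\<one> A \<otimes> p)) W"
      and eq: "g \<cdot> \<one> A \<otimes> p = h \<cdot> \<one> A \<otimes> p"
    let ?X = "Cod C p"
    have X: "?X \<in> Obj C" and ph: "p \<in> hom C (Dom C p) ?X" using p by (simp_all add: hom_iff)
    have g: "g \<in> hom C (A \<odot> ?X) W" and h: "h \<in> hom C (A \<odot> ?X) W" using gh p A by simp_all
    have W: "W \<in> Obj C" using g by (auto simp: hom_iff)
    have "cur ?X g \<cdot> p = cur ?X h \<cdot> p"
      by (rule ev_inj[OF Comp_hom[OF ph cur_hom[OF X g]] Comp_hom[OF ph cur_hom[OF X h]] W])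
        (simp only: ev_cur_Comp[OF X g ph] ev_cur_Comp[OF X h ph] eq)
    then have "cur ?X g = cur ?X h"
      by (rule epiD[OF assms cur_hom[OF X g] cur_hom[OF X h]])
    then show "g = h" by (metis ev_cur[OF X g] ev_cur[OF X h])
  qed
qed

end

end

lemma is_functor_comp: "is_functor K L H \<Longrightarrow> is_functor L N J \<Longrightarrow> is_functor K N (comp_functor J H)"
  unfolding is_functor_def comp_functor_def by simp blast

lemma is_functor_id: "category D \<Longrightarrow> is_functor D D id_functor"
  unfolding is_functor_def id_functor_def by (simp add: category.Id_hom)

section \<open>The functor of coinvariants and the equivalence\<close>

locale hopf_coinvariants = closed_braided_monoidal_category C + regular_hopf_monoid C Q B
  for C :: "('o, 'a) cbmc_data" (structure) and Q :: "'a set" and B :: "('o, 'a) mult_data" +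
  fixes Vc :: "('o, 'a) hopf_data \<Rightarrow> 'o" and p i :: "('o, 'a) hopf_data \<Rightarrow> 'a"
  assumes fact: "hopf_module C Q B V \<Longrightarrow> coinvariants_factorization C B V (Vc V) (p V) (i V)"
begin

abbreviation G where "G \<equiv> coinvariants_functor C Vc p"
abbreviation F where "F \<equiv> free_functor C B"
abbreviation (input) fm where "fm \<equiv> free_hopf_module C B"

lemma fact_simps [simp]:
  assumes "hopf_module C Q B M"
  shows "p M \<in> Arr C" "Dom C (p M) = HObj M" "Cod C (p M) = Vc M" "Vc M \<in> Obj C"
    "i M \<in> Arr C" "Dom C (i M) = Vc M" "Cod C (i M) = IHomO C A (HObj M)"
    "is_strong_epi C (p M)" "is_mono C (i M)" "is_epi C (p M)"
proof -
  show h: "p M \<in> Arr C" "Dom C (p M) = HObj M" "Cod C (p M) = Vc M"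
    "i M \<in> Arr C" "Dom C (i M) = Vc M" "Cod C (i M) = IHomO C A (HObj M)"
    "is_strong_epi C (p M)" "is_mono C (i M)" "is_epi C (p M)"
    using fact[OF assms]
    by (auto simp: coinvariants_factorization_def hom_iff is_pure_mono_def is_strong_epi_def)
  show "Vc M \<in> Obj C" using Cod_Obj[OF h(1)] h(3) by simp
qed

text \<open>The transpose of the map that is factorized: \<open>a \<otimes> x \<mapsto> x\<^sub>1 S(x\<^sub>2) a\<close>.\<close>

definition proj :: "('o, 'a) hopf_data \<Rightarrow> 'a" where
  "proj M = action C B M \<cdot> arr_inv C (Co1 M) \<cdot> \<c> A (HObj M)"

lemma proj_hom:
  assumes "hopf_module C Q B M"
  shows "proj M \<in> hom C (A \<odot> HObj M) (HObj M)"
  using assms by (simp add: proj_def hom_iff)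

lemma i_p:
  assumes M: "hopf_module C Q B M"
  shows "i M \<cdot> p M = cur A (HObj M) (proj M)"
proof -
  let ?V = "HObj M"
  note s [simp] = hopf_module_simps[OF M]
  have h: "action C B M \<in> hom C (?V \<odot> A) ?V" "arr_inv C (Co1 M) \<in> hom C (?V \<odot> A) (?V \<odot> A)"
    "\<c> A ?V \<in> hom C (A \<odot> ?V) (?V \<odot> A)" "action C B M \<cdot> arr_inv C (Co1 M) \<in> hom C (?V \<odot> A) ?V"
    by (simp_all add: hom_iff)
  have "i M \<cdot> p M = coinvariants_map C B M"
    using fact[OF M] by (simp add: coinvariants_factorization_def)
  also have "\<dots> = cur A ?V (proj M)"
    unfolding coinvariants_map_def cur_def[OF A_Obj] proj_def Let_def
      ihom_simps(5)[OF A_Obj h(3,4)] ihom_simps(5)[OF A_Obj h(2,1)] ..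
  finally show ?thesis .
qed

lemma ev_i_p:
  assumes M: "hopf_module C Q B M" and f: "f \<in> hom C X (HObj M)"
  shows "Ev C A (HObj M) \<cdot> \<one> A \<otimes> (i M \<cdot> p M \<cdot> f) = proj M \<cdot> \<one> A \<otimes> f"
  unfolding i_p[OF M] using M by (intro ev_cur_Comp[OF A_Obj _ proj_hom[OF M] f]) simp

text \<open>\<open>i\<close> is monic and transposition is injective, so \<open>p\<close> identifies
  whatever the projection identifies.\<close>

lemma p_equalizes:
  assumes M: "hopf_module C Q B M" and f: "f \<in> hom C X (HObj M)" and g: "g \<in> hom C X (HObj M)"
    and eq: "proj M \<cdot> \<one> A \<otimes> f = proj M \<cdot> \<one> A \<otimes> g"
  shows "p M \<cdot> f = p M \<cdot> g"
proof -
  have X: "X \<in> Obj C" using f by (auto simp: hom_iff)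
  note [simp] = hopf_module_simps[OF M] fact_simps[OF M]
  have "i M \<cdot> p M \<cdot> f = i M \<cdot> p M \<cdot> g"
    by (rule ev_inj[OF A_Obj _ _ _ trans[OF ev_i_p[OF M f] trans[OF eq ev_i_p[OF M g, symmetric]]]])
      (use f g in \<open>simp_all add: hom_iff\<close>)
  then have "i M \<cdot> (p M \<cdot> f) = i M \<cdot> (p M \<cdot> g)" using f g by (simp add: hom_iff)
  then show ?thesis
    by (rule monoD[OF fact_simps(9)[OF M], rotated 2]) (use f g in \<open>simp_all add: hom_iff\<close>)
qed

text \<open>By \<open>p_equalizes\<close> this reduces to \<open>E(x a) = E(x) e(a)\<close>, which
  is \<open>projection_action\<close> up to the crossing that brings \<open>A\<close> to the
  front.\<close>

lemma p_action:
  assumes M: "hopf_module C Q B M"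
  shows "p M \<cdot> action C B M = p M \<cdot> cap_right C e (HObj M)"
proof (rule p_equalizes[OF M])
  interpret M: hopf_bimodule C Q B M by unfold_locales (fact M)
  let ?V = "HObj M"
  have v1 [simp]: "is_iso C (Co1 M)" by (rule M.co.v1_iso)
  show "action C B M \<in> hom C (?V \<odot> A) ?V" "cap_right C e ?V \<in> hom C (?V \<odot> A) ?V"
    using M by (simp_all add: hom_iff)
  have a: "bd A ?V \<star> [A] \<lhd> M.al = M.al \<rhd> [A] \<star> [?V] \<lhd> bd A A \<star> bd A ?V \<rhd> [A]"
    unfolding M.mo.al_def by (rule slide21(2)[symmetric]) simp_all
  have b: "[?V] \<lhd> ep \<rhd> [A] \<star> [?V] \<lhd> bd A A = [?V, A] \<lhd> ep"
    using whisk_eq[OF ep_slide(2)[OF A_Obj, of True], of "[?V]" "[]"] by simp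
  have c: "[?V, A] \<lhd> ep \<star> bd A ?V \<rhd> [A] = bd A ?V \<star> [A, ?V] \<lhd> ep"
    using interchange[of "[]" "bd A ?V" "[]" ep "[]"] by simp
  have d: "M.al \<star> M.ri \<star> bd A ?V \<star> [A] \<lhd> M.al = M.al \<star> M.ri \<star> bd A ?V \<star> [A] \<lhd> ([?V] \<lhd> ep)"
    by (simp add: a ext3[OF M.projection_action] ext2[OF b] c)
  define v where "v = action C B M"
  define v1 where "v1 = arr_inv C (Co1 M)"
  have [simp]: "v \<in> Arr C" "Dom C v = ?V \<odot> A" "Cod C v = ?V"
    "v1 \<in> Arr C" "Dom C v1 = ?V \<odot> A" "Cod C v1 = ?V \<odot> A"
    using M by (simp_all add: v_def v1_def)
  have al: "M.al = str [?V, A] [?V] v" and ri: "M.ri = str [?V, A] [?V, A] v1"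
    by (simp_all add: M.mo.al_def M.ri_def v_def v1_def M.action_eq)
  show "proj M \<cdot> \<one> A \<otimes> action C B M = proj M \<cdot> \<one> A \<otimes> cap_right C e ?V"
    unfolding proj_def v_def[symmetric] v1_def[symmetric]
  \<comment> \<open>\<open>\<one> A \<otimes> v\<close> starts at a product bracketed to the right,
    whereas lists are bracketed to the left. The associator is inserted before passing to
    strands.\<close>
  proof (rule epiD[OF iso_epi[OF Assoc_iso[of A ?V A]], rotated 5])
    show "v \<cdot> v1 \<cdot> \<c> A ?V \<cdot> \<one> A \<otimes> v \<cdot> \<a> A ?V A = v \<cdot> v1 \<cdot> \<c> A ?V \<cdot> \<one> A \<otimes> cap_right C e ?V \<cdot> \<a> A ?V A"
      by (rule str_faithful[of "[A, ?V, A]" "[?V]"])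
        (use d in \<open>simp_all add: al ri to_str del: swhisk_swhisk\<close>)
  qed (simp_all add: hom_iff)
qed

text \<open>The braiding carries this to tensoring on the left, where \<open>tensor_epi\<close>
  applies.\<close>

lemma p_tensor_epi:
  assumes "is_epi C q"
  shows "is_epi C (q \<otimes> \<one> A)"
proof -
  have q: "q \<in> Arr C" using assms by (simp add: is_epi_def)
  have eq: "q \<otimes> \<one> A \<cdot> \<c> A (Dom C q) = \<c> A (Cod C q) \<cdot> \<one> A \<otimes> q"
    using Braid_nat[of "\<one> A" A A q "Dom C q" "Cod C q"] q by (simp add: hom_iff)
  have q1: "is_epi C (\<one> A \<otimes> q)" by (rule tensor_epi[OF A_Obj assms])
  show ?thesis
    unfolding is_epi_def
  proof (intro conjI allI ballI impI)
    show "q \<otimes> \<one> A \<in> Arr C" using q by simp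
    fix W g h assume g: "g \<in> hom C (Cod C (q \<otimes> \<one> A)) W" and h: "h \<in> hom C (Cod C (q \<otimes> \<one> A)) W"
      and gh: "g \<cdot> q \<otimes> \<one> A = h \<cdot> q \<otimes> \<one> A"
    have e: "k \<cdot> \<c> A (Cod C q) \<cdot> \<one> A \<otimes> q = k \<cdot> q \<otimes> \<one> A \<cdot> \<c> A (Dom C q)"
      if "k \<in> hom C (Cod C (q \<otimes> \<one> A)) W" for k
      using that q eq by (simp add: hom_iff)
    have "g \<cdot> \<c> A (Cod C q) \<cdot> \<one> A \<otimes> q = h \<cdot> \<c> A (Cod C q) \<cdot> \<one> A \<otimes> q"
      unfolding e[OF g] e[OF h] gh ..
    then have "g \<cdot> \<c> A (Cod C q) = h \<cdot> \<c> A (Cod C q)"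
      by (rule epiD[OF q1, rotated 2]) (use g h q in \<open>simp_all add: hom_iff\<close>)
    then show "g = h"
      by (rule epiD[OF iso_epi[OF Braid_iso], rotated 4]) (use g h q in \<open>simp_all add: hom_iff\<close>)
  qed
qed

text \<open>The inverse of the counit of the equivalence: \<open>x a \<mapsto> p(x\<^sub>1) \<otimes> x\<^sub>2 a\<close>.\<close>

definition comparison :: "('o, 'a) hopf_data \<Rightarrow> 'a" where
  "comparison M = (SOME \<theta>. \<theta> \<in> hom C (HObj M) (Vc M \<odot> A) \<and> \<theta> \<cdot> action C B M = p M \<otimes> \<one> A \<cdot> Co1 M)"

lemma comparison:
  assumes M: "hopf_module C Q B M"
  shows "comparison M \<in> hom C (HObj M) (Vc M \<odot> A)" "comparison M \<cdot> action C B M = p M \<otimes> \<one> A \<cdot> Co1 M"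
proof -
  interpret M: hopf_bimodule C Q B M by unfold_locales (fact M)
  have "p M \<in> hom C (HObj M) (Vc M)" "p M \<cdot> M.mo.alC = p M \<cdot> cap_right C e (HObj M)"
    using M p_action[OF M] by (simp_all add: hom_iff M.action_eq)
  then obtain \<theta> where "\<theta> \<in> hom C (HObj M) (Vc M \<odot> A)" "\<theta> \<cdot> M.mo.alC = p M \<otimes> \<one> A \<cdot> Co1 M"
    by (rule M.comparison_exists)
  then have "\<exists>\<theta>. \<theta> \<in> hom C (HObj M) (Vc M \<odot> A) \<and> \<theta> \<cdot> action C B M = p M \<otimes> \<one> A \<cdot> Co1 M"
    by (auto simp: M.action_eq)
  from someI_ex[OF this]
  show "comparison M \<in> hom C (HObj M) (Vc M \<odot> A)" "comparison M \<cdot> action C B M = p M \<otimes> \<one> A \<cdot> Co1 M"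
    by (simp_all add: comparison_def)
qed

lemma comparison_hopf:
  assumes M: "hopf_module C Q B M"
  shows "hopf_arrow M (fm (Vc M)) (comparison M)"
proof -
  interpret M: hopf_bimodule C Q B M by unfold_locales (fact M)
  have p: "p M \<in> hom C (HObj M) (Vc M)" "p M \<cdot> M.mo.alC = p M \<cdot> cap_right C e (HObj M)"
    using M p_action[OF M] by (simp_all add: hom_iff M.action_eq)
  note c = comparison[OF M, unfolded M.action_eq]
  have U: "Vc M \<in> Obj C" using M by simp
  show ?thesis
  proof (rule hopf_arrowI)
    show "Co1 (fm (Vc M)) \<cdot> comparison M \<otimes> \<one> A = comparison M \<otimes> \<one> A \<cdot> Co1 M"
      using M.comparison_coaction[OF p c] by (simp add: FM_simps[OF U])
    show "action C B (fm (Vc M)) \<cdot> comparison M \<otimes> \<one> A = comparison M \<cdot> action C B M"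
      using M.comparison_action[OF p c] by (simp add: action_free[OF U] M.action_eq)
  qed (use M U c in \<open>simp_all add: free_hopf FM_simps\<close>)
qed

lemma comparison_iso:
  assumes M: "hopf_module C Q B M"
  shows "is_iso C (comparison M)"
proof -
  let ?V = "HObj M" and ?U = "Vc M" and ?\<theta> = "comparison M" and ?v = "action C B M"
  note [simp] = hopf_module_simps[OF M] fact_simps[OF M]
  note th = comparison[OF M]
  have th' [simp]: "?\<theta> \<in> Arr C" "Dom C ?\<theta> = ?V" "Cod C ?\<theta> = ?U \<odot> A"
    using th(1) by (auto simp: hom_iff)
  have ev [simp]: "Ev C A ?V \<in> Arr C" "Dom C (Ev C A ?V) = A \<odot> IHomO C A ?V" "Cod C (Ev C A ?V) = ?V"
    using ihom_simps(4)[OF A_Obj hopf_module_simps(1)[OF M]] by (auto simp: hom_iff)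
  \<comment> \<open>The transpose of \<open>i\<close>, with \<open>A\<close> moved to the right: in
    elements \<open>p(x) \<otimes> a \<mapsto> x\<^sub>1 S(x\<^sub>2) a\<close>.\<close>
  define \<psi> where "\<psi> = Ev C A ?V \<cdot> \<one> A \<otimes> i M \<cdot> arr_inv C (\<c> A ?U)"
  have psi [simp]: "\<psi> \<in> Arr C" "Dom C \<psi> = ?U \<odot> A" "Cod C \<psi> = ?V"
    by (simp_all add: \<psi>_def)
  have nat: "p M \<otimes> \<one> A \<cdot> \<c> A ?V = \<c> A ?U \<cdot> \<one> A \<otimes> p M"
    using Braid_nat[of "\<one> A" A A "p M" ?V ?U] by (simp add: hom_iff)
  have "\<psi> \<cdot> p M \<otimes> \<one> A \<cdot> \<c> A ?V = \<psi> \<cdot> (\<c> A ?U \<cdot> \<one> A \<otimes> p M)"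
    using nat by simp
  also have "\<dots> = Ev C A ?V \<cdot> \<one> A \<otimes> (i M \<cdot> p M \<cdot> \<one> ?V)"
    by (simp add: \<psi>_def Id_tensor_Comp)
  also have "\<dots> = proj M \<cdot> \<one> A \<otimes> \<one> ?V"
    by (rule ev_i_p[OF M]) (simp add: hom_iff)
  also have "\<dots> = ?v \<cdot> arr_inv C (Co1 M) \<cdot> \<c> A ?V"
    by (simp add: proj_def TensA_Id)
  finally have "\<psi> \<cdot> p M \<otimes> \<one> A = ?v \<cdot> arr_inv C (Co1 M)"
    by (rule epiD[OF iso_epi[OF Braid_iso], rotated 4]) (simp_all add: hom_iff)
  then have "\<psi> \<cdot> p M \<otimes> \<one> A \<cdot> Co1 M = ?v \<cdot> arr_inv C (Co1 M) \<cdot> Co1 M" by (simp only:)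
  then have psi_p: "\<psi> \<cdot> (p M \<otimes> \<one> A \<cdot> Co1 M) = ?v" by simp
  \<comment> \<open>\<open>?\<theta>\<close> and \<open>\<psi>\<close> exchange the epimorphisms
    \<open>v\<close> and \<open>(p \<otimes> 1) v\<^sup>1\<close>, both starting at
    \<open>V \<odot> A\<close>; hence they are mutually inverse.\<close>
  have "\<psi> \<cdot> ?\<theta> \<cdot> ?v = \<one> ?V \<cdot> ?v"
    using th(2) psi_p by simp
  then have 1: "\<psi> \<cdot> ?\<theta> = \<one> ?V"
    by (rule epiD[OF Q_epi[OF hopf_module_simps(17)[OF M]], rotated 2]) (simp_all add: hom_iff)
  have epi: "is_epi C (p M \<otimes> \<one> A)" by (rule p_tensor_epi) simp
  have "?\<theta> \<cdot> \<psi> \<cdot> p M \<otimes> \<one> A \<cdot> Co1 M = \<one> (?U \<odot> A) \<cdot> p M \<otimes> \<one> A \<cdot> Co1 M"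
    using th(2) psi_p by simp
  then have "?\<theta> \<cdot> \<psi> \<cdot> p M \<otimes> \<one> A = \<one> (?U \<odot> A) \<cdot> p M \<otimes> \<one> A"
    by (rule epiD[OF iso_epi[OF hopf_module_simps(18)[OF M]], rotated 2]) (simp_all add: hom_iff)
  then have 2: "?\<theta> \<cdot> \<psi> = \<one> (?U \<odot> A)"
    by (rule epiD[OF epi, rotated 2]) (simp_all add: hom_iff)
  have "inverse_arrows C ?\<theta> \<psi>"
    using 1 2 by (simp add: inverse_arrows_def hom_iff)
  then show ?thesis by (auto simp: is_iso_def)
qed

lemma proj_nat:
  assumes h: "hopf_arrow M N h"
  shows "proj N \<cdot> \<one> A \<otimes> h = h \<cdot> proj M"
proof -
  note M = hopf_arrowD(1)[OF h] and N = hopf_arrowD(2)[OF h]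
  note [simp] = hopf_arrowD(3-5)[OF h] hopf_module_simps[OF M] hopf_module_simps[OF N]
  let ?V = "HObj M" and ?W = "HObj N"
  have a: "\<c> A ?W \<cdot> \<one> A \<otimes> h = h \<otimes> \<one> A \<cdot> \<c> A ?V"
    using Braid_nat[of "\<one> A" A A h ?V ?W] by (simp add: hom_iff)
  have "arr_inv C (Co1 N) \<cdot> h \<otimes> \<one> A \<cdot> Co1 M = arr_inv C (Co1 N) \<cdot> (Co1 N \<cdot> h \<otimes> \<one> A)"
    using hopf_arrowD(6)[OF h] by simp
  also have "\<dots> = h \<otimes> \<one> A \<cdot> arr_inv C (Co1 M) \<cdot> Co1 M" by simp
  finally have b: "arr_inv C (Co1 N) \<cdot> h \<otimes> \<one> A = h \<otimes> \<one> A \<cdot> arr_inv C (Co1 M)"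
    by (rule epiD[OF iso_epi[OF hopf_module_simps(18)[OF M]], rotated 2]) (simp_all add: hom_iff)
  have "proj N \<cdot> \<one> A \<otimes> h = action C B N \<cdot> (arr_inv C (Co1 N) \<cdot> h \<otimes> \<one> A) \<cdot> \<c> A ?V"
    by (simp add: proj_def a)
  also have "\<dots> = (action C B N \<cdot> h \<otimes> \<one> A) \<cdot> (arr_inv C (Co1 M) \<cdot> \<c> A ?V)"
    unfolding b by simp
  also have "\<dots> = h \<cdot> proj M"
    unfolding hopf_arrow_action[OF h] by (simp add: proj_def)
  finally show ?thesis .
qed

text \<open>Naturality of the projection makes a commutative square of the two factorizations. Its
  diagonal, from the strong epimorphism \<open>p M\<close> to the monomorphism \<open>i N\<close>,
  is the arrow sought.\<close>

lemma coinvariants_arrow: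
  assumes h: "hopf_arrow M N h"
  shows "\<exists>!k. k \<in> hom C (Vc M) (Vc N) \<and> k \<cdot> p M = p N \<cdot> h"
proof -
  note M = hopf_arrowD(1)[OF h] and N = hopf_arrowD(2)[OF h]
  note [simp] = hopf_arrowD(3-5)[OF h] hopf_module_simps[OF M] hopf_module_simps[OF N] fact_simps[OF M] fact_simps[OF N]
  let ?V = "HObj M" and ?W = "HObj N"
  have hh: "h \<in> hom C ?V ?W" by (simp add: hom_iff)
  have V: "?V \<in> Obj C" and W: "?W \<in> Obj C" by simp_all
  have H: "IHomA C A h \<in> Arr C" "Dom C (IHomA C A h) = IHomO C A ?V" "Cod C (IHomA C A h) = IHomO C A ?W"
    "Ev C A ?V \<in> Arr C" "Dom C (Ev C A ?V) = A \<odot> IHomO C A ?V" "Cod C (Ev C A ?V) = ?V"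
    "Ev C A ?W \<in> Arr C" "Dom C (Ev C A ?W) = A \<odot> IHomO C A ?W" "Cod C (Ev C A ?W) = ?W"
    using ihom_simps(2)[OF A_Obj hh] ihom_simps(4)[OF A_Obj V] ihom_simps(4)[OF A_Obj W] by (auto simp: hom_iff)
  have sq: "i N \<cdot> p N \<cdot> h = IHomA C A h \<cdot> i M \<cdot> p M"
  proof (rule ev_inj[OF A_Obj])
    have "Ev C A ?W \<cdot> \<one> A \<otimes> (IHomA C A h \<cdot> i M \<cdot> p M) = (Ev C A ?W \<cdot> \<one> A \<otimes> IHomA C A h) \<cdot> \<one> A \<otimes> (i M \<cdot> p M \<cdot> \<one> ?V)"
      using H by (simp add: Id_tensor_Comp)
    also have "\<dots> = h \<cdot> (Ev C A ?V \<cdot> \<one> A \<otimes> (i M \<cdot> p M \<cdot> \<one> ?V))"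
      unfolding ihom_simps(7)[OF A_Obj hh] using H by simp
    also have "\<dots> = h \<cdot> (proj M \<cdot> \<one> A \<otimes> \<one> ?V)"
      by (subst ev_i_p[OF M]) (simp_all add: hom_iff)
    also have "\<dots> = proj N \<cdot> \<one> A \<otimes> h"
      using proj_hom[OF M] proj_nat[OF h] by (simp add: hom_iff TensA_Id)
    also have "\<dots> = Ev C A ?W \<cdot> \<one> A \<otimes> (i N \<cdot> p N \<cdot> h)"
      by (rule ev_i_p[OF N hh, symmetric])
    finally show "Ev C A ?W \<cdot> \<one> A \<otimes> (i N \<cdot> p N \<cdot> h) = Ev C A ?W \<cdot> \<one> A \<otimes> (IHomA C A h \<cdot> i M \<cdot> p M)" ..
  qed (use H in \<open>simp_all add: hom_iff\<close>)
  obtain d where "d \<in> hom C (Cod C (p M)) (Dom C (i N))" "d \<cdot> p M = p N \<cdot> h"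
    by (rule strong_epi_diagonal[OF fact_simps(8)[OF M] fact_simps(9)[OF N], of "p N \<cdot> h" "IHomA C A h \<cdot> i M"])
      (use sq H in \<open>simp_all add: hom_iff\<close>)
  then have d: "d \<in> hom C (Vc M) (Vc N)" "d \<cdot> p M = p N \<cdot> h" by simp_all
  show ?thesis
  proof (rule ex1I)
    show "d \<in> hom C (Vc M) (Vc N) \<and> d \<cdot> p M = p N \<cdot> h" using d by blast
    fix k assume "k \<in> hom C (Vc M) (Vc N) \<and> k \<cdot> p M = p N \<cdot> h"
    then show "k = d" using d epiD[OF fact_simps(10)[OF M], of k "Vc N" d] by simp
  qed
qed

lemma G_simps [simp]: "FObj G = Vc" "FArr G (M, h, N) = (THE k. k \<in> hom C (Vc M) (Vc N) \<and> k \<cdot> p M = p N \<cdot> h)"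
  by (simp_all add: coinvariants_functor_def)

lemma G_arrow:
  assumes h: "hopf_arrow M N h"
  shows "FArr G (M, h, N) \<in> hom C (Vc M) (Vc N)" and "FArr G (M, h, N) \<cdot> p M = p N \<cdot> h"
    and "\<lbrakk>k \<in> hom C (Vc M) (Vc N); k \<cdot> p M = p N \<cdot> h\<rbrakk> \<Longrightarrow> FArr G (M, h, N) = k"
  unfolding G_simps(2)
  using theI'[OF coinvariants_arrow[OF h]] the1_equality[OF coinvariants_arrow[OF h]] by blast+

lemma G_is_functor: "is_functor HC C G"
  unfolding is_functor_def
proof (intro conjI ballI allI)
  show "category C" by unfold_locales
  show "category HC" by (fact HC_category)
  fix M assume "M \<in> Obj HC"
  then have M: "hopf_module C Q B M" by simp
  show "FObj G M \<in> Obj C" using M by simp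
  show "FArr G (\<one>\<^bsub>HC\<^esub> M) = \<one> (FObj G M)"
    unfolding HC_simps by (rule trans[OF G_arrow(3)[OF hopf_arrow_Id[OF M]]]) (use M in \<open>simp_all add: hom_iff\<close>)
next
  fix M N K Fh Gk assume "Fh \<in> hom HC M N"
  then obtain h where h: "Fh = (M, h, N)" "hopf_arrow M N h" by (auto simp: HC_hom)
  show "FArr G Fh \<in> hom C (FObj G M) (FObj G N)" using G_arrow(1)[OF h(2)] h(1) by simp
  assume "Gk \<in> hom HC N K"
  then obtain k where k: "Gk = (N, k, K)" "hopf_arrow N K k" by (auto simp: HC_hom)
  note M = hopf_arrowD(1)[OF h(2)] and N = hopf_arrowD(2)[OF h(2)] and K = hopf_arrowD(2)[OF k(2)]
  note s = hopf_arrowD(3-5)[OF h(2)] hopf_arrowD(3-5)[OF k(2)] fact_simps(1-4)[OF M] fact_simps(1-4)[OF N] fact_simps(1-4)[OF K]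
  note gh = G_arrow(1,2)[OF h(2)] and gk = G_arrow(1,2)[OF k(2)]
  have "FArr G (M, k \<cdot> h, K) = FArr G (N, k, K) \<cdot> FArr G (M, h, N)"
  proof (rule G_arrow(3)[OF hopf_arrow_Comp[OF h(2) k(2)]])
    show "FArr G (N, k, K) \<cdot> FArr G (M, h, N) \<in> hom C (Vc M) (Vc K)"
      by (rule Comp_hom[OF gh(1) gk(1)])
    have "FArr G (N, k, K) \<cdot> FArr G (M, h, N) \<cdot> p M = FArr G (N, k, K) \<cdot> (FArr G (M, h, N) \<cdot> p M)"
      using gh(1) gk(1) s by (simp del: G_simps add: hom_iff)
    also have "\<dots> = (FArr G (N, k, K) \<cdot> p N) \<cdot> h"
      unfolding gh(2) using gk(1) s by (simp del: G_simps add: hom_iff)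
    also have "\<dots> = p K \<cdot> (k \<cdot> h)" unfolding gk(2) using s by simp
    finally show "FArr G (N, k, K) \<cdot> FArr G (M, h, N) \<cdot> p M = p K \<cdot> (k \<cdot> h)" .
  qed
  then show "FArr G (Gk \<cdot>\<^bsub>HC\<^esub> Fh) = FArr G Gk \<cdot> FArr G Fh"
    unfolding h(1) k(1) HC_simps .
qed

text \<open>On a free module the two strong epi-mono factorizations of the projection are compared.\<close>

lemma free_coinvariants:
  assumes X: "X \<in> Obj C"
  shows "\<exists>k. k \<in> hom C (Vc (fm X)) X \<and> is_iso C k \<and> k \<cdot> p (fm X) = cap_right C e X"
proof -
  let ?M = "fm X" and ?q = "cap_right C e X" and ?W = "X \<odot> A"
  have M: "hopf_module C Q B ?M" by (rule free_hopf[OF X])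
  note [simp] = FM_simps[OF X] X
  note s [simp] = hopf_module_simps[OF M] fact_simps[OF M]
  have q: "?q \<in> Q" "is_strong_epi C ?q" "is_epi C ?q" using X by (simp_all add: Q_cap Q_strong Q_epi)
  have "proj ?M = ?q \<otimes> \<one> A \<cdot> (Co1 ?M \<cdot> arr_inv C (Co1 ?M)) \<cdot> \<c> A ?W"
    using s by (simp add: proj_def free_projection[OF X] del: FM_simps)
  also have "\<dots> = ?q \<otimes> \<one> A \<cdot> \<c> A ?W" using s(18) by simp
  also have "\<dots> = \<c> A X \<cdot> \<one> A \<otimes> ?q"
    using Braid_nat[of "\<one> A" A A ?q ?W X] by (simp add: hom_iff)
  finally have pr: "proj ?M = \<c> A X \<cdot> \<one> A \<otimes> ?q" .
  have cX: "\<c> A X \<in> hom C (A \<odot> X) ?W" by (simp add: hom_iff)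
  \<comment> \<open>The projection on \<open>X \<odot> A\<close> is \<open>1e\<close> followed by a
    braiding, so its transpose is \<open>1e\<close> followed by the transpose \<open>j\<close> of
    that braiding. This is the second factorization.\<close>
  define j where "j = cur A X (\<c> A X)"
  have j: "j \<in> Arr C" "Dom C j = X" "Cod C j = IHomO C A ?W"
    using cur_hom[OF A_Obj X cX] by (auto simp: j_def hom_iff)
  have mono: "is_mono C j"
    unfolding is_mono_def
  proof (intro conjI allI ballI impI)
    show "j \<in> Arr C" by (fact j)
    fix W f g assume "f \<in> hom C W (Dom C j)" "g \<in> hom C W (Dom C j)" and eq: "j \<cdot> f = j \<cdot> g"
    then have f: "f \<in> hom C W X" and g: "g \<in> hom C W X" using j by simp_all
    have W: "W \<in> Obj C" using f by (auto simp: hom_iff)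
    note fg [simp] = f[unfolded hom_iff] g[unfolded hom_iff]
    have "\<c> A X \<cdot> \<one> A \<otimes> f = \<c> A X \<cdot> \<one> A \<otimes> g"
      using ev_cur_Comp[OF A_Obj X cX f] ev_cur_Comp[OF A_Obj X cX g] eq unfolding j_def by metis
    then have "f \<otimes> \<one> A \<cdot> \<c> A W = g \<otimes> \<one> A \<cdot> \<c> A W"
      using Braid_nat[of "\<one> A" A A f W X] Braid_nat[of "\<one> A" A A g W X] f g by (simp add: hom_iff)
    then have "f \<otimes> \<one> A = g \<otimes> \<one> A"
      by (rule epiD[OF iso_epi[OF Braid_iso], rotated 4]) (use W in \<open>simp_all add: hom_iff\<close>)
    \<comment> \<open>Density of the counit makes tensoring with \<open>A\<close> faithful:
      \<open>1e\<close> is natural and epic.\<close>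
    then have "f \<cdot> cap_right C e W = g \<cdot> cap_right C e W"
      using cap_right_nat[of f] cap_right_nat[of g] by simp
    then show "f = g"
      by (rule epiD[OF Q_epi[OF Q_cap(2)[OF W]], rotated 2]) (use W in \<open>simp_all add: hom_iff\<close>)
  qed
  have sq: "j \<cdot> ?q = i ?M \<cdot> p ?M"
  proof (rule ev_inj[OF A_Obj])
    have "Ev C A ?W \<cdot> \<one> A \<otimes> (j \<cdot> ?q) = proj ?M"
      unfolding j_def pr by (rule ev_cur_Comp[OF A_Obj X cX]) (simp add: hom_iff)
    also have "\<dots> = Ev C A ?W \<cdot> \<one> A \<otimes> (i ?M \<cdot> p ?M)"
      unfolding i_p[OF M] using ev_cur[OF A_Obj _ proj_hom[OF M]] by simp
    finally show "Ev C A ?W \<cdot> \<one> A \<otimes> (j \<cdot> ?q) = Ev C A ?W \<cdot> \<one> A \<otimes> (i ?M \<cdot> p ?M)" .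
  qed (use j in \<open>simp_all add: hom_iff\<close>)
  obtain d where "d \<in> hom C (Cod C (p ?M)) (Dom C j)" "d \<cdot> p ?M = ?q"
    by (rule strong_epi_diagonal[OF fact_simps(8)[OF M] mono, of ?q "i ?M"]) (use sq j in \<open>simp_all add: hom_iff\<close>)
  then have d: "d \<in> hom C (Vc ?M) X" "d \<cdot> p ?M = ?q" using j by simp_all
  obtain d' where "d' \<in> hom C (Cod C ?q) (Dom C (i ?M))" "d' \<cdot> ?q = p ?M"
    by (rule strong_epi_diagonal[OF q(2) fact_simps(9)[OF M], of "p ?M" j]) (use sq j in \<open>simp_all add: hom_iff\<close>)
  then have d': "d' \<in> hom C X (Vc ?M)" "d' \<cdot> ?q = p ?M" by simp_all
  have "d \<cdot> d' \<cdot> ?q = \<one> X \<cdot> ?q"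
    using d d' by (simp add: hom_iff)
  then have 1: "d \<cdot> d' = \<one> X"
    by (rule epiD[OF q(3), rotated 2]) (use d d' in \<open>simp_all add: hom_iff\<close>)
  have "d' \<cdot> d \<cdot> p ?M = \<one> (Vc ?M) \<cdot> p ?M"
    using d d' by (simp add: hom_iff)
  then have 2: "d' \<cdot> d = \<one> (Vc ?M)"
    by (rule epiD[OF fact_simps(10)[OF M], rotated 2]) (use d d' in \<open>simp_all add: hom_iff\<close>)
  have "inverse_arrows C d d'" using 1 2 d d' by (simp add: inverse_arrows_def hom_iff)
  then show ?thesis using d by (auto simp: is_iso_def)
qed

definition unit_iso :: "'o \<Rightarrow> 'a" where
  "unit_iso X = (SOME k. k \<in> hom C (Vc (fm X)) X \<and> is_iso C k \<and> k \<cdot> p (fm X) = cap_right C e X)"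

lemma unit_iso:
  assumes "X \<in> Obj C"
  shows "unit_iso X \<in> hom C (Vc (fm X)) X" "is_iso C (unit_iso X)" "unit_iso X \<cdot> p (fm X) = cap_right C e X"
  using someI_ex[OF free_coinvariants[OF assms]] by (simp_all add: unit_iso_def)

lemma unit_natural: "is_nat_iso C C (comp_functor G F) id_functor unit_iso"
  unfolding is_nat_iso_def is_nat_trans_def
proof (intro conjI ballI allI)
  show "is_functor C C (comp_functor G F)" by (rule is_functor_comp[OF free_is_functor G_is_functor])
  show "is_functor C C id_functor" by (rule is_functor_id) unfold_locales
  fix X assume X: "X \<in> Obj C"
  show "unit_iso X \<in> hom C (FObj (comp_functor G F) X) (FObj id_functor X)" "is_iso C (unit_iso X)"
    using unit_iso[OF X] by (simp_all add: comp_functor_def id_functor_def)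
next
  fix X Y f assume f: "f \<in> hom C X Y"
  then have o: "X \<in> Obj C" "Y \<in> Obj C" "f \<in> Arr C" "Dom C f = X" "Cod C f = Y" by (auto simp: hom_iff)
  let ?g = "FArr G (fm X, f \<otimes> \<one> A, fm Y)"
  note ha = free_hopf_arrow[OF f]
  note X = free_hopf[OF o(1)] and Y = free_hopf[OF o(2)]
  note u = unit_iso[OF o(1)] unit_iso[OF o(2)] and g = G_arrow(1,2)[OF ha]
  note s = fact_simps(1-4)[OF X] fact_simps(1-4)[OF Y] FM_simps(1)[OF o(1)] FM_simps(1)[OF o(2)]
  have "unit_iso Y \<cdot> ?g \<cdot> p (fm X) = unit_iso Y \<cdot> (?g \<cdot> p (fm X))"
    using u g(1) s by (simp del: G_simps add: hom_iff)
  also have "\<dots> = (unit_iso Y \<cdot> p (fm Y)) \<cdot> f \<otimes> \<one> A"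
    unfolding g(2) using u(1,4) s o by (simp add: hom_iff)
  also have "\<dots> = f \<cdot> (unit_iso X \<cdot> p (fm X))"
    unfolding u using cap_right_nat[of f] o by simp
  also have "\<dots> = f \<cdot> unit_iso X \<cdot> p (fm X)"
    using u s o by (simp add: hom_iff)
  finally have "unit_iso Y \<cdot> ?g = f \<cdot> unit_iso X"
    by (rule epiD[OF fact_simps(10)[OF X], rotated 2])
      (use u g(1) s o in \<open>simp_all del: G_simps add: hom_iff\<close>)
  then show "unit_iso Y \<cdot> FArr (comp_functor G F) f = FArr id_functor f \<cdot> unit_iso X"
    using o by (simp add: comp_functor_def id_functor_def del: G_simps)
qed

definition counit_iso :: "('o, 'a) hopf_data \<Rightarrow> ('o, 'a) hopf_data \<times> 'a \<times> ('o, 'a) hopf_data" where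
  "counit_iso M = (fm (Vc M), arr_inv C (comparison M), M)"

text \<open>Only \<open>comparison\<close> has a formula, namely on \<open>x a\<close>. Its
  naturality is checked there, after the epimorphism \<open>v\<close>, and then passed to the
  inverses.\<close>

lemma counit_natural: "is_nat_iso HC HC (comp_functor F G) id_functor counit_iso"
  unfolding is_nat_iso_def is_nat_trans_def
proof (intro conjI ballI allI)
  show "is_functor HC HC (comp_functor F G)" by (rule is_functor_comp[OF G_is_functor free_is_functor])
  show "is_functor HC HC id_functor" by (rule is_functor_id[OF HC_category])
  fix M assume "M \<in> Obj HC"
  then have M: "hopf_module C Q B M" by simp
  have a: "hopf_arrow (fm (Vc M)) M (arr_inv C (comparison M))"
    by (rule hopf_arrow_inv[OF comparison_hopf[OF M] comparison_iso[OF M]])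
  show "counit_iso M \<in> hom HC (FObj (comp_functor F G) M) (FObj id_functor M)"
    using a by (simp add: counit_iso_def comp_functor_def id_functor_def HC_hom)
  show "is_iso HC (counit_iso M)"
    unfolding counit_iso_def by (rule HC_iso[OF a]) (simp add: comparison_iso[OF M])
next
  fix M N Fh assume "Fh \<in> hom HC M N"
  then obtain h where h: "Fh = (M, h, N)" "hopf_arrow M N h" by (auto simp: HC_hom)
  note M = hopf_arrowD(1)[OF h(2)] and N = hopf_arrowD(2)[OF h(2)]
  let ?k = "FArr G (M, h, N)" and ?s = "comparison M" and ?t = "comparison N"
  note k = G_arrow(1,2)[OF h(2)]
  have k' [simp]: "?k \<in> Arr C" "Dom C ?k = Vc M" "Cod C ?k = Vc N"
    using k(1) by (auto simp: hom_iff simp del: G_simps)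
  note [simp del] = G_simps(2)
  note [simp] = hopf_arrowD(3-5)[OF h(2)] hopf_module_simps[OF M] hopf_module_simps[OF N]
    fact_simps[OF M] fact_simps[OF N] comparison_iso[OF M] comparison_iso[OF N]
  have st [simp]: "?s \<in> Arr C" "Dom C ?s = HObj M" "Cod C ?s = Vc M \<odot> A"
    "?t \<in> Arr C" "Dom C ?t = HObj N" "Cod C ?t = Vc N \<odot> A"
    using comparison(1)[OF M] comparison(1)[OF N] by (auto simp: hom_iff)
  have "?t \<cdot> h \<cdot> action C B M = ?t \<cdot> (action C B N \<cdot> h \<otimes> \<one> A)"
    unfolding hopf_arrow_action[OF h(2)] by simp
  also have "\<dots> = (?t \<cdot> action C B N) \<cdot> h \<otimes> \<one> A" by simp
  also have "\<dots> = p N \<otimes> \<one> A \<cdot> (Co1 N \<cdot> h \<otimes> \<one> A)"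
    unfolding comparison(2)[OF N] by simp
  also have "\<dots> = (p N \<cdot> h) \<otimes> \<one> A \<cdot> Co1 M"
    unfolding hopf_arrowD(6)[OF h(2)] by (simp add: Id_tensor_Comp)
  also have "\<dots> = ?k \<otimes> \<one> A \<cdot> (p M \<otimes> \<one> A \<cdot> Co1 M)"
    unfolding k(2)[symmetric] by (simp add: Id_tensor_Comp)
  also have "\<dots> = ?k \<otimes> \<one> A \<cdot> ?s \<cdot> action C B M"
    unfolding comparison(2)[OF M, symmetric] by simp
  finally have nat: "?t \<cdot> h = ?k \<otimes> \<one> A \<cdot> ?s"
    by (rule epiD[OF Q_epi[OF hopf_module_simps(17)[OF M]], rotated 2]) (simp_all add: hom_iff)
  have "arr_inv C ?t \<cdot> ?k \<otimes> \<one> A = arr_inv C ?t \<cdot> (?k \<otimes> \<one> A \<cdot> ?s) \<cdot> arr_inv C ?s"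
    by simp
  also have "\<dots> = h \<cdot> arr_inv C ?s"
    unfolding nat[symmetric] by simp
  finally show "counit_iso N \<cdot>\<^bsub>HC\<^esub> FArr (comp_functor F G) Fh = FArr id_functor Fh \<cdot>\<^bsub>HC\<^esub> counit_iso M"
    unfolding h(1) by (simp add: counit_iso_def comp_functor_def id_functor_def)
qed

lemma equivalence: "equivalence_with_inverse C HC F G"
  unfolding equivalence_with_inverse_def
  using free_is_functor G_is_functor unit_natural counit_natural by blast

end

theorem theorem6p4:
  fixes C :: "('o, 'a) cbmc_data"
    and Q :: "'a set"
    and B :: "('o, 'a) mult_data"
    and Vc :: "('o, 'a) hopf_data \<Rightarrow> 'o"
    and p i :: "('o, 'a) hopf_data \<Rightarrow> 'a"
  assumes "closed_braided_monoidal_category C"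
    and "admissible_class C Q"
    and "regular_multiplier_bimonoid C B"
    and "nondegenerate C (Car B) (mult C B)"
    and "Counit B \<in> Q"
    and "multiplier_hopf_monoid C (Car B) (T1 B) (T2 B) (Counit B)"
    and "\<And>V. hopf_module C Q B V \<Longrightarrow> coinvariants_factorization C B V (Vc V) (p V) (i V)"
  shows "equivalence_with_inverse C (hopf_cat C Q B)
           (free_functor C B) (coinvariants_functor C Vc p)"
proof -
  interpret closed_braided_monoidal_category C by (fact assms(1))
  interpret hopf_coinvariants C Q B Vc p i
    by unfold_locales (fact assms)+
  show ?thesis by (fact equivalence)
qed

end
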